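(* Let $M$ be a generic convex curve in $\mathbb{R}^2$. Then the number of cusps of $E_\lambda(M)$ for a generic $\lambda\neq\frac12$ is even, and the number of cusps of $E_{\frac12}(M)$ is odd.
   Context: A convex curve is a regular (nowhere vanishing velocity) simple closed $C^\infty$ curve in $\mathbb{R}^2$ whose curvature does not vanish. A pair of different points $a,b\in M$ is a parallel pair if the tangent lines $T_aM$ and $T_bM$ are parallel. For $\lambda\in\mathbb{R}$, $E_\lambda(M)=\{\lambda a+(1-\lambda)b : a,b\text{ is a parallel pair of }M\}$; $E_{\frac12}(M)$ is the Wigner caustic. On a convex curve $M=f(S^1)$ each point $a$ has exactly one partner $P(a)\neq a$ such that $a,P(a)$ is a parallel pair. The set $E_\lambda(M)$, $\lambda\ne\frac12$, is regarded as the closed curve parameterized by $S^1\ni s\mapsto\lambda f(s)+(1-\lambda)P(f(s))$. For $\lambda=\frac12$ this map is a double covering of the closed curve $E_{\frac12}(M)$ (since $a$ and $P(a)$ give the same point), and cusps of $E_{\frac12}(M)$ are counted on the quotient, i.e. once per unordered parallel pair $\{a,P(a)\}$. A cusp is an ordinary cusp singularity, i.e. the curve germ is diffeomorphic to $t\mapsto(t^2,t^3)$ at $0$. "Generic convex curve" means a convex curve belonging to a suitable residual set of convex curves (in the $C^\infty$ topology); "generic $\lambda$" means $\lambda$ in a suitable open dense set of real numbers (depending on $M$). Known fact implicit in the statement: for a generic convex curve $M$, $E_{\frac12}(M)$, and $E_\lambda(M)$ for a generic $\lambda$, are smooth closed curves (images of smooth maps of $S^1$) whose only singularities are cusps. 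*)

theory Defs
  imports "HOL-Analysis.Analysis"
begin

section \<open>Smooth maps and diffeomorphisms\<close>

text \<open>The domain \<open>S\<close> is meant to be open: all derivatives are taken in the full space.
  The next definition says that \<open>f\<close> is \<open>C\<^sup>k\<close>.\<close>

primrec times_differentiable_on ::
  "nat \<Rightarrow> 'a::euclidean_space set \<Rightarrow> ('a \<Rightarrow> 'b::real_normed_vector) \<Rightarrow> bool" where
  "times_differentiable_on 0 S f \<longleftrightarrow> continuous_on S f"
| "times_differentiable_on (Suc k) S f \<longleftrightarrow>
     (\<forall>x\<in>S. f differentiable (at x)) \<and>
     (\<forall>v. times_differentiable_on k S (\<lambda>x. frechet_derivative f (at x) v))"

definition smooth_on ::
  "'a::euclidean_space set \<Rightarrow> ('a \<Rightarrow> 'b::real_normed_vector) \<Rightarrow> bool" where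
  "smooth_on S f \<longleftrightarrow> (\<forall>k. times_differentiable_on k S f)"

definition diffeo_on ::
  "'a::euclidean_space set \<Rightarrow> 'b::euclidean_space set \<Rightarrow> ('a \<Rightarrow> 'b) \<Rightarrow> bool" where
  "diffeo_on U V \<phi> \<longleftrightarrow> open U \<and> open V \<and> smooth_on U \<phi> \<and>
     (\<exists>\<psi>. homeomorphism U V \<phi> \<psi> \<and> smooth_on V \<psi>)"

definition nth_deriv :: "nat \<Rightarrow> (real \<Rightarrow> 'b::real_normed_vector) \<Rightarrow> real \<Rightarrow> 'b" where
  "nth_deriv k f = ((\<lambda>g t. vector_derivative g (at t)) ^^ k) f"

section \<open>Closed plane curves and cusps\<close>

text \<open>Closed curves are maps from \<open>S\<^sup>1 = \<real> / 2\<pi>\<int>\<close>, encoded as \<open>2\<pi>\<close>-periodic maps on the real line.\<close>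

definition smooth_closed_curve :: "(real \<Rightarrow> real^2) \<Rightarrow> bool" where
  "smooth_closed_curve f \<longleftrightarrow> smooth_on UNIV f \<and> (\<forall>t. f (t + 2 * pi) = f t)"

definition curvature :: "(real \<Rightarrow> real^2) \<Rightarrow> real \<Rightarrow> real" where
  "curvature f t =
     (nth_deriv 1 f t $ 1 * nth_deriv 2 f t $ 2 - nth_deriv 1 f t $ 2 * nth_deriv 2 f t $ 1)
     / norm (nth_deriv 1 f t) ^ 3"

definition convex_curve :: "(real \<Rightarrow> real^2) \<Rightarrow> bool" where
  "convex_curve f \<longleftrightarrow> smooth_closed_curve f \<and> inj_on f {0..<2 * pi} \<and>
     (\<forall>t. nth_deriv 1 f t \<noteq> 0) \<and> (\<forall>t. curvature f t \<noteq> 0)"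

text \<open>The germ of \<open>\<gamma>\<close> at \<open>s\<close> is an ordinary cusp: up to diffeomorphism germs \<open>\<phi>\<close> of the source
  and \<open>\<psi>\<close> of the target it is the germ of \<open>t \<mapsto> (t\<^sup>2, t\<^sup>3)\<close> at \<open>0\<close>.\<close>

definition cusp_at :: "(real \<Rightarrow> real^2) \<Rightarrow> real \<Rightarrow> bool" where
  "cusp_at \<gamma> s \<longleftrightarrow>
     (\<exists>(U::real set) (I::real set) \<phi> (V::(real^2) set) (W::(real^2) set) \<psi>.
        diffeo_on U I \<phi> \<and> 0 \<in> U \<and> \<phi> 0 = s \<and>
        diffeo_on V W \<psi> \<and> \<gamma> ` I \<subseteq> V \<and>
        (\<forall>t\<in>U. \<psi> (\<gamma> (\<phi> t)) = vector [t ^ 2, t ^ 3]))"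

definition only_cusp_singularities :: "(real \<Rightarrow> real^2) \<Rightarrow> bool" where
  "only_cusp_singularities \<gamma> \<longleftrightarrow> smooth_closed_curve \<gamma> \<and>
     (\<forall>s. nth_deriv 1 \<gamma> s = 0 \<longrightarrow> cusp_at \<gamma> s)"

section \<open>Parallel pairs and affine equidistants\<close>

definition tangent_direction :: "(real \<Rightarrow> real^2) \<Rightarrow> real \<Rightarrow> (real^2) set" where
  "tangent_direction f s = span {nth_deriv 1 f s}"

definition parallel_pair :: "(real \<Rightarrow> real^2) \<Rightarrow> real^2 \<Rightarrow> real^2 \<Rightarrow> bool" where
  "parallel_pair f a b \<longleftrightarrow> a \<noteq> b \<and>
     (\<exists>s t. f s = a \<and> f t = b \<and> tangent_direction f s = tangent_direction f t)"

text \<open>On a convex curve the partner of a point exists and is unique.\<close>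

definition partner :: "(real \<Rightarrow> real^2) \<Rightarrow> real^2 \<Rightarrow> real^2" where
  "partner f a = (THE b. parallel_pair f a b)"

text \<open>The affine equidistant \<open>E\<^sub>l(M)\<close> of \<open>M = range f\<close>, as a closed curve parameterized by \<open>S\<^sup>1\<close>;
  its range is the set of all \<open>l a + (1 - l) b\<close> with \<open>a, b\<close> a parallel pair.
  For \<open>l = 1/2\<close> this parameterization is a double covering of the Wigner caustic.\<close>

definition equidistant :: "real \<Rightarrow> (real \<Rightarrow> real^2) \<Rightarrow> real \<Rightarrow> real^2" where
  "equidistant l f s = l *\<^sub>R f s + (1 - l) *\<^sub>R partner f (f s)"

definition equidistant_cusps :: "real \<Rightarrow> (real \<Rightarrow> real^2) \<Rightarrow> real set" where
  "equidistant_cusps l f = {s \<in> {0..<2 * pi}. cusp_at (equidistant l f) s}"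

text \<open>Cusps of the Wigner caustic are indexed by unordered parallel pairs.\<close>

definition wigner_cusps :: "(real \<Rightarrow> real^2) \<Rightarrow> (real^2) set set" where
  "wigner_cusps f = {{f s, partner f (f s)} | s. cusp_at (equidistant (1/2) f) s}"

section \<open>Genericity\<close>

definition Cinf_ball :: "(real \<Rightarrow> real^2) \<Rightarrow> nat \<Rightarrow> real \<Rightarrow> (real \<Rightarrow> real^2) set" where
  "Cinf_ball f k e = {g. smooth_closed_curve g \<and>
     (\<forall>j\<le>k. \<forall>t. dist (nth_deriv j g t) (nth_deriv j f t) < e)}"

text \<open>The \<open>C\<^sup>\<infinity>\<close> topology (uniform convergence of all derivatives) on smooth closed curves.
  By periodicity the pointwise strict bounds above are bounds on the supremum norms.\<close>

definition Cinf_topology :: "(real \<Rightarrow> real^2) topology" where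
  "Cinf_topology = topology_generated_by
     {Cinf_ball f k e | f k e. smooth_closed_curve f \<and> 0 < e}"

definition convex_curve_topology :: "(real \<Rightarrow> real^2) topology" where
  "convex_curve_topology = subtopology Cinf_topology {f. convex_curve f}"

definition residual_in :: "'a topology \<Rightarrow> 'a set \<Rightarrow> bool" where
  "residual_in X S \<longleftrightarrow> S \<subseteq> topspace X \<and>
     (\<exists>\<U>. countable \<U> \<and> (\<forall>U\<in>\<U>. openin X U \<and> X closure_of U = topspace X) \<and>
          topspace X \<inter> \<Inter>\<U> \<subseteq> S)"

end

theory Submission
  imports Defs
begin

text \<open>Parameterise a convex curve by its tangent angle, \<open>F' = \<rho> e\<close> with \<open>e(\<theta>)\<close> the unit tangent and
  \<open>\<rho> > 0\<close> the radius of curvature; that the angle makes exactly one turn is the theorem of turning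
  tangents. Parallel pairs are \<open>F \<theta>, F (\<theta> + \<pi>)\<close>, so the \<open>\<lambda>\<close>-equidistant has derivative
  \<open>(\<lambda> \<rho> \<theta> - (1 - \<lambda>) \<rho> (\<theta> + \<pi>)) e(\<theta>)\<close>, a positive multiple of \<open>(\<lambda> - q \<theta>) e(\<theta>)\<close> where
  \<open>q \<theta> = \<rho> (\<theta> + \<pi>) / (\<rho> \<theta> + \<rho> (\<theta> + \<pi>))\<close>. If \<open>\<lambda>\<close> is a regular value of \<open>q\<close>, the cusps are exactly
  the zeros of \<open>\<lambda> - q\<close>, all simple. A periodic function has an even number of simple zeros per period,
  while \<open>1/2 - q\<close> changes sign under \<open>\<theta> \<mapsto> \<theta> + \<pi>\<close> and has an odd number of zeros in a half period.
  Sard's theorem makes almost every \<open>\<lambda>\<close> regular, and Thom's transversality argument shows that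
  \<open>1/2\<close> is regular for an open dense set of curves.\<close>

section \<open>Smooth functions\<close>

text \<open>Two obstacles shape the proof. First, \<open>cusp_at\<close> asks for genuine
  diffeomorphisms onto the germ of (t^2, t^3), so linear independence of the second and third
  derivatives has to be turned into a normal form. This needs Whitney's theorem that a smooth even
  function of t is a smooth function of t^2. The cusp itself only visits nonnegative x, but the
  diffeomorphism of the plane must be defined for x on both sides of 0; the extension to negative x
  is where Borel's theorem enters. Second, the topology lives on parameterized curves, while
  regularity of 1/2 is visible in the tangent angle, whose dependence on the curve would be awkward
  to control. Failure of regularity is therefore restated as a closed condition on the 3-jets at two
  parameter values: an antiparallel pair with equal curvature and equal arc-length derivative of
  curvature. Openness then follows by compactness of the square of parameters. For density the angle
  function is kept fixed and only the radius of curvature is changed, so that convexity of the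
  perturbed curve, injectivity included, follows from the angle data alone.\<close>

lemma times_differentiable_cong:
  assumes "open S" "\<And>x. x \<in> S \<Longrightarrow> f x = g x"
  shows "times_differentiable_on k S f = times_differentiable_on k S g"
  using assms(2)
proof (induction k arbitrary: f g)
  case 0
  then show ?case by (simp cong: continuous_on_cong)
next
  case (Suc k)
  have D: "(f has_derivative D) (at x) \<longleftrightarrow> (g has_derivative D) (at x)" if "x \<in> S" for x D
    using has_derivative_transform_within_open[OF _ \<open>open S\<close> that] Suc.prems by metis
  then have "frechet_derivative f (at x) = frechet_derivative g (at x)" if "x \<in> S" for x
    unfolding frechet_derivative_def using that by simp
  then show ?case
    using D Suc.IH[of "\<lambda>x. frechet_derivative f (at x) v" "\<lambda>x. frechet_derivative g (at x) v" for v]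
    by (auto simp: differentiable_def)
qed

text \<open>An explicit derivative is substituted for the choice-based
  \<open>frechet_derivative\<close>; together with the converse
  \<open>times_differentiable_SucD\<close> this carries the inductions on the order below.\<close>

lemma times_differentiable_SucI:
  assumes "open S" "\<And>x. x \<in> S \<Longrightarrow> (f has_derivative f' x) (at x)"
    and "\<And>v. times_differentiable_on k S (\<lambda>x. f' x v)"
  shows "times_differentiable_on (Suc k) S f"
proof -
  have "times_differentiable_on k S (\<lambda>x. frechet_derivative f (at x) v)" for v
    using times_differentiable_cong[of S "\<lambda>x. frechet_derivative f (at x) v" "\<lambda>x. f' x v" k] assms
      frechet_derivative_at[OF assms(2)] by (metis (full_types))
  then show ?thesis using assms(2) by (auto simp: differentiable_def)
qed

lemma times_differentiable_SucD:
  assumes "times_differentiable_on (Suc k) S f"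
  obtains f' where "\<And>x. x \<in> S \<Longrightarrow> (f has_derivative f' x) (at x)"
    "\<And>v. times_differentiable_on k S (\<lambda>x. f' x v)"
  using assms frechet_derivative_works by (metis times_differentiable_on.simps(2))

lemma times_differentiable_Suc_imp: "times_differentiable_on (Suc k) S f \<Longrightarrow> times_differentiable_on k S f"
proof (induction k arbitrary: f)
  case 0
  then show ?case
    by (auto intro!: continuous_at_imp_continuous_on differentiable_imp_continuous_within)
next
  case (Suc k)
  then show ?case by (simp del: times_differentiable_on.simps add: times_differentiable_on.simps(2)[of _ S f])
qed

lemma times_differentiable_const: "open S \<Longrightarrow> times_differentiable_on k S (\<lambda>x. c)"
proof (induction k arbitrary: c)
  case (Suc k)
  then show ?case by (intro times_differentiable_SucI[where f'="\<lambda>x v. 0"]) auto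
qed simp

lemma times_differentiable_linear:
  assumes "bounded_linear h" "open S" "times_differentiable_on k S f"
  shows "times_differentiable_on k S (\<lambda>x. h (f x))"
  using assms(3)
proof (induction k arbitrary: f)
  case 0
  then show ?case using assms by (auto intro: bounded_linear.continuous_on)
next
  case (Suc k)
  obtain f' where f': "\<And>x. x \<in> S \<Longrightarrow> (f has_derivative f' x) (at x)"
    "\<And>v. times_differentiable_on k S (\<lambda>x. f' x v)"
    using times_differentiable_SucD[OF Suc.prems] by blast
  show ?case
    by (rule times_differentiable_SucI[where f'="\<lambda>x v. h (f' x v)"])
      (use f' assms Suc.IH in \<open>auto intro: bounded_linear.has_derivative\<close>)
qed

lemma times_differentiable_id: "open S \<Longrightarrow> times_differentiable_on k S (\<lambda>x. x)"
  by (cases k) (auto intro!: times_differentiable_SucI[where f'="\<lambda>x v. v"] times_differentiable_const simp del: times_differentiable_on.simps(2))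

lemma times_differentiable_add:
  assumes "open S" "times_differentiable_on k S f" "times_differentiable_on k S g"
  shows "times_differentiable_on k S (\<lambda>x. f x + g x)"
  using assms(2,3)
proof (induction k arbitrary: f g)
  case 0
  then show ?case by (auto intro: continuous_intros)
next
  case (Suc k)
  obtain f' where f': "\<And>x. x \<in> S \<Longrightarrow> (f has_derivative f' x) (at x)"
    "\<And>v. times_differentiable_on k S (\<lambda>x. f' x v)"
    using times_differentiable_SucD[OF Suc.prems(1)] by blast
  obtain g' where g': "\<And>x. x \<in> S \<Longrightarrow> (g has_derivative g' x) (at x)"
    "\<And>v. times_differentiable_on k S (\<lambda>x. g' x v)"
    using times_differentiable_SucD[OF Suc.prems(2)] by blast
  show ?case
    by (rule times_differentiable_SucI[where f'="\<lambda>x v. f' x v + g' x v"])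
      (use f' g' assms Suc.IH in \<open>auto intro: has_derivative_add\<close>)
qed

lemma times_differentiable_sum:
  assumes "open S" "\<And>i. i \<in> I \<Longrightarrow> times_differentiable_on k S (f i)"
  shows "times_differentiable_on k S (\<lambda>x. \<Sum>i\<in>I. f i x)"
  using assms(2) by (induction I rule: infinite_finite_induct) (auto intro: times_differentiable_const times_differentiable_add assms(1))

lemma times_differentiable_bilinear:
  assumes "bounded_bilinear B" "open S" "times_differentiable_on k S f" "times_differentiable_on k S g"
  shows "times_differentiable_on k S (\<lambda>x. B (f x) (g x))"
  using assms(3,4)
proof (induction k arbitrary: f g)
  case 0
  then show ?case using bounded_bilinear.continuous_on[OF assms(1)] by auto
next
  case (Suc k)
  obtain f' where f': "\<And>x. x \<in> S \<Longrightarrow> (f has_derivative f' x) (at x)"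
    "\<And>v. times_differentiable_on k S (\<lambda>x. f' x v)"
    using times_differentiable_SucD[OF Suc.prems(1)] by blast
  obtain g' where g': "\<And>x. x \<in> S \<Longrightarrow> (g has_derivative g' x) (at x)"
    "\<And>v. times_differentiable_on k S (\<lambda>x. g' x v)"
    using times_differentiable_SucD[OF Suc.prems(2)] by blast
  show ?case
    by (rule times_differentiable_SucI[where f'="\<lambda>x v. B (f x) (g' x v) + B (f' x v) (g x)"])
      (use f' g' assms Suc.IH times_differentiable_Suc_imp[OF Suc.prems(1)] times_differentiable_Suc_imp[OF Suc.prems(2)]
        in \<open>auto intro!: bounded_bilinear.FDERIV times_differentiable_add\<close>)
qed

lemma times_differentiable_compose:
  fixes f :: "'a::euclidean_space \<Rightarrow> 'b::euclidean_space" and g :: "'b \<Rightarrow> 'c::real_normed_vector"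
  assumes "open S" "open T" "f ` S \<subseteq> T" "times_differentiable_on k T g" "times_differentiable_on k S f"
  shows "times_differentiable_on k S (\<lambda>x. g (f x))"
  using assms(4,5)
proof (induction k arbitrary: g)
  case 0
  then show ?case using assms(3) by (auto intro: continuous_on_compose2)
next
  case (Suc k)
  obtain f' where f': "\<And>x. x \<in> S \<Longrightarrow> (f has_derivative f' x) (at x)"
    "\<And>v. times_differentiable_on k S (\<lambda>x. f' x v)"
    using times_differentiable_SucD[OF Suc.prems(2)] by blast
  obtain g' where g': "\<And>x. x \<in> T \<Longrightarrow> (g has_derivative g' x) (at x)"
    "\<And>v. times_differentiable_on k T (\<lambda>x. g' x v)"
    using times_differentiable_SucD[OF Suc.prems(1)] by blast
  \<comment> \<open>The direction \<open>f' x v\<close> moves with \<open>x\<close>, while the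
    induction hypothesis concerns fixed directions. Expansion in the basis leaves only
    \<open>g' (f x) b\<close> with constant \<open>b\<close>.\<close>
  have eq: "g' (f x) (f' x v) = (\<Sum>b\<in>Basis. (f' x v \<bullet> b) *\<^sub>R g' (f x) b)" if "x \<in> S" for x v
  proof -
    have "linear (g' (f x))" using g'(1)[of "f x"] assms(3) that has_derivative_linear by blast
    then have "g' (f x) (\<Sum>b\<in>Basis. (f' x v \<bullet> b) *\<^sub>R b) = (\<Sum>b\<in>Basis. (f' x v \<bullet> b) *\<^sub>R g' (f x) b)"
      by (simp add: linear_sum linear_cmul)
    then show ?thesis by (simp add: euclidean_representation)
  qed
  have "times_differentiable_on k S (\<lambda>x. \<Sum>b\<in>Basis. (f' x v \<bullet> b) *\<^sub>R g' (f x) b)" for v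
    using f'(2) g'(2) Suc.IH times_differentiable_Suc_imp[OF Suc.prems(2)] assms(1)
    by (auto intro!: times_differentiable_sum times_differentiable_bilinear[OF bounded_bilinear_scaleR]
        times_differentiable_linear[OF bounded_linear_inner_left])
  then have "times_differentiable_on k S (\<lambda>x. g' (f x) (f' x v))" for v
    using times_differentiable_cong[OF assms(1), where k=k and f="\<lambda>x. g' (f x) (f' x v)"] eq by simp
  moreover have "((\<lambda>x. g (f x)) has_derivative (\<lambda>v. g' (f x) (f' x v))) (at x)" if "x \<in> S" for x
    using has_derivative_compose[OF f'(1)[OF that]] g'(1)[of "f x"] assms(3) that by auto
  ultimately show ?case by (intro times_differentiable_SucI[OF assms(1), where f'="\<lambda>x v. g' (f x) (f' x v)"])
qed

lemma times_differentiable_subset: "S \<subseteq> T \<Longrightarrow> times_differentiable_on k T f \<Longrightarrow> times_differentiable_on k S f"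
  by (induction k arbitrary: f) (auto intro: continuous_on_subset)

lemma smooth_on_cong:
  "open S \<Longrightarrow> (\<And>x. x \<in> S \<Longrightarrow> f x = g x) \<Longrightarrow> smooth_on S f = smooth_on S g"
  unfolding smooth_on_def using times_differentiable_cong by blast

lemma smooth_on_const: "open S \<Longrightarrow> smooth_on S (\<lambda>x. c)"
  and smooth_on_id: "open S \<Longrightarrow> smooth_on S (\<lambda>x. x)"
  and smooth_on_add: "open S \<Longrightarrow> smooth_on S f \<Longrightarrow> smooth_on S g \<Longrightarrow> smooth_on S (\<lambda>x. f x + g x)"
  and smooth_on_linear: "bounded_linear h \<Longrightarrow> open S \<Longrightarrow> smooth_on S f \<Longrightarrow> smooth_on S (\<lambda>x. h (f x))"
  and smooth_on_bilinear: "bounded_bilinear B \<Longrightarrow> open S \<Longrightarrow> smooth_on S f' \<Longrightarrow> smooth_on S g'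
      \<Longrightarrow> smooth_on S (\<lambda>x. B (f' x) (g' x))"
  and smooth_on_subset: "S \<subseteq> T \<Longrightarrow> smooth_on T f \<Longrightarrow> smooth_on S f"
  unfolding smooth_on_def
  by (auto intro: times_differentiable_const times_differentiable_id times_differentiable_add times_differentiable_linear times_differentiable_bilinear times_differentiable_subset)

lemma smooth_on_compose:
  fixes f :: "'a::euclidean_space \<Rightarrow> 'b::euclidean_space" and g :: "'b \<Rightarrow> 'c::real_normed_vector"
  assumes "open S" "open T" "f ` S \<subseteq> T" "smooth_on T g" "smooth_on S f"
  shows "smooth_on S (\<lambda>x. g (f x))"
  using assms times_differentiable_compose unfolding smooth_on_def by blast

lemma smooth_on_compose_UNIV:
  fixes f :: "'a::euclidean_space \<Rightarrow> 'b::euclidean_space" and g :: "'b \<Rightarrow> 'c::real_normed_vector"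
  assumes "open S" "smooth_on UNIV g" "smooth_on S f"
  shows "smooth_on S (\<lambda>x. g (f x))"
  using assms smooth_on_compose[of S UNIV] by auto

lemma smooth_on_scaleR: "open S \<Longrightarrow> smooth_on S f \<Longrightarrow> smooth_on S g \<Longrightarrow> smooth_on S (\<lambda>x. f x *\<^sub>R g x)"
  by (rule smooth_on_bilinear[OF bounded_bilinear_scaleR])

lemma smooth_on_mult:
  fixes f g :: "'a::euclidean_space \<Rightarrow> real"
  shows "open S \<Longrightarrow> smooth_on S f \<Longrightarrow> smooth_on S g \<Longrightarrow> smooth_on S (\<lambda>x. f x * g x)"
  by (rule smooth_on_bilinear[OF bounded_bilinear_mult])

lemma smooth_on_minus: "open S \<Longrightarrow> smooth_on S f \<Longrightarrow> smooth_on S (\<lambda>x. - f x)"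
  by (rule smooth_on_linear[OF bounded_linear_minus[OF bounded_linear_ident]])

lemma smooth_on_diff: "open S \<Longrightarrow> smooth_on S f \<Longrightarrow> smooth_on S g \<Longrightarrow> smooth_on S (\<lambda>x. f x - g x)"
  using smooth_on_add[of S f "\<lambda>x. - g x"] smooth_on_minus[of S g] by simp

lemma smooth_on_power:
  fixes f :: "'a::euclidean_space \<Rightarrow> real"
  shows "open S \<Longrightarrow> smooth_on S f \<Longrightarrow> smooth_on S (\<lambda>x. f x ^ n)"
  by (induction n) (auto intro: smooth_on_const smooth_on_mult)

lemma smooth_on_nth: "open S \<Longrightarrow> smooth_on S f \<Longrightarrow> smooth_on S (\<lambda>x. f x $ i)"
  by (rule smooth_on_linear[OF bounded_linear_vec_nth])

lemma smooth_on_imp_continuous: "smooth_on S f \<Longrightarrow> continuous_on S f"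
  unfolding smooth_on_def by (metis times_differentiable_on.simps(1))

lemma smooth_on_differentiable: "smooth_on S f \<Longrightarrow> x \<in> S \<Longrightarrow> f differentiable (at x)"
  unfolding smooth_on_def by (metis times_differentiable_on.simps(2))

section \<open>Smooth functions of one real variable\<close>

lemma times_differentiable_real_SucI:
  fixes f :: "real \<Rightarrow> 'b::real_normed_vector"
  assumes "open S" "\<And>x. x \<in> S \<Longrightarrow> (f has_vector_derivative f' x) (at x)"
    and "times_differentiable_on k S f'"
  shows "times_differentiable_on (Suc k) S f"
  by (rule times_differentiable_SucI[OF assms(1) assms(2)[unfolded has_vector_derivative_def]])
    (auto intro: assms times_differentiable_linear[OF bounded_linear_scaleR_right])

lemma times_differentiable_real_SucD:
  fixes f :: "real \<Rightarrow> 'b::real_normed_vector"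
  assumes "open S" "times_differentiable_on (Suc k) S f"
  shows "times_differentiable_on k S (\<lambda>x. vector_derivative f (at x))"
    and "x \<in> S \<Longrightarrow> (f has_vector_derivative vector_derivative f (at x)) (at x)"
proof -
  have d: "f differentiable (at x)" if "x \<in> S" for x using assms that by auto
  have "times_differentiable_on k S (\<lambda>x. frechet_derivative f (at x) 1)" using assms by auto
  then show "times_differentiable_on k S (\<lambda>x. vector_derivative f (at x))"
    using times_differentiable_cong[OF assms(1), of "\<lambda>x. frechet_derivative f (at x) 1" "\<lambda>x. vector_derivative f (at x)" k]
      d by (simp add: frechet_derivative_eq_vector_derivative)
  show "x \<in> S \<Longrightarrow> (f has_vector_derivative vector_derivative f (at x)) (at x)"
    using d vector_derivative_works by blast
qed

text \<open>A whole tower of candidate derivatives certifies each of its members at once. This suits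
  functions given by integrals and functions glued from two halves, where all orders have to be
  checked anyway.\<close>

lemma smooth_on_real_seqI:
  fixes D :: "nat \<Rightarrow> real \<Rightarrow> 'b::real_normed_vector"
  assumes "open S" "\<And>n x. x \<in> S \<Longrightarrow> (D n has_vector_derivative D (Suc n) x) (at x)"
  shows "smooth_on S (D n)"
proof -
  have "times_differentiable_on k S (D n)" for k n
  proof (induction k arbitrary: n)
    case 0
    then show ?case
      by (auto intro!: continuous_at_imp_continuous_on assms(2) intro: has_vector_derivative_continuous)
  next
    case (Suc k)
    show ?case by (rule times_differentiable_real_SucI[OF assms(1) assms(2) Suc])
  qed
  then show ?thesis unfolding smooth_on_def by blast
qed

lemma smooth_on_vector_derivative:
  fixes f :: "real \<Rightarrow> 'b::real_normed_vector"
  assumes "open S" "smooth_on S f"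
  shows "smooth_on S (\<lambda>x. vector_derivative f (at x))"
  using assms times_differentiable_real_SucD(1) unfolding smooth_on_def by blast

lemma smooth_on_has_vector_derivative:
  fixes f :: "real \<Rightarrow> 'b::real_normed_vector"
  assumes "open S" "smooth_on S f" "x \<in> S"
  shows "(f has_vector_derivative vector_derivative f (at x)) (at x)"
  using assms times_differentiable_real_SucD(2) unfolding smooth_on_def by blast

lemma smooth_on_derivI:
  fixes f :: "real \<Rightarrow> 'b::real_normed_vector"
  assumes "open S" "\<And>x. x \<in> S \<Longrightarrow> (f has_vector_derivative f' x) (at x)" "smooth_on S f'"
  shows "smooth_on S f"
  unfolding smooth_on_def
proof
  fix k show "times_differentiable_on k S f"
    using times_differentiable_Suc_imp[OF times_differentiable_real_SucI[OF assms(1,2)]] assms(3) unfolding smooth_on_def by blast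
qed

lemma smooth_on_derivD:
  fixes f :: "real \<Rightarrow> 'b::real_normed_vector"
  assumes "open S" "smooth_on S f" "\<And>x. x \<in> S \<Longrightarrow> (f has_vector_derivative f' x) (at x)"
  shows "smooth_on S f'"
  using smooth_on_vector_derivative[OF assms(1,2)] smooth_on_cong[OF assms(1)]
    vector_derivative_at[OF assms(3)] by (metis (no_types, lifting))

section \<open>Iterated derivatives and elementary functions\<close>

lemma nth_deriv_0 [simp]: "nth_deriv 0 f = f"
  and nth_deriv_Suc: "nth_deriv (Suc n) f = (\<lambda>t. vector_derivative (nth_deriv n f) (at t))"
  by (simp_all add: nth_deriv_def)

lemma nth_deriv_1: "nth_deriv 1 f = (\<lambda>t. vector_derivative f (at t))"
  using nth_deriv_Suc[of 0 f] by simp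

lemma smooth_on_nth_deriv:
  fixes f :: "real \<Rightarrow> 'b::real_normed_vector"
  assumes "open S" "smooth_on S f"
  shows "smooth_on S (nth_deriv n f)"
  by (induction n) (simp_all add: nth_deriv_Suc smooth_on_vector_derivative assms)

lemma nth_deriv_has_derivative:
  fixes f :: "real \<Rightarrow> 'b::real_normed_vector"
  assumes "open S" "smooth_on S f" "x \<in> S"
  shows "(nth_deriv n f has_vector_derivative nth_deriv (Suc n) f x) (at x)"
  unfolding nth_deriv_Suc
  by (rule smooth_on_has_vector_derivative[OF assms(1) smooth_on_nth_deriv[OF assms(1,2)] assms(3)])

lemma nth_deriv_eqI:
  fixes D :: "nat \<Rightarrow> real \<Rightarrow> 'b::real_normed_vector"
  assumes "\<And>n x. (D n has_vector_derivative D (Suc n) x) (at x)"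
  shows "nth_deriv n (D 0) = D n"
  by (induction n) (auto simp: nth_deriv_Suc vector_derivative_at assms)

text \<open>The derivative of \<open>inverse\<close> is a polynomial in \<open>inverse\<close>, so
  the order of differentiability climbs by induction.\<close>

lemma smooth_on_inverse: "smooth_on (-{0}) (inverse :: real \<Rightarrow> real)"
proof -
  have "times_differentiable_on k (-{0}) (inverse :: real \<Rightarrow> real)" for k
  proof (induction k)
    case 0
    show ?case by (auto intro: continuous_intros)
  next
    case (Suc k)
    show ?case
    proof (rule times_differentiable_real_SucI[where f'="\<lambda>x. - (inverse x * inverse x)"])
      show "times_differentiable_on k (- {0}) (\<lambda>x::real. - (inverse x * inverse x))"
        using Suc by (intro times_differentiable_linear[OF bounded_linear_minus[OF bounded_linear_ident]]
            times_differentiable_bilinear[OF bounded_bilinear_mult]) auto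
    qed (auto simp: has_real_derivative_iff_has_vector_derivative[symmetric] intro!: derivative_eq_intros)
  qed
  then show ?thesis unfolding smooth_on_def by blast
qed

lemma smooth_on_divide:
  fixes f g :: "'a::euclidean_space \<Rightarrow> real"
  assumes "open S" "smooth_on S f" "smooth_on S g" "\<And>x. x \<in> S \<Longrightarrow> g x \<noteq> 0"
  shows "smooth_on S (\<lambda>x. f x / g x)"
proof -
  have "smooth_on S (\<lambda>x. inverse (g x))"
    by (rule smooth_on_compose[OF assms(1) _ _ smooth_on_inverse assms(3)]) (use assms(4) in auto)
  then show ?thesis by (simp add: divide_inverse smooth_on_mult assms)
qed

lemma smooth_on_sqrt: "smooth_on {0<..} sqrt"
proof -
  have "times_differentiable_on k {0<..} sqrt" for k
  proof (induction k)
    case 0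
    show ?case by (auto intro: continuous_intros)
  next
    case (Suc k)
    show ?case
    proof (rule times_differentiable_real_SucI[where f'="\<lambda>x. inverse (sqrt x) / 2"])
      have "times_differentiable_on k {0<..} (\<lambda>x. inverse (sqrt x))"
        using smooth_on_inverse
        by (intro times_differentiable_compose[where T="-{0}" and g=inverse, OF _ _ _ _ Suc]) (auto simp: smooth_on_def)
      then show "times_differentiable_on k {0<..} (\<lambda>x::real. inverse (sqrt x) / 2)"
        by (rule times_differentiable_linear[OF bounded_linear_divide open_greaterThan])
    qed (auto simp: has_real_derivative_iff_has_vector_derivative[symmetric] intro!: derivative_eq_intros)
  qed
  then show ?thesis unfolding smooth_on_def by blast
qed

lemma smooth_on_sqrt_comp:
  fixes f :: "'a::euclidean_space \<Rightarrow> real"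
  assumes "open S" "smooth_on S f" "\<And>x. x \<in> S \<Longrightarrow> 0 < f x"
  shows "smooth_on S (\<lambda>x. sqrt (f x))"
  by (rule smooth_on_compose[OF assms(1) _ _ smooth_on_sqrt assms(2)]) (use assms(3) in auto)

text \<open>Differentiation shifts the cosine by \<open>pi/2\<close>, so the shifted cosines form a
  closed tower of derivatives; the sine is the shift by \<open>-(pi/2)\<close>.\<close>

lemma smooth_on_cos_shift: "smooth_on UNIV (\<lambda>x::real. cos (x + a))"
proof -
  have "smooth_on UNIV ((\<lambda>n x. cos (x + a + real n * (pi/2))) 0)"
    by (rule smooth_on_real_seqI[OF open_UNIV])
      (auto simp: has_real_derivative_iff_has_vector_derivative[symmetric] algebra_simps add_divide_distrib
          cos_add sin_add intro!: derivative_eq_intros)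
  then show ?thesis by simp
qed

lemma smooth_on_cos: "open S \<Longrightarrow> smooth_on S f \<Longrightarrow> smooth_on S (\<lambda>x. cos (f x :: real))"
  using smooth_on_compose_UNIV[OF _ smooth_on_cos_shift[of 0]] by simp

lemma smooth_on_sin: "open S \<Longrightarrow> smooth_on S f \<Longrightarrow> smooth_on S (\<lambda>x. sin (f x :: real))"
  using smooth_on_compose_UNIV[OF _ smooth_on_cos_shift[of "-(pi/2)"]] by (simp add: cos_diff)

lemma smooth_on_vector2:
  fixes f g :: "'a::euclidean_space \<Rightarrow> real"
  assumes "open S" "smooth_on S f" "smooth_on S g"
  shows "smooth_on S (\<lambda>x. vector [f x, g x] :: real^2)"
proof -
  have eq: "vector [f x, g x] = f x *\<^sub>R (vector [1,0] :: real^2) + g x *\<^sub>R vector [0,1]" for x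
    by (simp add: vec_eq_iff forall_2)
  show ?thesis unfolding eq
    by (intro smooth_on_add smooth_on_scaleR smooth_on_const assms)
qed

text \<open>Bootstrapping: the derivative of \<open>\<psi>\<close> is the reciprocal of the
  derivative of \<open>\<phi>\<close>, evaluated at \<open>\<psi>\<close> itself, so each order of
  differentiability of \<open>\<psi>\<close> yields the next.\<close>

lemma times_differentiable_inverse_function:
  fixes \<phi> \<psi> :: "real \<Rightarrow> real"
  assumes "open S" "open T" "smooth_on S \<phi>" "\<psi> ` T \<subseteq> S" "\<And>y. y \<in> T \<Longrightarrow> \<phi> (\<psi> y) = y"
    "continuous_on T \<psi>" "\<And>x. x \<in> S \<Longrightarrow> vector_derivative \<phi> (at x) \<noteq> 0"
  shows "times_differentiable_on k T \<psi>"
proof (induction k)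
  case 0
  then show ?case using assms by simp
next
  case (Suc k)
  let ?d = "\<lambda>x. vector_derivative \<phi> (at x)"
  have "(\<psi> has_vector_derivative 1 / ?d (\<psi> y)) (at y)" if y: "y \<in> T" for y
  proof -
    obtain e where e: "e > 0" "ball y e \<subseteq> T" using \<open>open T\<close> y open_contains_ball by metis
    have S: "\<psi> y \<in> S" using y assms by auto
    have "DERIV \<phi> (\<psi> y) :> ?d (\<psi> y)"
      using smooth_on_has_vector_derivative[OF assms(1,3) S] by (simp add: has_real_derivative_iff_has_vector_derivative)
    moreover have "isCont \<psi> y" using assms(2,6) y continuous_on_eq_continuous_at by blast
    moreover have "z \<in> T" if "y - e < z" "z < y + e" for z
      using e(2) that by (auto simp: subset_iff dist_real_def)
    ultimately have "DERIV \<psi> y :> inverse (?d (\<psi> y))"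
      using e(1) assms(5) assms(7)[OF S]
      by (intro DERIV_inverse_function[where f=\<phi> and a="y - e" and b="y + e"]) auto
    then show ?thesis by (simp add: has_real_derivative_iff_has_vector_derivative field_simps)
  qed
  moreover have "smooth_on S (\<lambda>x. 1 / ?d x)"
    by (intro smooth_on_divide smooth_on_const smooth_on_vector_derivative assms)
  then have "times_differentiable_on k T (\<lambda>y. 1 / ?d (\<psi> y))"
    using times_differentiable_compose[OF assms(2,1,4) _ Suc, of "\<lambda>x. 1 / ?d x"] by (simp add: smooth_on_def)
  ultimately show ?case by (rule times_differentiable_real_SucI[OF assms(2)])
qed

text \<open>A positive derivative makes the map strictly increasing on the interval; in one
  dimension a continuous injection is open and has a continuous inverse, which the previous lemma
  makes smooth.\<close>

lemma diffeo_on_real: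
  fixes \<phi> :: "real \<Rightarrow> real"
  assumes "open S" "connected S" "smooth_on S \<phi>" "\<And>x. x \<in> S \<Longrightarrow> vector_derivative \<phi> (at x) > 0"
  shows "diffeo_on S (\<phi> ` S) \<phi>" and "inj_on \<phi> S"
proof -
  have "\<phi> x < \<phi> y" if "x \<in> S" "y \<in> S" "x < y" for x y
  proof (rule DERIV_pos_imp_increasing[OF that(3)])
    fix z assume "x \<le> z" "z \<le> y"
    then have "z \<in> S" using assms(2) that connected_contains_Icc[of S x y] by auto
    then show "\<exists>d. DERIV \<phi> z :> d \<and> 0 < d"
      using smooth_on_has_vector_derivative[OF assms(1,3), of z] assms(4)[of z]
      by (auto simp: has_real_derivative_iff_has_vector_derivative)
  qed
  then show inj: "inj_on \<phi> S" by (metis inj_onI linorder_neqE_linordered_idom less_irrefl)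
  have c: "continuous_on S \<phi>" using assms(3) by (rule smooth_on_imp_continuous)
  have op: "open (\<phi> ` S)"
    by (rule injective_into_1d_imp_open_map_UNIV[OF assms(1) c inj]) simp
  obtain \<psi> where h: "homeomorphism S (\<phi> ` S) \<phi> \<psi>"
    using homeomorphism_into_1d[of S \<phi> "\<phi> ` S"] assms(2) c inj
    by (metis connected_open_path_connected assms(1))
  have "smooth_on (\<phi> ` S) \<psi>"
    unfolding smooth_on_def
    by (intro allI times_differentiable_inverse_function[OF assms(1) op assms(3)])
      (use h assms(4) in \<open>force simp: homeomorphism_def\<close>)+
  then show "diffeo_on S (\<phi> ` S) \<phi>" using op h assms unfolding diffeo_on_def by blast
qed

section \<open>Smooth division and even functions\<close>

text \<open>Hadamard's quotient \<open>(f t - f 0) / t\<close>, in an integral form without a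
  singularity at 0.\<close>

definition hadamard :: "(real \<Rightarrow> real) \<Rightarrow> real \<Rightarrow> real" where
  "hadamard f t = integral {0..1} (\<lambda>u. vector_derivative f (at (u * t)))"

text \<open>Differentiation under the integral sign; the inner function \<open>u * t\<close>
  contributes one more factor \<open>u\<close> each time.\<close>

lemma hadamard_derivs:
  fixes f :: "real \<Rightarrow> real"
  assumes "open S" "convex S" "0 \<in> S" "smooth_on S f" "t \<in> S"
  shows "((\<lambda>t. integral {0..1} (\<lambda>u. u ^ n * nth_deriv (Suc n) f (u * t)))
    has_vector_derivative integral {0..1} (\<lambda>u. u ^ Suc n * nth_deriv (Suc (Suc n)) f (u * t))) (at t)"
proof -
  have inS: "u * t \<in> S" if "t \<in> S" "u \<in> {0..1}" for u t
    using convexD[OF assms(2,3) that(1), of "1 - u" u] that(2) by simp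
  have cont: "continuous_on S (nth_deriv k f)" for k
    using smooth_on_nth_deriv[OF assms(1,4)] smooth_on_imp_continuous by blast
  have "((\<lambda>t. integral (cbox 0 1) (\<lambda>u. u ^ n * nth_deriv (Suc n) f (u * t)))
    has_vector_derivative integral (cbox 0 1) (\<lambda>u. u ^ Suc n * nth_deriv (Suc (Suc n)) f (u * t)))
      (at t within S)"
  proof (rule leibniz_rule_vector_derivative[OF _ _ _ assms(5,2)])
    fix x u assume x: "x \<in> S" and u: "u \<in> cbox 0 (1::real)"
    then have "u * x \<in> S" using inS by simp
    then have "(nth_deriv (Suc n) f has_vector_derivative nth_deriv (Suc (Suc n)) f (u * x)) (at (u * x))"
      by (rule nth_deriv_has_derivative[OF assms(1,4)])
    then have "((\<lambda>x. nth_deriv (Suc n) f (u * x)) has_real_derivative nth_deriv (Suc (Suc n)) f (u * x) * u) (at x)"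
      unfolding has_real_derivative_iff_has_vector_derivative[symmetric]
      by (rule DERIV_chain2) (auto intro!: derivative_eq_intros)
    then have "((\<lambda>x. u ^ n * nth_deriv (Suc n) f (u * x)) has_real_derivative
        u ^ n * (nth_deriv (Suc (Suc n)) f (u * x) * u)) (at x)"
      by (rule DERIV_cmult)
    then show "((\<lambda>x. u ^ n * nth_deriv (Suc n) f (u * x)) has_vector_derivative
        u ^ Suc n * nth_deriv (Suc (Suc n)) f (u * x)) (at x within S)"
      by (auto simp: has_real_derivative_iff_has_vector_derivative mult_ac intro: has_vector_derivative_at_within)
  next
    fix x assume x: "x \<in> S"
    have "continuous_on (cbox 0 1) (\<lambda>u. nth_deriv (Suc n) f (u * x))"
      by (rule continuous_on_compose2[OF cont]) (use inS[OF x] in \<open>auto intro: continuous_intros\<close>)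
    then show "(\<lambda>u. u ^ n * nth_deriv (Suc n) f (u * x)) integrable_on cbox 0 1"
      by (intro integrable_continuous continuous_intros)
  next
    show "continuous_on (S \<times> cbox 0 1) (\<lambda>(x, u). u ^ Suc n * nth_deriv (Suc (Suc n)) f (u * x))"
    proof -
      have "continuous_on (S \<times> cbox 0 1) (\<lambda>p. nth_deriv (Suc (Suc n)) f (snd p * fst p))"
        by (rule continuous_on_compose2[OF cont]) (use inS in \<open>auto intro!: continuous_intros\<close>)
      then show ?thesis unfolding split_beta by (intro continuous_intros)
    qed
  qed
  then show ?thesis by (simp only: at_within_open[OF assms(5,1)] cbox_interval)
qed

lemma smooth_on_hadamard:
  assumes "open S" "convex S" "0 \<in> S" "smooth_on S f"
  shows "smooth_on S (hadamard f)"
proof -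
  have "hadamard f = (\<lambda>n t. integral {0..1} (\<lambda>u. u ^ n * nth_deriv (Suc n) f (u * t))) 0"
    by (rule ext) (simp add: hadamard_def nth_deriv_Suc)
  moreover have "smooth_on S ((\<lambda>n t. integral {0..1} (\<lambda>u. u ^ n * nth_deriv (Suc n) f (u * t))) 0)"
    by (rule smooth_on_real_seqI[OF assms(1)]) (rule hadamard_derivs[OF assms])
  ultimately show ?thesis by (simp only:)
qed

text \<open>Division by \<open>t\<close> shifts the Taylor coefficients by one place; the factor
  \<open>1 / Suc n\<close> is the integral of \<open>u ^ n\<close>.\<close>

lemma nth_deriv_hadamard_0:
  assumes "smooth_on UNIV f"
  shows "nth_deriv n (hadamard f) 0 = nth_deriv (Suc n) f 0 / (Suc n)"
proof -
  let ?D = "\<lambda>n t. integral {0..1} (\<lambda>u. u ^ n * nth_deriv (Suc n) f (u * t))"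
  have h: "hadamard f = ?D 0"
    by (rule ext) (simp add: hadamard_def nth_deriv_Suc)
  have "nth_deriv n (?D 0) = ?D n"
    by (rule nth_deriv_eqI) (use hadamard_derivs[OF _ _ _ assms] in auto)
  moreover have "((\<lambda>u::real. u ^ n) has_integral (1 ^ Suc n / Suc n - 0 ^ Suc n / Suc n)) {0..1}"
    by (rule fundamental_theorem_of_calculus)
      (auto simp: has_real_derivative_iff_has_vector_derivative[symmetric] simp del: power_Suc
        intro!: derivative_eq_intros)
  then have "integral {0..1} (\<lambda>u::real. u ^ n) = 1 / Suc n"
    by (simp add: integral_unique)
  ultimately have "nth_deriv n (hadamard f) 0 = ?D n 0" and "?D n 0 = nth_deriv (Suc n) f 0 / Suc n"
    unfolding h by (simp_all only: mult_zero_right integral_mult_left) simp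
  then show ?thesis by simp
qed

lemma hadamard_eq:
  assumes "open S" "convex S" "0 \<in> S" "smooth_on S f" "t \<in> S"
  shows "f t = f 0 + t * hadamard f t"
proof -
  have inS: "u * t \<in> S" if "u \<in> {0..1}" for u
    using convexD[OF assms(2,3,5), of "1 - u" u] that by simp
  have "((\<lambda>u. t * vector_derivative f (at (u * t))) has_integral (f (1 * t) - f (0 * t))) {0..1}"
  proof (rule fundamental_theorem_of_calculus)
    fix u :: real assume u: "u \<in> {0..1}"
    have "DERIV f (u * t) :> vector_derivative f (at (u * t))"
      using smooth_on_has_vector_derivative[OF assms(1,4) inS[OF u]]
      by (simp add: has_real_derivative_iff_has_vector_derivative)
    then have "((\<lambda>u. f (u * t)) has_real_derivative vector_derivative f (at (u * t)) * t) (at u)"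
      by (rule DERIV_chain2) (auto intro!: derivative_eq_intros)
    then show "((\<lambda>u. f (u * t)) has_vector_derivative t * vector_derivative f (at (u * t))) (at u within {0..1})"
      by (auto simp: has_real_derivative_iff_has_vector_derivative mult_ac intro: has_vector_derivative_at_within)
  qed simp
  then have "integral {0..1} (\<lambda>u. t * vector_derivative f (at (u * t))) = f (1 * t) - f (0 * t)"
    by (rule integral_unique)
  then show ?thesis by (simp add: hadamard_def)
qed

text \<open>The \<open>m\<close>-fold integral of \<open>exp (c x)\<close> from \<open>0\<close>.\<close>

definition exp_integral :: "real \<Rightarrow> nat \<Rightarrow> real \<Rightarrow> real" where
  "exp_integral c m x = (exp (c * x) - (\<Sum>i<m. (c * x) ^ i / fact i)) / c ^ m"

lemma exp_integral_0: "exp_integral c 0 x = exp (c * x)"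
  by (simp add: exp_integral_def)

lemma exp_integral_at_0: "exp_integral c (Suc m) 0 = 0"
  by (simp add: exp_integral_def sum.lessThan_Suc_shift del: sum.lessThan_Suc)

lemma exp_integral_deriv:
  assumes "c > 0"
  shows "(exp_integral c (Suc m) has_real_derivative exp_integral c m x) (at x)"
proof -
  have d: "((\<lambda>x. (c * x) ^ Suc i / fact (Suc i)) has_real_derivative c * ((c * x) ^ i / fact i)) (at x)" for i
  proof -
    have "((\<lambda>x. (c * x) ^ Suc i / fact (Suc i)) has_real_derivative real (Suc i) * ((c * x) ^ i * c) / fact (Suc i)) (at x)"
      by (auto intro!: derivative_eq_intros simp del: power_Suc of_nat_Suc fact_Suc)
    moreover have "real (Suc i) * ((c * x) ^ i * c) / fact (Suc i) = c * ((c * x) ^ i / fact i)"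
      by (simp add: fact_Suc field_simps del: of_nat_Suc)
    ultimately show ?thesis by (simp only:)
  qed
  have S: "((\<lambda>x. \<Sum>i<m. (c * x) ^ Suc i / fact (Suc i)) has_real_derivative (\<Sum>i<m. c * ((c * x) ^ i / fact i))) (at x)"
    by (intro DERIV_sum d)
  have e: "((\<lambda>x. exp (c * x)) has_real_derivative exp (c * x) * c) (at x)"
    by (auto intro!: derivative_eq_intros)
  have "((\<lambda>x. (exp (c * x) - (1 + (\<Sum>i<m. (c * x) ^ Suc i / fact (Suc i)))) / c ^ Suc m) has_real_derivative
     (exp (c * x) * c - (0 + (\<Sum>i<m. c * ((c * x) ^ i / fact i)))) / c ^ Suc m) (at x)"
    by (rule DERIV_cdivide[OF DERIV_diff[OF e DERIV_add[OF DERIV_const S]]])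
  moreover have "(exp (c * x) * c - (0 + (\<Sum>i<m. c * ((c * x) ^ i / fact i)))) / c ^ Suc m = exp_integral c m x"
    unfolding sum_distrib_left[symmetric] exp_integral_def using assms by (simp add: field_simps)
  moreover have "(\<lambda>x. (exp (c * x) - (1 + (\<Sum>i<m. (c * x) ^ Suc i / fact (Suc i)))) / c ^ Suc m) = exp_integral c (Suc m)"
    unfolding exp_integral_def sum.lessThan_Suc_shift by (simp only: power_0 fact_0 div_by_1)
  ultimately show ?thesis by (simp only:)
qed

text \<open>The first integral of the exponential is at most \<open>1 / c\<close> in size left of 0,
  and each further integration runs over a length of at most 1. Right of 0 the exponential grows
  with \<open>c\<close>, hence the one-sided interval.\<close>

lemma exp_integral_bound:
  assumes "c > 0" "x \<in> {-1..0}"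
  shows "\<bar>exp_integral c (Suc m) x\<bar> \<le> 1 / c"
  using assms(2)
proof (induction m arbitrary: x)
  case 0
  then have "exp (c * x) \<le> 1" using assms(1) by (simp add: mult_nonneg_nonpos)
  then show ?case using assms(1) exp_gt_zero[of "c * x"]
    by (simp add: exp_integral_def abs_if field_simps)
next
  case (Suc m)
  show ?case
  proof (cases "x = 0")
    case True
    then show ?thesis using assms by (simp add: exp_integral_at_0)
  next
    case False
    then have "x < 0" using Suc.prems by simp
    then obtain z where z: "x < z" "z < 0"
      "exp_integral c (Suc (Suc m)) 0 - exp_integral c (Suc (Suc m)) x = (0 - x) * exp_integral c (Suc m) z"
      using MVT2[of x 0 "exp_integral c (Suc (Suc m))" "exp_integral c (Suc m)"]
        exp_integral_deriv[OF assms(1)] by auto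
    have "\<bar>exp_integral c (Suc m) z\<bar> \<le> 1 / c" using Suc z by auto
    moreover have "\<bar>exp_integral c (Suc (Suc m)) x\<bar> = \<bar>x\<bar> * \<bar>exp_integral c (Suc m) z\<bar>"
      using z(3) by (simp add: exp_integral_at_0 abs_mult[symmetric])
    moreover have "\<bar>x\<bar> \<le> 1" using Suc.prems by auto
    ultimately show ?thesis
      by (metis abs_ge_zero mult_left_le_one_le order_trans)
  qed
qed

text \<open>Forward substitution: with \<open>b = borel_coeff a\<close> and
  \<open>c m = 2 ^ m * (1 + |b m|)\<close>, the value \<open>a n\<close> is the sum of
  \<open>b m * c m ^ (n - m)\<close> over \<open>m \<le> n\<close>. The rate \<open>c m\<close>
  depends on \<open>b m\<close> alone, so it is known when it is used.\<close>

fun borel_coeff :: "(nat \<Rightarrow> real) \<Rightarrow> nat \<Rightarrow> real" where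
  "borel_coeff a n = a n - (\<Sum>m<n. borel_coeff a m * (2 ^ m * (1 + \<bar>borel_coeff a m\<bar>)) ^ (n - m))"

declare borel_coeff.simps [simp del]

text \<open>Borel's theorem: the \<open>n\<close>-th summand is the \<open>n\<close>-fold integral of \<open>b\<^sub>n exp (c\<^sub>n x)\<close>, whose derivatives
  of order less than \<open>n\<close> are bounded by \<open>\<bar>b\<^sub>n\<bar> / c\<^sub>n \<le> 2\<^sup>-\<^sup>n\<close>; the \<open>b\<^sub>n\<close> solve a triangular system.\<close>

lemma borel_left:
  fixes a :: "nat \<Rightarrow> real"
  obtains D :: "nat \<Rightarrow> real \<Rightarrow> real"
  where "\<And>n x. x \<in> {-1..0} \<Longrightarrow> (D n has_real_derivative D (Suc n) x) (at x within {-1..0})"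
    and "\<And>n. D n 0 = a n"
proof
  define b where "b = borel_coeff a"
  define c where "c m = 2 ^ m * (1 + \<bar>b m\<bar>)" for m
  \<comment> \<open>\<open>E j n\<close> is the \<open>j\<close>-th derivative of the
    \<open>n\<close>-th summand: of the \<open>n\<close> integrations \<open>n - j\<close> remain,
    or else \<open>j - n\<close> differentiations have been carried out.\<close>
  define E where "E j n x = b n * (if j < n then exp_integral (c n) (n - j) x else c n ^ (j - n) * exp (c n * x))" for j n x
  define D where "D j x = (\<Sum>n. E j n x)" for j x
  have c: "c n > 0" for n by (simp add: c_def add_pos_nonneg)
  have dE: "(E j n has_real_derivative E (Suc j) n x) (at x)" for j n x
  proof -
    consider "Suc j < n" | "n = Suc j" | "n \<le> j" by linarith
    then show ?thesis
    proof cases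
      case 1
      then have "n - j = Suc (n - Suc j)" by simp
      then show ?thesis unfolding E_def using 1 exp_integral_deriv[OF c, of n "n - Suc j" x]
        by (auto intro!: DERIV_cmult)
    next
      case 2
      then show ?thesis unfolding E_def using exp_integral_deriv[OF c, of n 0 x]
        by (auto intro!: DERIV_cmult simp: exp_integral_0)
    next
      case 3
      then have "Suc j - n = Suc (j - n)" by simp
      with 3 show ?thesis unfolding E_def
        by (auto intro!: derivative_eq_intros)
    qed
  qed
  \<comment> \<open>This is the purpose of the rate: \<open>|b n| / c n\<close> is at most
    \<open>(1/2) ^ n\<close> whatever the size of \<open>b n\<close>.\<close>
  have bE: "\<bar>E j n x\<bar> \<le> (1/2) ^ n" if "j < n" "x \<in> {-1..0}" for j n x
  proof -
    have "\<bar>exp_integral (c n) (n - j) x\<bar> \<le> 1 / c n"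
      using exp_integral_bound[OF c that(2), of n "n - Suc j"] that(1) by (simp add: Suc_diff_Suc)
    then have "\<bar>E j n x\<bar> \<le> \<bar>b n\<bar> * (1 / c n)"
      unfolding E_def using that(1) by (simp only: abs_mult if_True mult_left_mono abs_ge_zero)
    also have "\<dots> = (1/2) ^ n * (\<bar>b n\<bar> / (1 + \<bar>b n\<bar>))"
      by (simp add: c_def power_divide)
    also have "\<dots> \<le> (1/2) ^ n * 1"
      by (rule mult_left_mono) auto
    finally have "\<bar>E j n x\<bar> \<le> (1/2) ^ n * 1" .
    then show ?thesis by simp
  qed
  \<comment> \<open>For fixed \<open>j\<close> the bound only covers the summands with
    \<open>n > j\<close>, hence the Weierstrass test in its eventual form.\<close>
  have ul: "uniform_limit {-1..0} (\<lambda>n x. \<Sum>i<n. E j i x) (\<lambda>x. \<Sum>i. E j i x) sequentially" for j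
  proof (rule Weierstrass_m_test_ev)
    show "\<forall>\<^sub>F n in sequentially. \<forall>x\<in>{-1..0}. norm (E j n x) \<le> (1/2) ^ n"
      using bE[of j] by (auto intro!: eventually_sequentiallyI[of "Suc j"])
  qed (simp add: summable_geometric)
  have su: "summable (\<lambda>n. E j n x)" if "x \<in> {-1..0}" for j x
    by (rule summable_comparison_test_ev[of _ "\<lambda>n. (1/2) ^ n"])
      (use bE[of j] that in \<open>auto intro!: eventually_sequentiallyI[of "Suc j"] summable_geometric\<close>)
  show "(D j has_real_derivative D (Suc j) x) (at x within {-1..0})" if "x \<in> {-1..0}" for j x
  proof -
    obtain g where g: "\<forall>x\<in>{-1..0}. (\<lambda>n. E j n x) sums g x \<and>
        (g has_field_derivative D (Suc j) x) (at x within {-1..0})"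
      using has_field_derivative_series[of "{-1..0}" "E j" "E (Suc j)" "D (Suc j)" 0] dE ul su[of 0 j]
      unfolding D_def[abs_def] by (force intro: has_field_derivative_at_within)
    have "g y = D j y" if "y \<in> {-1..0}" for y using g that sums_unique unfolding D_def by blast
    then show ?thesis
      using has_field_derivative_transform_within[of g "D (Suc j) x" x "{-1..0}" 1 "D j"] g that by auto
  qed
  show "D j 0 = a j" for j
  proof -
    \<comment> \<open>A summand with \<open>n > j\<close> still has an integration from 0 left and
      vanishes at 0; the finite rest is the triangular system.\<close>
    have z: "E j n 0 = (if j < n then 0 else b n * c n ^ (j - n))" for n
      using exp_integral_at_0[of "c n" "n - Suc j"] by (cases "j < n") (simp_all add: E_def Suc_diff_Suc)
    have "D j 0 = (\<Sum>n\<le>j. E j n 0)"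
      unfolding D_def by (rule suminf_finite) (auto simp: z)
    also have "\<dots> = b j + (\<Sum>n<j. b n * c n ^ (j - n))"
      by (simp add: z lessThan_Suc_atMost[symmetric])
    also have "\<dots> = a j"
      by (simp add: b_def c_def borel_coeff.simps[of a j])
    finally show ?thesis .
  qed
qed

text \<open>The derivatives of \<open>f (sqrt x)\<close> are \<open>f\<^sub>n (sqrt x)\<close> with \<open>f\<^sub>n\<^sub>+\<^sub>1 t = f\<^sub>n' t / (2 t)\<close>,
  which is smooth and even again; Borel's theorem continues this family to \<open>x < 0\<close>.\<close>

lemma smooth_even_sqrt:
  fixes f :: "real \<Rightarrow> real"
  assumes "\<delta> > 0" "smooth_on {-\<delta><..<\<delta>} f" "\<And>t. t \<in> {-\<delta><..<\<delta>} \<Longrightarrow> f (- t) = f t"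
  obtains g \<eta> where "0 < \<eta>" "\<eta> \<le> \<delta>\<^sup>2" "smooth_on {-\<eta><..<\<eta>} g" "\<And>t. t\<^sup>2 < \<eta> \<Longrightarrow> f t = g (t\<^sup>2)"
proof -
  define S where "S = {-\<delta><..<\<delta>}"
  have S: "open S" "convex S" "0 \<in> S" using assms(1) by (auto simp: S_def)
  define F where "F = rec_nat f (\<lambda>_ h t. hadamard (\<lambda>s. vector_derivative h (at s)) t / 2)"
  have F0: "F 0 = f" and FS: "F (Suc n) t = hadamard (\<lambda>s. vector_derivative (F n) (at s)) t / 2" for n t
    by (simp_all add: F_def)
  have F: "smooth_on S (F n) \<and> (\<forall>t\<in>S. F n (- t) = F n t) \<and>
      (\<forall>t\<in>S. (F n has_real_derivative 2 * t * F (Suc n) t) (at t))" for n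
  proof -
    have step: "(\<forall>t\<in>S. (F n has_real_derivative 2 * t * F (Suc n) t) (at t)) \<and> smooth_on S (F (Suc n)) \<and>
        (\<forall>t\<in>S. F (Suc n) (- t) = F (Suc n) t)" if sm: "smooth_on S (F n)" and ev: "\<forall>t\<in>S. F n (- t) = F n t" for n
    proof -
      let ?d = "\<lambda>s. vector_derivative (F n) (at s)"
      have smd: "smooth_on S ?d" using smooth_on_vector_derivative[OF S(1) sm] .
      have D: "(F n has_real_derivative ?d t) (at t)" if "t \<in> S" for t
        using smooth_on_has_vector_derivative[OF S(1) sm that] by (simp add: has_real_derivative_iff_has_vector_derivative)
      \<comment> \<open>An odd derivative vanishes at 0, so its Hadamard quotient is exactly the
        derivative divided by \<open>t\<close>.\<close>
      have odd: "?d (- t) = - ?d t" if t: "t \<in> S" for t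
      proof -
        have t': "- t \<in> S" using t by (auto simp: S_def)
        have "((\<lambda>t. F n (- t)) has_real_derivative ?d (- t) * (- 1)) (at t)"
          by (rule DERIV_chain2[where g=uminus, OF D[OF t']]) (auto intro!: derivative_eq_intros)
        then have "(F n has_real_derivative ?d (- t) * (- 1)) (at t)"
          by (rule has_field_derivative_transform_within_open[OF _ S(1) t]) (use ev in auto)
        then have "?d (- t) * (- 1) = ?d t" using D[OF t] DERIV_unique by blast
        then show ?thesis by simp
      qed
      have "?d 0 = 0" using odd[OF S(3)] by simp
      then have eq: "?d t = 2 * t * F (Suc n) t" if "t \<in> S" for t
        using hadamard_eq[OF S smd that] by (simp add: FS)
      have "smooth_on S (F (Suc n))"
        using smooth_on_linear[OF bounded_linear_divide S(1) smooth_on_hadamard[OF S smd]]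
        unfolding FS[abs_def] .
      moreover have "F (Suc n) (- t) = F (Suc n) t" if t: "t \<in> S" for t
      proof (cases "t = 0")
        case False
        have "- t \<in> S" using t by (auto simp: S_def)
        then have "2 * (- t) * F (Suc n) (- t) = - (2 * t * F (Suc n) t)"
          using eq odd t by metis
        then show ?thesis using False by simp
      qed simp
      ultimately show ?thesis using D eq by simp
    qed
    have "smooth_on S (F n) \<and> (\<forall>t\<in>S. F n (- t) = F n t)"
    proof (induction n)
      case 0
      then show ?case using assms(2,3) by (simp add: F0 S_def)
    next
      case (Suc n)
      then show ?case using step by blast
    qed
    then show ?thesis using step by blast
  qed
  obtain D :: "nat \<Rightarrow> real \<Rightarrow> real" where D:
    "\<And>n x. x \<in> {-1..0} \<Longrightarrow> (D n has_real_derivative D (Suc n) x) (at x within {-1..0})" "\<And>n. D n 0 = F n 0"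
    using borel_left[of "\<lambda>n. F n 0"] by blast
  \<comment> \<open>The 1 is the length of the interval on which \<open>D\<close> is available; the
    bound \<open>\<delta>\<^sup>2\<close> keeps \<open>sqrt x\<close> in the domain of
    \<open>f\<close>.\<close>
  define \<eta> where "\<eta> = min 1 (\<delta>\<^sup>2)"
  have \<eta>: "0 < \<eta>" "\<eta> \<le> \<delta>\<^sup>2" "\<eta> \<le> 1" using assms(1) by (auto simp: \<eta>_def)
  have sq: "sqrt x \<in> S" if "0 \<le> x" "x < \<eta>" for x
  proof -
    have "sqrt x < \<delta>" using that \<eta> assms(1) real_less_lsqrt by auto
    then show ?thesis using that assms(1) unfolding S_def
      by (smt (verit) greaterThanLessThan_iff real_sqrt_ge_zero)
  qed
  define G where "G n x = (if 0 \<le> x then F n (sqrt x) else D n x)" for n x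
  have right: "(G n has_real_derivative G (Suc n) x) (at x)" if x: "0 < x" "x < \<eta>" for n x
  proof -
    have "(F n has_real_derivative 2 * sqrt x * F (Suc n) (sqrt x)) (at (sqrt x))"
      using F sq x by simp
    then have "((\<lambda>x. F n (sqrt x)) has_real_derivative 2 * sqrt x * F (Suc n) (sqrt x) * (inverse (sqrt x) / 2)) (at x)"
      by (rule DERIV_chain2) (use x in \<open>auto intro!: derivative_eq_intros\<close>)
    then have "((\<lambda>x. F n (sqrt x)) has_real_derivative G (Suc n) x) (at x)"
      using x by (simp add: G_def field_simps)
    then show ?thesis
      by (rule has_field_derivative_transform_within_open[of _ _ _ "{0<..}"]) (use x in \<open>auto simp: G_def\<close>)
  qed
  have left: "(G n has_real_derivative G (Suc n) x) (at x)" if x: "-\<eta> < x" "x < 0" for n x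
  proof -
    have "(D n has_real_derivative G (Suc n) x) (at x within {-1..0})"
      using D(1)[of x n] x \<eta> by (simp add: G_def)
    moreover have "at x within {-1..0} = at x"
      by (rule at_within_interior) (use x \<eta> in auto)
    ultimately have "(D n has_real_derivative G (Suc n) x) (at x)" by simp
    then show ?thesis
      by (rule has_field_derivative_transform_within_open[of _ _ _ "{..<0}"]) (use x in \<open>auto simp: G_def\<close>)
  qed
  have contr: "continuous_on {0..<\<eta>} (G n)" for n
  proof -
    have "continuous_on {0..<\<eta>} (\<lambda>x. F n (sqrt x))"
      by (rule continuous_on_compose2[OF smooth_on_imp_continuous[of S]])
        (use F sq in \<open>auto intro!: continuous_intros\<close>)
    then show ?thesis by (rule continuous_on_eq) (auto simp: G_def)
  qed
  have zero: "(G n has_real_derivative G (Suc n) 0) (at 0)" for n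
  proof -
    have eqD: "D n x = G n x" if "x \<in> {-1..0}" for x
      using that D(2)[of n] by (cases "x = 0") (auto simp: G_def)
    have "(D n has_real_derivative G (Suc n) 0) (at 0 within {-1..0})"
      using D(1)[of 0 n] D(2) by (simp add: G_def)
    then have l: "(G n has_real_derivative G (Suc n) 0) (at 0 within {-1..0})"
      by (rule has_field_derivative_transform_within[of _ _ _ _ 1]) (use eqD in auto)
    \<comment> \<open>\<open>sqrt\<close> is not differentiable at 0, so the chain rule fails here.
      The right derivative comes from the mean value theorem and the continuity of
      \<open>G (Suc n)\<close>.\<close>
    have "((\<lambda>x. (G n x - G n 0) / (x - 0)) \<longlongrightarrow> G (Suc n) 0) (at 0 within {0..<\<eta>})"
      unfolding tendsto_iff
    proof (intro allI impI)
      fix e :: real assume e: "e > 0"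
      have "(G (Suc n) \<longlongrightarrow> G (Suc n) 0) (at 0 within {0..<\<eta>})"
        by (rule contr[of "Suc n", unfolded continuous_on_def, rule_format]) (use \<eta>(1) in simp)
      then have "\<forall>\<^sub>F x in at 0 within {0..<\<eta>}. dist (G (Suc n) x) (G (Suc n) 0) < e"
        by (rule tendstoD[OF _ e])
      then obtain d where d: "d > 0"
        "\<And>x. x \<in> {0..<\<eta>} \<Longrightarrow> x \<noteq> 0 \<Longrightarrow> dist x 0 < d \<Longrightarrow> dist (G (Suc n) x) (G (Suc n) 0) < e"
        unfolding eventually_at by metis
      have "dist ((G n x - G n 0) / (x - 0)) (G (Suc n) 0) < e"
        if x: "x \<in> {0..<\<eta>}" "x \<noteq> 0" "dist x 0 < d" for x
      proof -
        have "\<exists>l z. 0 < z \<and> z < x \<and> (G n has_real_derivative l) (at z) \<and> G n x - G n 0 = (x - 0) * l"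
        proof (rule MVT)
          show "continuous_on {0..x} (G n)" using contr[of n] x(1) by (auto intro: continuous_on_subset)
          show "G n differentiable (at z)" if "0 < z" "z < x" for z
            using right[of z n] that x(1) by (auto simp: real_differentiable_def)
        qed (use x in auto)
        then obtain l z where z: "0 < z" "z < x" "(G n has_real_derivative l) (at z)" "G n x - G n 0 = (x - 0) * l" by blast
        then have "l = G (Suc n) z" using right[of z n] x(1) DERIV_unique by fastforce
        then have "(G n x - G n 0) / (x - 0) = G (Suc n) z" using z x by simp
        then show ?thesis using d(2)[of z] z x by auto
      qed
      then show "\<forall>\<^sub>F x in at 0 within {0..<\<eta>}. dist ((G n x - G n 0) / (x - 0)) (G (Suc n) 0) < e"
        unfolding eventually_at using d(1) by metis
    qed
    then have r: "(G n has_real_derivative G (Suc n) 0) (at 0 within {0..<\<eta>})"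
      by (simp add: has_field_derivative_iff)
    have "(G n has_real_derivative G (Suc n) 0) (at 0 within ({-1..0} \<union> {0..<\<eta>}))"
      using l r by (simp add: has_field_derivative_iff Lim_within_Un)
    moreover have "at 0 within ({-1..0} \<union> {0..<\<eta>}) = at (0::real)"
    proof (rule at_within_nhd[of 0 "{-1<..<\<eta>}"])
    qed (use \<eta> in auto)
    ultimately show ?thesis by simp
  qed
  have "smooth_on {-\<eta><..<\<eta>} (G 0)"
  proof (rule smooth_on_real_seqI)
    fix n x assume "x \<in> {-\<eta><..<\<eta>}"
    then have "(G n has_real_derivative G (Suc n) x) (at x)"
      using left[of x n] right[of x n] zero[of n] by (cases x "0::real" rule: linorder_cases) auto
    then show "(G n has_vector_derivative G (Suc n) x) (at x)"
      by (simp add: has_real_derivative_iff_has_vector_derivative)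
  qed simp
  moreover have "f t = G 0 (t\<^sup>2)" if "t\<^sup>2 < \<eta>" for t
  proof -
    have "\<bar>t\<bar> \<in> S" using sq[of "t\<^sup>2"] that by simp
    then have "\<bar>t\<bar> < \<delta>" by (simp add: S_def)
    then have "f \<bar>t\<bar> = f t" using assms(3)[of t] by (auto simp: abs_if)
    then show ?thesis by (simp add: G_def F0)
  qed
  ultimately show thesis using that \<eta> by blast
qed

text \<open>The even part of \<open>f\<close> and the odd part divided by \<open>t\<close> are both
  smooth and even, and each of them is a smooth function of \<open>t\<^sup>2\<close>.\<close>

lemma smooth_even_odd_split:
  fixes f :: "real \<Rightarrow> real"
  assumes "\<delta> > 0" "smooth_on {-\<delta><..<\<delta>} f"
  obtains P Q \<eta> where "0 < \<eta>" "\<eta> \<le> \<delta>\<^sup>2" "smooth_on {-\<eta><..<\<eta>} P" "smooth_on {-\<eta><..<\<eta>} Q"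
    "\<And>t. t\<^sup>2 < \<eta> \<Longrightarrow> f t = P (t\<^sup>2) + t * Q (t\<^sup>2)"
proof -
  define S where "S = {-\<delta><..<\<delta>}"
  have S: "open S" "convex S" "0 \<in> S" and Sm: "\<And>t. t \<in> S \<Longrightarrow> - t \<in> S" using assms(1) by (auto simp: S_def)
  have sf: "smooth_on S f" using assms by (simp add: S_def)
  have sm: "smooth_on S (\<lambda>t. f (- t))"
    by (rule smooth_on_compose[OF S(1,1) _ sf smooth_on_minus[OF S(1) smooth_on_id[OF S(1)]]]) (use Sm in auto)
  define e where "e t = (f t + f (- t)) / 2" for t
  define d where "d t = (f t - f (- t)) / 2" for t
  have se: "smooth_on S e" unfolding e_def[abs_def]
    by (intro smooth_on_linear[OF bounded_linear_divide] smooth_on_add sf sm S)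
  have sd: "smooth_on S d" unfolding d_def[abs_def]
    by (intro smooth_on_linear[OF bounded_linear_divide] smooth_on_diff sf sm S)
  define c where "c = hadamard d"
  have sc: "smooth_on S c" unfolding c_def by (rule smooth_on_hadamard[OF S sd])
  have dc: "d t = t * c t" if "t \<in> S" for t
    using hadamard_eq[OF S sd that] by (simp add: c_def d_def)
  have ce: "c (- t) = c t" if "t \<in> S" for t
  proof (cases "t = 0")
    case False
    have "d (- t) = - d t" by (simp add: d_def field_simps)
    then have "(- t) * c (- t) = - (t * c t)"
      using dc[OF that] dc[OF Sm[OF that]] by (simp only:)
    then show ?thesis using False by simp
  qed simp
  have ee: "e (- t) = e t" for t by (simp add: e_def add.commute)
  obtain P \<eta>1 where P: "0 < \<eta>1" "\<eta>1 \<le> \<delta>\<^sup>2" "smooth_on {-\<eta>1<..<\<eta>1} P" "\<And>t. t\<^sup>2 < \<eta>1 \<Longrightarrow> e t = P (t\<^sup>2)"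
    using smooth_even_sqrt[OF assms(1) se[unfolded S_def] ee] by metis
  obtain Q \<eta>2 where Q: "0 < \<eta>2" "\<eta>2 \<le> \<delta>\<^sup>2" "smooth_on {-\<eta>2<..<\<eta>2} Q" "\<And>t. t\<^sup>2 < \<eta>2 \<Longrightarrow> c t = Q (t\<^sup>2)"
    using smooth_even_sqrt[OF assms(1) sc[unfolded S_def] ce[unfolded S_def]] by metis
  have "f t = P (t\<^sup>2) + t * Q (t\<^sup>2)" if "t\<^sup>2 < min \<eta>1 \<eta>2" for t
  proof -
    have "t\<^sup>2 < \<delta>\<^sup>2" using that P(2) by auto
    then have "\<bar>t\<bar> < \<delta>" using assms(1) power2_less_imp_less[of "\<bar>t\<bar>" \<delta>] by simp
    then have "t \<in> S" by (auto simp: S_def)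
    have "f t = e t + d t" by (simp add: e_def d_def field_simps)
    then show ?thesis using P(4)[of t] Q(4)[of t] dc[OF \<open>t \<in> S\<close>] that by simp
  qed
  moreover have "smooth_on {- min \<eta>1 \<eta>2<..<min \<eta>1 \<eta>2} P" "smooth_on {- min \<eta>1 \<eta>2<..<min \<eta>1 \<eta>2} Q"
    by (rule smooth_on_subset[OF _ P(3)], force) (rule smooth_on_subset[OF _ Q(3)], force)
  ultimately show thesis using that[of "min \<eta>1 \<eta>2" P Q] P Q by auto
qed

section \<open>Recognition of ordinary cusps\<close>

lemma diffeo_on_restrict:
  assumes "diffeo_on S T \<phi>" "open U" "U \<subseteq> S"
  shows "diffeo_on U (\<phi> ` U) \<phi>"
proof -
  obtain \<psi> where \<psi>: "homeomorphism S T \<phi> \<psi>" "smooth_on T \<psi>" "open S" "open T" "smooth_on S \<phi>"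
    using assms(1) unfolding diffeo_on_def by blast
  have im: "\<phi> ` U = T \<inter> \<psi> -` U"
    using \<psi>(1) assms(3) unfolding homeomorphism_def by force
  have "open (\<phi> ` U)" unfolding im
    using \<psi>(1,4) assms(2) continuous_open_preimage unfolding homeomorphism_def by blast
  moreover have "homeomorphism U (\<phi> ` U) \<phi> \<psi>"
    by (rule homeomorphism_of_subsets[OF \<psi>(1)]) (use assms(3) \<psi>(1) in \<open>auto simp: homeomorphism_def\<close>)
  ultimately show ?thesis
    unfolding diffeo_on_def using assms(2,3) \<psi> smooth_on_subset im by (metis Int_lower1)
qed

lemma diffeo_onE:
  assumes "diffeo_on S T \<phi>"
  obtains \<psi> where "diffeo_on T S \<psi>" "\<And>x. x \<in> S \<Longrightarrow> \<psi> (\<phi> x) = x" "\<And>y. y \<in> T \<Longrightarrow> \<phi> (\<psi> y) = y"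
    "\<phi> ` S = T" "\<psi> ` T = S"
  using assms homeomorphism_symD unfolding diffeo_on_def homeomorphism_def by metis

lemma diffeo_on_compose:
  assumes "diffeo_on S T \<phi>" "diffeo_on T U \<psi>"
  shows "diffeo_on S U (\<lambda>x. \<psi> (\<phi> x))"
proof -
  obtain \<phi>' where 1: "homeomorphism S T \<phi> \<phi>'" "smooth_on T \<phi>'" "open S" "open T" "smooth_on S \<phi>"
    using assms(1) unfolding diffeo_on_def by blast
  obtain \<psi>' where 2: "homeomorphism T U \<psi> \<psi>'" "smooth_on U \<psi>'" "open U" "smooth_on T \<psi>"
    using assms(2) unfolding diffeo_on_def by blast
  have "homeomorphism S U (\<psi> \<circ> \<phi>) (\<phi>' \<circ> \<psi>')" by (rule homeomorphism_compose[OF 1(1) 2(1)])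
  moreover have "smooth_on S (\<psi> \<circ> \<phi>)" "smooth_on U (\<phi>' \<circ> \<psi>')"
    unfolding o_def
     apply (rule smooth_on_compose[OF 1(3,4) _ 2(4) 1(5)]) using 1(1) apply (simp add: homeomorphism_def)
    apply (rule smooth_on_compose[OF 2(3) 1(4) _ 1(2) 2(2)]) using 2(1) by (simp add: homeomorphism_def)
  ultimately show ?thesis
    unfolding diffeo_on_def using 1 2 by (auto simp: o_def)
qed

section \<open>Plane determinants and local coordinates at a singular point\<close>

definition cross2 :: "real^2 \<Rightarrow> real^2 \<Rightarrow> real" where
  "cross2 v w = v $ 1 * w $ 2 - v $ 2 * w $ 1"

lemma bounded_bilinear_cross2: "bounded_bilinear cross2"
proof (unfold_locales)
  show "\<exists>K. \<forall>a b. norm (cross2 a b) \<le> norm a * norm b * K"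
  proof (intro exI allI)
    fix a b :: "real^2"
    have "\<bar>a $ 1 * b $ 2\<bar> \<le> norm a * norm b" "\<bar>a $ 2 * b $ 1\<bar> \<le> norm a * norm b"
      unfolding abs_mult by (intro mult_mono component_le_norm_cart; simp)+
    then show "norm (cross2 a b) \<le> norm a * norm b * 2"
      unfolding cross2_def real_norm_def by linarith
  qed
qed (auto simp: cross2_def algebra_simps)

text \<open>Cramer's rule.\<close>

lemma cross2_expand:
  assumes "cross2 v w \<noteq> 0"
  shows "z = (cross2 z w / cross2 v w) *\<^sub>R v + (cross2 v z / cross2 v w) *\<^sub>R w"
proof -
  have "cross2 v w * z $ i = cross2 z w * v $ i + cross2 v z * w $ i" for i
    using exhaust_2[of i] by (auto simp: cross2_def algebra_simps)
  then show ?thesis using assms by (simp add: vec_eq_iff field_simps)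
qed

text \<open>Transfers the jet of \<open>\<gamma>\<close> at \<open>s\<close> to linear coordinates
  centred at \<open>c\<close>; the translation affects order 0 only, hence
  \<open>Suc n\<close>.\<close>

lemma nth_deriv_linear_shift:
  fixes \<gamma> :: "real \<Rightarrow> 'a::euclidean_space"
  assumes "bounded_linear h" "smooth_on UNIV \<gamma>"
  shows "smooth_on UNIV (\<lambda>t. h (\<gamma> (s + t) - c))"
    and "nth_deriv (Suc n) (\<lambda>t. h (\<gamma> (s + t) - c)) t = h (nth_deriv (Suc n) \<gamma> (s + t))"
proof -
  show "smooth_on UNIV (\<lambda>t. h (\<gamma> (s + t) - c))"
    by (intro smooth_on_linear[OF assms(1)] smooth_on_diff smooth_on_const smooth_on_add smooth_on_id
        smooth_on_compose_UNIV[OF _ assms(2)] open_UNIV)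
  let ?D = "\<lambda>n t. if n = 0 then h (\<gamma> (s + t) - c) else h (nth_deriv n \<gamma> (s + t))"
  have "((\<lambda>t. h (nth_deriv n \<gamma> (s + t))) has_vector_derivative h (nth_deriv (Suc n) \<gamma> (s + t))) (at t)" for n t
  proof -
    have "(nth_deriv n \<gamma> has_vector_derivative nth_deriv (Suc n) \<gamma> (s + t)) (at (s + t))"
      by (rule nth_deriv_has_derivative[OF _ assms(2)]) auto
    then have "((\<lambda>t. nth_deriv n \<gamma> (s + t)) has_vector_derivative nth_deriv (Suc n) \<gamma> (s + t)) (at t)"
      using vector_diff_chain_at[of "\<lambda>t. s + t" 1 t "nth_deriv n \<gamma>" "nth_deriv (Suc n) \<gamma> (s + t)"]
        has_vector_derivative_add[OF has_vector_derivative_const[of s] has_vector_derivative_id, of "at t"]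
      by (simp add: o_def)
    then show ?thesis by (rule bounded_linear.has_vector_derivative[OF assms(1)])
  qed
  note d = this
  have "(?D n has_vector_derivative ?D (Suc n) t) (at t)" for n t
  proof (cases n)
    case 0
    have "((\<lambda>t. h (\<gamma> (s + t)) - h c) has_vector_derivative h (nth_deriv (Suc 0) \<gamma> (s + t))) (at t)"
      using d[of 0 t] by (auto intro!: derivative_eq_intros)
    then show ?thesis using 0 bounded_linear.linear[OF assms(1)] by (simp add: linear_diff)
  next
    case (Suc m)
    then show ?thesis using d[of n t] by simp
  qed
  from nth_deriv_eqI[of ?D "Suc n", OF this]
  show "nth_deriv (Suc n) (\<lambda>t. h (\<gamma> (s + t) - c)) t = h (nth_deriv (Suc n) \<gamma> (s + t))"
    by simp
qed

text \<open>Normal form of an \<open>A\<^sub>2\<close> point: in coordinates \<open>x = t\<^sup>2\<close>, \<open>y = t\<^sup>3 (P (t\<^sup>2) + t Q (t\<^sup>2))\<close>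
  the shear \<open>(x, y) \<mapsto> (x, (y - x\<^sup>2 Q x) / P x)\<close> yields \<open>(t\<^sup>2, t\<^sup>3)\<close>.\<close>

lemma cusp_atI:
  fixes \<gamma> :: "real \<Rightarrow> real^2"
  assumes sm: "smooth_on UNIV \<gamma>" and d1: "nth_deriv 1 \<gamma> s = 0"
    and d23: "cross2 (nth_deriv 2 \<gamma> s) (nth_deriv 3 \<gamma> s) \<noteq> 0"
  shows "cusp_at \<gamma> s"
proof -
  define v where "v = nth_deriv 2 \<gamma> s"
  define w where "w = nth_deriv 3 \<gamma> s"
  define d where "d = cross2 v w"
  have d: "d \<noteq> 0" using d23 by (simp add: d_def v_def w_def)
  \<comment> \<open>Coordinates along \<open>v\<close> and \<open>w\<close>. The constants 2 and 6
    cancel the factorials of the Taylor terms, so that \<open>x\<close> starts with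
    \<open>t ^ 2\<close> and \<open>y\<close> with \<open>t ^ 3\<close>.\<close>
  define hx where "hx z = 2 / d * cross2 z w" for z
  define hy where "hy z = 6 / d * cross2 v z" for z
  have blx: "bounded_linear hx" unfolding hx_def[abs_def]
    by (intro bounded_linear_const_mult bounded_bilinear.bounded_linear_left[OF bounded_bilinear_cross2])
  have bly: "bounded_linear hy" unfolding hy_def[abs_def]
    by (intro bounded_linear_const_mult bounded_bilinear.bounded_linear_right[OF bounded_bilinear_cross2])
  have hvw: "hx v = 2" "hx w = 0" "hy v = 0" "hy w = 6"
    using d by (simp_all add: hx_def hy_def d_def) (simp_all add: cross2_def)
  have expand: "z = (hx z / 2) *\<^sub>R v + (hy z / 6) *\<^sub>R w" for z
    using cross2_expand[of v w z] d by (simp add: hx_def hy_def d_def)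
  define x where "x t = hx (\<gamma> (s + t) - \<gamma> s)" for t
  define y where "y t = hy (\<gamma> (s + t) - \<gamma> s)" for t
  have sx: "smooth_on UNIV x" and sy: "smooth_on UNIV y"
    unfolding x_def[abs_def] y_def[abs_def] using nth_deriv_linear_shift(1) sm blx bly by blast+
  have x0: "x 0 = 0" "y 0 = 0" using blx bly by (auto simp: x_def y_def linear_0 bounded_linear.linear)
  have dx: "nth_deriv (Suc n) x 0 = hx (nth_deriv (Suc n) \<gamma> s)"
    and dy: "nth_deriv (Suc n) y 0 = hy (nth_deriv (Suc n) \<gamma> s)" for n
    using nth_deriv_linear_shift(2)[OF blx sm, of n s "\<gamma> s" 0] nth_deriv_linear_shift(2)[OF bly sm, of n s "\<gamma> s" 0]
    unfolding x_def[abs_def] y_def[abs_def] by simp_all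
  have x123: "nth_deriv 1 x 0 = 0" "nth_deriv 2 x 0 = 2"
    and y123: "nth_deriv 1 y 0 = 0" "nth_deriv 2 y 0 = 0" "nth_deriv 3 y 0 = 6"
    using dx[of 0] dx[of 1] dx[of 2] dy[of 0] dy[of 1] dy[of 2] d1 hvw
      linear_0[OF bounded_linear.linear[OF blx]] linear_0[OF bounded_linear.linear[OF bly]]
    by (simp_all add: v_def w_def numeral_2_eq_2 numeral_3_eq_3)
  have sh: "smooth_on UNIV (hadamard f)" if "smooth_on UNIV f" for f
    by (rule smooth_on_hadamard[OF _ _ _ that]) auto
  have he: "f t = f 0 + t * hadamard f t" if "smooth_on UNIV f" for f t
    by (rule hadamard_eq[OF _ _ _ that]) auto
  \<comment> \<open>The vanishing Taylor coefficients, two of \<open>x\<close> and three of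
    \<open>y\<close>, are divided out; what remains has value 1 at 0.\<close>
  define a where "a = hadamard (hadamard x)"
  define b where "b = hadamard (hadamard (hadamard y))"
  have sa: "smooth_on UNIV a" and sb: "smooth_on UNIV b" unfolding a_def b_def by (intro sh sx sy)+
  have a0: "a 0 = 1" and hx0: "hadamard x 0 = 0"
    using nth_deriv_hadamard_0[OF sh[OF sx], of 0] nth_deriv_hadamard_0[OF sx, of 1] nth_deriv_hadamard_0[OF sx, of 0] x123
    by (simp_all add: a_def numeral_2_eq_2)
  have b0: "b 0 = 1" and hy0: "hadamard (hadamard y) 0 = 0" "hadamard y 0 = 0"
    using nth_deriv_hadamard_0[OF sh[OF sh[OF sy]], of 0] nth_deriv_hadamard_0[OF sh[OF sy], of 0]
      nth_deriv_hadamard_0[OF sh[OF sy], of 1] nth_deriv_hadamard_0[OF sy, of 0]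
      nth_deriv_hadamard_0[OF sy, of 1] nth_deriv_hadamard_0[OF sy, of 2] y123
    by (simp_all add: b_def numeral_2_eq_2 numeral_3_eq_3)
  have xa: "x t = t\<^sup>2 * a t" for t
    using he[OF sx, of t] he[OF sh[OF sx], of t] x0 hx0 by (simp add: a_def power2_eq_square)
  have yb: "y t = t ^ 3 * b t" for t
    using he[OF sy, of t] he[OF sh[OF sy], of t] he[OF sh[OF sh[OF sy]], of t] x0 hy0
    by (simp add: b_def power3_eq_cube)
  define S0 where "S0 = {t. a t > 0}"
  have ca: "continuous_on UNIV a" using sa by (rule smooth_on_imp_continuous)
  have S0: "open S0" "0 \<in> S0"
    unfolding S0_def using ca by (auto simp: a0 intro: open_Collect_less continuous_on_const)
  \<comment> \<open>The smooth signed square root of \<open>x\<close>: in this new parameter the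
    first coordinate is exactly a square.\<close>
  define \<tau> where "\<tau> t = t * sqrt (a t)" for t
  have ssq: "smooth_on S0 (\<lambda>t. sqrt (a t))"
    by (rule smooth_on_sqrt_comp[OF S0(1) smooth_on_subset[OF _ sa]]) (auto simp: S0_def)
  have s\<tau>: "smooth_on S0 \<tau>"
    unfolding \<tau>_def[abs_def] by (intro smooth_on_mult smooth_on_id ssq S0)
  let ?d = "\<lambda>t. vector_derivative \<tau> (at t)"
  have "?d 0 = 1"
  proof (rule vector_derivative_at)
    obtain D where "((\<lambda>t. sqrt (a t)) has_real_derivative D) (at 0)"
      using smooth_on_has_vector_derivative[OF S0(1) ssq S0(2)]
      by (auto simp: has_real_derivative_iff_has_vector_derivative)
    from DERIV_mult[OF DERIV_ident this] show "(\<tau> has_vector_derivative 1) (at 0)"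
      unfolding \<tau>_def[abs_def] has_real_derivative_iff_has_vector_derivative[symmetric]
      by (simp add: a0)
  qed
  moreover have cd: "continuous_on S0 ?d"
    by (rule smooth_on_imp_continuous[OF smooth_on_vector_derivative[OF S0(1) s\<tau>]])
  ultimately have op: "open (S0 \<inter> ?d -` {0<..})" "0 \<in> S0 \<inter> ?d -` {0<..}"
    using S0 continuous_open_preimage[OF cd S0(1), of "{0<..}"] by auto
  then obtain r where r: "r > 0" "ball 0 r \<subseteq> S0 \<inter> ?d -` {0<..}"
    using open_contains_ball by metis
  define S where "S = ball (0::real) r"
  have S: "open S" "connected S" "0 \<in> S" "S \<subseteq> S0" "\<And>t. t \<in> S \<Longrightarrow> ?d t > 0"
    using r by (auto simp: S_def)
  have dif: "diffeo_on S (\<tau> ` S) \<tau>"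
    by (rule diffeo_on_real[OF S(1,2) smooth_on_subset[OF S(4) s\<tau>] S(5)])
  obtain \<phi> where \<phi>: "diffeo_on (\<tau> ` S) S \<phi>" "\<And>t. t \<in> S \<Longrightarrow> \<phi> (\<tau> t) = t"
    "\<And>t. t \<in> \<tau> ` S \<Longrightarrow> \<tau> (\<phi> t) = t" "\<tau> ` S = \<tau> ` S" "\<phi> ` \<tau> ` S = S"
    by (rule diffeo_onE[OF dif]) (rule that)
  have opT: "open (\<tau> ` S)" and s\<phi>: "smooth_on (\<tau> ` S) \<phi>" using \<phi>(1) by (auto simp: diffeo_on_def)
  have T0: "0 \<in> \<tau> ` S" using S(3) by (force simp: \<tau>_def)
  have \<phi>0: "\<phi> 0 = 0" using \<phi>(2)[OF S(3)] by (simp add: \<tau>_def)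
  obtain \<delta> where \<delta>: "\<delta> > 0" "ball 0 \<delta> \<subseteq> \<tau> ` S" using opT T0 open_contains_ball by metis
  have bl: "ball 0 \<delta> = {-\<delta><..<\<delta>}" by (auto simp: dist_real_def)
  define B where "B u = b (\<phi> u) / sqrt (a (\<phi> u)) ^ 3" for u
  have apos: "a (\<phi> u) > 0" if "u \<in> \<tau> ` S" for u
    using \<phi>(5) S(4) that by (auto simp: S0_def)
  have sB: "smooth_on {-\<delta><..<\<delta>} B"
  proof -
    have "smooth_on (\<tau> ` S) (\<lambda>u. a (\<phi> u))" "smooth_on (\<tau> ` S) (\<lambda>u. b (\<phi> u))"
      using smooth_on_compose_UNIV[OF opT _ s\<phi>] sa sb by auto
    moreover have "sqrt (a (\<phi> u)) ^ 3 \<noteq> 0" if "u \<in> \<tau> ` S" for u using apos[OF that] by simp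
    ultimately have "smooth_on (\<tau> ` S) B"
      unfolding B_def[abs_def] using apos
      by (intro smooth_on_divide smooth_on_power smooth_on_sqrt_comp opT)
    then show ?thesis using \<delta>(2) smooth_on_subset unfolding bl by blast
  qed
  obtain P Q \<eta>0 where PQ: "0 < \<eta>0" "\<eta>0 \<le> \<delta>\<^sup>2" "smooth_on {-\<eta>0<..<\<eta>0} P" "smooth_on {-\<eta>0<..<\<eta>0} Q"
    "\<And>t. t\<^sup>2 < \<eta>0 \<Longrightarrow> B t = P (t\<^sup>2) + t * Q (t\<^sup>2)"
    by (rule smooth_even_odd_split[OF \<delta>(1) sB]) (rule that)
  have "P 0 = 1" using PQ(5)[of 0] PQ(1) by (simp add: B_def \<phi>0 a0 b0)
  then have "0 \<in> {-\<eta>0<..<\<eta>0} \<inter> P -` {0<..}" using PQ(1) by simp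
  moreover have "open ({-\<eta>0<..<\<eta>0} \<inter> P -` {0<..})"
    by (intro continuous_open_preimage smooth_on_imp_continuous[OF PQ(3)] open_greaterThanLessThan open_greaterThan)
  ultimately obtain \<eta> where \<eta>: "\<eta> > 0" "ball 0 \<eta> \<subseteq> {-\<eta>0<..<\<eta>0} \<inter> P -` {0<..}"
    using open_contains_ball by metis
  \<comment> \<open>An interval on which \<open>P\<close> stays positive, so that the shear may
    divide by it; the plane domains \<open>V\<close> and \<open>W\<close> are the strips over
    \<open>K\<close>.\<close>
  define K where "K = {-\<eta><..<\<eta>}"
  have K: "K \<subseteq> {-\<eta>0<..<\<eta>0}" "\<And>u. u \<in> K \<Longrightarrow> P u > 0" "open K"
    using \<eta>(2) by (auto simp: K_def subset_iff dist_real_def)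
  have sP: "smooth_on K P" and sQ: "smooth_on K Q" using PQ(3,4) K(1) smooth_on_subset by blast+
  define U where "U = {u. u \<in> {-\<delta><..<\<delta>} \<and> u\<^sup>2 < \<eta>}"
  have "open ({-\<delta><..<\<delta>} \<inter> {u. u\<^sup>2 < \<eta>})"
    by (intro open_Int open_Collect_less continuous_intros open_greaterThanLessThan)
  then have U: "open U" "0 \<in> U" "U \<subseteq> \<tau> ` S" using \<delta> \<eta>(1) by (auto simp: U_def bl Int_def)
  define V where "V = {z. hx (z - \<gamma> s) \<in> K}"
  define W where "W = {p::real^2. p $ 1 \<in> K}"
  define \<psi> where "\<psi> z = (vector [hx (z - \<gamma> s), (hy (z - \<gamma> s) - (hx (z - \<gamma> s))\<^sup>2 * Q (hx (z - \<gamma> s))) / P (hx (z - \<gamma> s))]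
      :: real^2)" for z
  \<comment> \<open>The explicit inverse of the shear, expressed in the basis \<open>v\<close>,
    \<open>w\<close>.\<close>
  define \<zeta> where "\<zeta> p = \<gamma> s + ((p $ 1 / 2) *\<^sub>R v + ((p $ 2 * P (p $ 1) + (p $ 1)\<^sup>2 * Q (p $ 1)) / 6) *\<^sub>R w)"
    for p :: "real^2"
  have chx: "continuous_on UNIV (\<lambda>z. hx (z - \<gamma> s))"
    by (intro bounded_linear.continuous_on[OF blx] continuous_intros)
  have oV: "open V"
    using continuous_open_preimage[OF chx open_UNIV K(3)] by (simp add: V_def vimage_def)
  have oW: "open W"
    using continuous_open_preimage[OF _ open_UNIV K(3), of "\<lambda>p::real^2. p $ 1"]
    by (simp add: W_def vimage_def continuous_on_component continuous_on_id)
  have slin: "smooth_on V (\<lambda>z. hx (z - \<gamma> s))" "smooth_on V (\<lambda>z. hy (z - \<gamma> s))"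
    by (intro smooth_on_linear[OF blx] smooth_on_linear[OF bly] smooth_on_diff smooth_on_id smooth_on_const oV)+
  have s\<psi>: "smooth_on V \<psi>"
  proof -
    have "smooth_on V (\<lambda>z. P (hx (z - \<gamma> s)))" "smooth_on V (\<lambda>z. Q (hx (z - \<gamma> s)))"
      using smooth_on_compose[OF oV K(3) _ sP slin(1)] smooth_on_compose[OF oV K(3) _ sQ slin(1)]
      by (auto simp: V_def)
    moreover have "P (hx (z - \<gamma> s)) \<noteq> 0" if "z \<in> V" for z
      using K(2)[of "hx (z - \<gamma> s)"] that by (simp add: V_def)
    ultimately show ?thesis unfolding \<psi>_def[abs_def]
      by (intro smooth_on_vector2 smooth_on_divide smooth_on_diff smooth_on_mult smooth_on_power slin oV)
  qed
  have sp: "smooth_on W (\<lambda>p. p $ i)" for i by (intro smooth_on_nth smooth_on_id oW)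
  have s\<zeta>: "smooth_on W \<zeta>"
  proof -
    have "smooth_on W (\<lambda>p. P (p $ 1))" "smooth_on W (\<lambda>p. Q (p $ 1))"
      using smooth_on_compose[OF oW K(3) _ sP sp[of 1]] smooth_on_compose[OF oW K(3) _ sQ sp[of 1]]
      by (auto simp: W_def)
    then show ?thesis unfolding \<zeta>_def[abs_def]
      by (intro smooth_on_add smooth_on_scaleR smooth_on_const smooth_on_linear[OF bounded_linear_divide]
          smooth_on_mult smooth_on_power sp oW)
  qed
  have hc: "hx (\<zeta> p - \<gamma> s) = p $ 1" "hy (\<zeta> p - \<gamma> s) = p $ 2 * P (p $ 1) + (p $ 1)\<^sup>2 * Q (p $ 1)" for p
    using bounded_linear.linear[OF blx] bounded_linear.linear[OF bly] hvw
    by (simp_all add: \<zeta>_def linear_add linear_cmul)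
  have \<psi>\<zeta>: "\<psi> (\<zeta> p) = p" if "p \<in> W" for p
    using K(2)[of "p $ 1"] that by (simp add: \<psi>_def hc W_def vec_eq_iff forall_2)
  have \<zeta>\<psi>: "\<zeta> (\<psi> z) = z" if "z \<in> V" for z
  proof -
    have "P (hx (z - \<gamma> s)) \<noteq> 0" using K(2)[of "hx (z - \<gamma> s)"] that by (simp add: V_def)
    then have "\<zeta> (\<psi> z) = \<gamma> s + ((hx (z - \<gamma> s) / 2) *\<^sub>R v + (hy (z - \<gamma> s) / 6) *\<^sub>R w)"
      by (simp add: \<zeta>_def \<psi>_def)
    then show ?thesis using expand[of "z - \<gamma> s"] by simp
  qed
  have dV: "diffeo_on V W \<psi>"
    unfolding diffeo_on_def
  proof (intro conjI exI[of _ \<zeta>] oV oW s\<psi> s\<zeta>)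
    show "homeomorphism V W \<psi> \<zeta>"
    proof (rule homeomorphismI)
      show "\<psi> ` V \<subseteq> W" "\<zeta> ` W \<subseteq> V" by (auto simp: V_def W_def hc \<psi>_def)
    qed (simp_all add: \<psi>\<zeta> \<zeta>\<psi> smooth_on_imp_continuous s\<psi> s\<zeta>)
  qed
  have d\<phi>: "diffeo_on U (\<phi> ` U) \<phi>" by (rule diffeo_on_restrict[OF \<phi>(1) U(1,3)])
  have shift: "diffeo_on (\<phi> ` U) ((+) s ` \<phi> ` U) ((+) s)"
  proof -
    have o: "open (\<phi> ` U)" using d\<phi> by (simp add: diffeo_on_def)
    have "smooth_on (\<phi> ` U) ((+) s)" "smooth_on ((+) s ` \<phi> ` U) (\<lambda>x. - s + x)"
      using o open_translation[OF o, of s] by (intro smooth_on_add smooth_on_const smooth_on_id; simp)+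
    moreover have "homeomorphism (\<phi> ` U) ((+) s ` \<phi> ` U) ((+) s) (\<lambda>x. - s + x)"
      unfolding homeomorphism_def image_image by (simp add: continuous_on_add continuous_on_diff)
    ultimately show ?thesis using o open_translation[OF o, of s] by (auto simp: diffeo_on_def)
  qed
  have UK: "u\<^sup>2 \<in> K" if "u \<in> U" for u
    using that less_le_trans[of "- \<eta>" 0 "u\<^sup>2"] \<eta>(1) by (simp add: U_def K_def)
  have key: "hx (\<gamma> (s + \<phi> u) - \<gamma> s) = u\<^sup>2" "\<psi> (\<gamma> (s + \<phi> u)) = vector [u ^ 2, u ^ 3]" if u: "u \<in> U" for u
  proof -
    have uT: "u \<in> \<tau> ` S" using U u by auto
    let ?q = "sqrt (a (\<phi> u))"
    have q: "?q > 0" "?q\<^sup>2 = a (\<phi> u)" "u = \<phi> u * ?q"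
      using apos[OF uT] \<phi>(3)[OF uT] by (simp_all add: \<tau>_def)
    have X: "hx (\<gamma> (s + \<phi> u) - \<gamma> s) = u\<^sup>2"
    proof -
      have "hx (\<gamma> (s + \<phi> u) - \<gamma> s) = (\<phi> u)\<^sup>2 * ?q\<^sup>2" using xa[of "\<phi> u"] q(2) by (simp add: x_def)
      then show ?thesis using q(3) by (metis power_mult_distrib)
    qed
    then show "hx (\<gamma> (s + \<phi> u) - \<gamma> s) = u\<^sup>2" .
    have "hy (\<gamma> (s + \<phi> u) - \<gamma> s) = (\<phi> u) ^ 3 * b (\<phi> u)" using yb[of "\<phi> u"] by (simp add: y_def)
    also have "\<dots> = (\<phi> u * ?q) ^ 3 * B u" using q(1) by (simp add: B_def power_mult_distrib)
    also have "\<dots> = u ^ 3 * (P (u\<^sup>2) + u * Q (u\<^sup>2))"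
    proof -
      have "u\<^sup>2 < \<eta>0" using UK[OF u] K(1) by auto
      then show ?thesis using PQ(5)[of u] q(3) by simp
    qed
    finally have Y: "hy (\<gamma> (s + \<phi> u) - \<gamma> s) = u ^ 3 * P (u\<^sup>2) + (u\<^sup>2)\<^sup>2 * Q (u\<^sup>2)"
      by (simp add: algebra_simps power2_eq_square power3_eq_cube)
    have "P (u\<^sup>2) > 0" by (rule K(2)[OF UK[OF u]])
    then show "\<psi> (\<gamma> (s + \<phi> u)) = vector [u ^ 2, u ^ 3]"
      by (simp add: \<psi>_def X Y)
  qed
  show ?thesis
    unfolding cusp_at_def
  proof (intro exI conjI)
    show "diffeo_on U ((+) s ` \<phi> ` U) (\<lambda>u. s + \<phi> u)" by (rule diffeo_on_compose[OF d\<phi> shift])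
    show "0 \<in> U" by fact
    show "s + \<phi> 0 = s" by (simp add: \<phi>0)
    show "diffeo_on V W \<psi>" by fact
    show "\<gamma> ` (+) s ` \<phi> ` U \<subseteq> V"
      using key(1) UK by (auto simp: V_def)
    show "\<forall>t\<in>U. \<psi> (\<gamma> (s + \<phi> t)) = vector [t\<^sup>2, t ^ 3]" using key(2) by blast
  qed
qed

text \<open>Near \<open>s\<close> the curve is a smooth map applied to the model curve in the
  parameter \<open>\<phi>'\<close>, which vanishes at \<open>s\<close>. The model has velocity 0
  there, and the chain rule gives both the differentiability of \<open>\<gamma>\<close> at
  \<open>s\<close> and its zero velocity.\<close>

lemma cusp_at_imp_singular:
  fixes \<gamma> :: "real \<Rightarrow> real^2"
  assumes "cusp_at \<gamma> s"
  shows "nth_deriv 1 \<gamma> s = 0"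
proof -
  obtain U :: "real set" and I \<phi> and V W :: "(real^2) set" and \<psi> where
    h: "diffeo_on U I \<phi>" "0 \<in> U" "\<phi> 0 = s" "diffeo_on V W \<psi>" "\<gamma> ` I \<subseteq> V"
    "\<forall>t\<in>U. \<psi> (\<gamma> (\<phi> t)) = vector [t ^ 2, t ^ 3]"
    using assms unfolding cusp_at_def by blast
  obtain \<phi>' where \<phi>': "diffeo_on I U \<phi>'" "\<And>t. t \<in> U \<Longrightarrow> \<phi>' (\<phi> t) = t" "\<And>t. t \<in> I \<Longrightarrow> \<phi> (\<phi>' t) = t"
    "\<phi> ` U = I" "\<phi>' ` I = U"
    by (rule diffeo_onE[OF h(1)]) (rule that)
  obtain \<zeta> where \<zeta>: "diffeo_on W V \<zeta>" "\<And>z. z \<in> V \<Longrightarrow> \<zeta> (\<psi> z) = z"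
    "\<And>y. y \<in> W \<Longrightarrow> \<psi> (\<zeta> y) = y" "\<psi> ` V = W" "\<zeta> ` W = V"
    by (rule diffeo_onE[OF h(4)]) (rule that)
  have sI: "s \<in> I" "open I" using h \<phi>' by (auto simp: diffeo_on_def)
  have s0: "\<phi>' s = 0" using \<phi>'(2)[OF h(2)] h(3) by simp
  have eq: "\<gamma> r = \<zeta> (vector [(\<phi>' r)\<^sup>2, (\<phi>' r) ^ 3])" if "r \<in> I" for r
  proof -
    have "\<phi>' r \<in> U" using \<phi>'(5) that by auto
    then have "\<psi> (\<gamma> r) = vector [(\<phi>' r)\<^sup>2, (\<phi>' r) ^ 3]" using h(6) \<phi>'(3)[OF that] by metis
    moreover have "\<gamma> r \<in> V" using h(5) that by auto
    ultimately show ?thesis using \<zeta>(2) by metis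
  qed
  obtain D where D: "(\<phi>' has_real_derivative D) (at s)"
    using smooth_on_has_vector_derivative[of I \<phi>' s] \<phi>'(1) sI
    by (auto simp: diffeo_on_def has_real_derivative_iff_has_vector_derivative)
  have veq: "vector [(\<phi>' r)\<^sup>2, (\<phi>' r) ^ 3] = (\<phi>' r)\<^sup>2 *\<^sub>R (vector [1,0] :: real^2) + (\<phi>' r) ^ 3 *\<^sub>R vector [0,1]" for r
    by (simp add: vec_eq_iff forall_2)
  have d2: "((\<lambda>r. (\<phi>' r)\<^sup>2) has_real_derivative 0) (at s)"
    and d3: "((\<lambda>r. (\<phi>' r) ^ 3) has_real_derivative 0) (at s)"
    using D by (auto intro!: derivative_eq_intros simp: s0)
  have inner: "((\<lambda>r. vector [(\<phi>' r)\<^sup>2, (\<phi>' r) ^ 3] :: real^2) has_vector_derivative 0) (at s)"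
    unfolding veq
    using has_vector_derivative_add[OF has_vector_derivative_scaleR[OF d2 has_vector_derivative_const]
        has_vector_derivative_scaleR[OF d3 has_vector_derivative_const]]
    by simp
  have "\<psi> (\<gamma> s) = vector [(\<phi>' s)\<^sup>2, (\<phi>' s) ^ 3]"
    using h(6) h(2,3) s0 by metis
  moreover have "\<gamma> s \<in> V" using h(5) sI(1) by auto
  ultimately have "vector [(\<phi>' s)\<^sup>2, (\<phi>' s) ^ 3] \<in> W"
    using \<zeta>(4) by (metis imageI)
  then have "\<zeta> differentiable (at (vector [(\<phi>' s)\<^sup>2, (\<phi>' s) ^ 3]))"
    using \<zeta>(1) smooth_on_differentiable unfolding diffeo_on_def by blast
  then obtain E where E: "(\<zeta> has_derivative E) (at (vector [(\<phi>' s)\<^sup>2, (\<phi>' s) ^ 3]))"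
    by (auto simp: differentiable_def)
  have "((\<lambda>r. \<zeta> (vector [(\<phi>' r)\<^sup>2, (\<phi>' r) ^ 3])) has_derivative (\<lambda>x. E (x *\<^sub>R 0))) (at s)"
    using has_derivative_compose[OF inner[unfolded has_vector_derivative_def] E] .
  then have "((\<lambda>r. \<zeta> (vector [(\<phi>' r)\<^sup>2, (\<phi>' r) ^ 3])) has_vector_derivative 0) (at s)"
    using has_derivative_linear[OF E] by (simp add: has_vector_derivative_def linear_0)
  then have "(\<gamma> has_vector_derivative 0) (at s)"
    by (rule has_vector_derivative_transform_within_open[OF _ sI(2,1)]) (use eq in auto)
  then show ?thesis unfolding nth_deriv_1 by (rule vector_derivative_at)
qed

section \<open>The tangent angle of a convex curve\<close>

text \<open>The sign \<open>\<epsilon>\<close> records the orientation of the curve, so that the angle can always be taken increasing.\<close>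

definition dir :: "real \<Rightarrow> real \<Rightarrow> real^2" where
  "dir \<epsilon> \<theta> = vector [cos \<theta>, \<epsilon> * sin \<theta>]"

text \<open>The data are speed \<open>m\<close> and an increasing tangent angle
  \<open>\<Theta>\<close> making one turn per period. They already force \<open>f\<close> to be a
  convex curve (\<open>is_convex_curve\<close>), so a perturbed curve can be certified by exhibiting
  its angle data.\<close>

definition angle_rep :: "(real \<Rightarrow> real^2) \<Rightarrow> (real \<Rightarrow> real) \<Rightarrow> (real \<Rightarrow> real) \<Rightarrow> real \<Rightarrow> bool" where
  "angle_rep f m \<Theta> \<epsilon> \<longleftrightarrow>
     smooth_on UNIV m \<and> smooth_on UNIV \<Theta> \<and> (\<forall>s. m s > 0) \<and> (\<forall>s. vector_derivative \<Theta> (at s) > 0) \<and>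
     (\<forall>s. m (s + 2 * pi) = m s) \<and> (\<forall>s. \<Theta> (s + 2 * pi) = \<Theta> s + 2 * pi) \<and> \<epsilon> \<in> {1, -1} \<and>
     (\<forall>s. (f has_vector_derivative m s *\<^sub>R dir \<epsilon> (\<Theta> s)) (at s)) \<and> (\<forall>s. f (s + 2 * pi) = f s)"

section \<open>Periodic functions, antiderivatives and continuous arguments\<close>

lemma periodic_of_int:
  fixes F :: "real \<Rightarrow> 'a"
  assumes per: "\<And>t. F (t + L) = F t"
  shows "F (t + of_int n * L) = F t"
proof -
  have N: "F (t + real n * L) = F t" for t n
  proof (induction n)
    case (Suc n)
    have "t + real (Suc n) * L = (t + real n * L) + L" by (simp add: algebra_simps)
    then show ?case using Suc by (simp only: per)
  qed simp
  show ?thesis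
  proof (cases "n \<ge> 0")
    case True
    then show ?thesis using N[of t "nat n"] by simp
  next
    case False
    then show ?thesis using N[of "t + of_int n * L" "nat (- n)"] by (simp add: algebra_simps)
  qed
qed

lemma ex_shift_into_period:
  fixes t a L :: real
  assumes "L > 0"
  obtains n :: int where "t + of_int n * L \<in> {a..<a + L}"
proof
  define n where "n = \<lfloor>(t - a) / L\<rfloor>"
  have "of_int n \<le> (t - a) / L" "(t - a) / L < of_int n + 1" unfolding n_def by linarith+
  then show "t + of_int (- n) * L \<in> {a..<a + L}" using assms by (auto simp: field_simps)
qed

lemma antiderivative_UNIV:
  fixes f :: "real \<Rightarrow> real"
  assumes "continuous_on UNIV f"
  obtains g where "\<And>x. (g has_real_derivative f x) (at x)" "g 0 = c"
proof -
  define g where "g x = c + (integral {0..x} f - integral {x..0} f)" for x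
  have "(g has_real_derivative f x) (at x)" for x
  proof -
    define N where "N = \<bar>x\<bar> + 1"
    have int: "f integrable_on {a..b}" for a b
      by (rule integrable_continuous_interval) (rule continuous_on_subset[OF assms subset_UNIV])
    \<comment> \<open>Around \<open>x\<close> the signed integral from 0 differs by a constant from
      the integral starting at \<open>-N\<close>, to which the fundamental theorem applies on both
      sides of 0.\<close>
    have eq: "g y = c - integral {-N..0} f + integral {-N..y} f" if "y \<in> {-N<..<N}" for y
    proof (cases "y \<ge> 0")
      case True
      have "integral {-N..0} f + integral {0..y} f = integral {-N..y} f"
        by (rule Henstock_Kurzweil_Integration.integral_combine) (use True int N_def in auto)
      then show ?thesis using True by (cases "y = 0") (simp_all add: g_def)
    next
      case False
      have "integral {-N..y} f + integral {y..0} f = integral {-N..0} f"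
        by (rule Henstock_Kurzweil_Integration.integral_combine) (use False that int in auto)
      then show ?thesis using False by (simp add: g_def)
    qed
    have "((\<lambda>y. integral {-N..y} f) has_vector_derivative f x) (at x within {-N..N})"
      by (rule integral_has_vector_derivative) (auto simp: N_def intro: continuous_on_subset[OF assms])
    moreover have "at x within {-N..N} = at x"
      by (rule at_within_interior) (auto simp: N_def)
    ultimately have "((\<lambda>y. integral {-N..y} f) has_real_derivative f x) (at x)"
      by (simp add: has_real_derivative_iff_has_vector_derivative)
    then have "((\<lambda>y. c - integral {-N..0} f + integral {-N..y} f) has_real_derivative f x) (at x)"
      by (auto intro!: derivative_eq_intros)
    then show ?thesis
      by (rule has_field_derivative_transform_within_open[of _ _ _ "{-N<..<N}"]) (auto simp: eq, auto simp: N_def)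
  qed
  moreover have "g 0 = c" by (simp add: g_def)
  ultimately show thesis by (rule that)
qed

text \<open>Integration of the logarithmic derivative of \<open>p + i q\<close> gives
  \<open>A\<close> and \<open>\<Phi>\<close>; the curve divided by the resulting exponential has
  derivative 0 and starts at 1.\<close>

lemma complex_curve_polar:
  fixes p q :: "real \<Rightarrow> real"
  assumes sm: "smooth_on UNIV p" "smooth_on UNIV q" and nz: "\<And>s. (p s)\<^sup>2 + (q s)\<^sup>2 \<noteq> 0"
    and d: "\<And>s. (p has_real_derivative p' s) (at s)" "\<And>s. (q has_real_derivative q' s) (at s)"
  obtains A \<Phi> where "smooth_on UNIV A" "smooth_on UNIV \<Phi>"
    "\<And>s. (\<Phi> has_real_derivative (p s * q' s - q s * p' s) / ((p s)\<^sup>2 + (q s)\<^sup>2)) (at s)"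
    "\<And>s. Complex (p s) (q s) = exp (Complex (A s) (\<Phi> s))"
proof -
  have sd: "smooth_on UNIV p'" "smooth_on UNIV q'"
    using smooth_on_derivD[OF open_UNIV sm(1)] smooth_on_derivD[OF open_UNIV sm(2)] d
    by (auto simp: has_real_derivative_iff_has_vector_derivative)
  define \<omega> where "\<omega> s = (p s * q' s - q s * p' s) / ((p s)\<^sup>2 + (q s)\<^sup>2)" for s
  define \<rho> where "\<rho> s = (p s * p' s + q s * q' s) / ((p s)\<^sup>2 + (q s)\<^sup>2)" for s
  have s\<omega>: "smooth_on UNIV \<omega>" and s\<rho>: "smooth_on UNIV \<rho>"
    unfolding \<omega>_def[abs_def] \<rho>_def[abs_def]
    by (intro smooth_on_divide smooth_on_add smooth_on_diff smooth_on_mult smooth_on_power sm sd nz open_UNIV)+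
  have "Complex (p 0) (q 0) \<noteq> 0" using nz[of 0] by (auto simp: complex_eq_iff)
  then obtain c where c: "exp c = Complex (p 0) (q 0)" using exp_Ln by blast
  obtain \<Phi> where \<Phi>: "\<And>s. (\<Phi> has_real_derivative \<omega> s) (at s)" "\<Phi> 0 = Im c"
    using antiderivative_UNIV[OF smooth_on_imp_continuous[OF s\<omega>]] by metis
  obtain A where A: "\<And>s. (A has_real_derivative \<rho> s) (at s)" "A 0 = Re c"
    using antiderivative_UNIV[OF smooth_on_imp_continuous[OF s\<rho>]] by metis
  define h where "h s = Complex (p s) (q s) * exp (- Complex (A s) (\<Phi> s))" for s
  have Cv: "((\<lambda>s. Complex (u s) (v s)) has_vector_derivative Complex u' v') (at s)"
    if "(u has_real_derivative u') (at s)" "(v has_real_derivative v') (at s)" for u v u' v' s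
    using that unfolding has_vector_derivative_complex_iff has_real_derivative_iff_has_vector_derivative by simp
  have "(h has_vector_derivative 0) (at s)" for s
  proof -
    have 1: "((\<lambda>s. Complex (p s) (q s)) has_vector_derivative Complex (p' s) (q' s)) (at s)"
      by (rule Cv[OF d])
    have 2: "((\<lambda>s. exp (- Complex (A s) (\<Phi> s))) has_vector_derivative - Complex (\<rho> s) (\<omega> s) * exp (- Complex (A s) (\<Phi> s))) (at s)"
      using field_vector_diff_chain_at[OF has_vector_derivative_minus[OF Cv[OF A(1)[of s] \<Phi>(1)[of s]]] DERIV_exp]
      by (simp add: o_def)
    have eq: "Complex (p s) (q s) * Complex (\<rho> s) (\<omega> s) = Complex (p' s) (q' s)"
    proof -
      let ?n = "(p s)\<^sup>2 + (q s)\<^sup>2"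
      have "p s * (p s * p' s + q s * q' s) - q s * (p s * q' s - q s * p' s) = p' s * ?n"
        "p s * (p s * q' s - q s * p' s) + q s * (p s * p' s + q s * q' s) = q' s * ?n"
        by (simp_all add: algebra_simps power2_eq_square)
      then show ?thesis using nz[of s]
        by (simp add: complex_eq_iff \<rho>_def \<omega>_def diff_divide_distrib[symmetric] add_divide_distrib[symmetric])
    qed
    have "(h has_vector_derivative Complex (p s) (q s) * (- Complex (\<rho> s) (\<omega> s) * exp (- Complex (A s) (\<Phi> s)))
        + Complex (p' s) (q' s) * exp (- Complex (A s) (\<Phi> s))) (at s)"
      unfolding h_def[abs_def] by (rule has_vector_derivative_mult[OF 1 2])
    then show ?thesis by (simp add: eq[symmetric] algebra_simps)
  qed
  then obtain k where k: "\<And>s. h s = k"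
    using has_vector_derivative_zero_constant[of UNIV h] by auto
  have "h 0 = 1"
  proof -
    have "Complex (A 0) (\<Phi> 0) = c" by (simp add: A(2) \<Phi>(2))
    then show ?thesis by (simp add: h_def c[symmetric] exp_minus)
  qed
  then have h1: "h s = 1" for s using k by metis
  have "Complex (p s) (q s) = exp (Complex (A s) (\<Phi> s))" for s
    using h1[of s] by (simp add: h_def exp_minus field_simps)
  moreover have "smooth_on UNIV A" "smooth_on UNIV \<Phi>"
    using smooth_on_derivI[OF open_UNIV _ s\<rho>] smooth_on_derivI[OF open_UNIV _ s\<omega>] A(1) \<Phi>(1)
    by (auto simp: has_real_derivative_iff_has_vector_derivative)
  ultimately show thesis using that[of A \<Phi>] \<Phi>(1) unfolding \<omega>_def by simp
qed

text \<open>A growth beyond \<open>pi\<close> would pass \<open>h a + pi / 2\<close>, which forces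
  \<open>cos (h a)\<close> to be positive, and then a value just after \<open>h a + pi\<close>,
  where the sine is negative.\<close>

lemma half_plane_angle_le:
  fixes h :: "real \<Rightarrow> real"
  assumes "a \<le> b" "continuous_on {a..b} h" "\<And>t. t \<in> {a..b} \<Longrightarrow> 0 \<le> sin (h t)" "sin (h a) = 0"
  shows "h b - h a \<le> pi"
proof (rule ccontr)
  assume c: "\<not> ?thesis"
  define \<delta> where "\<delta> = min (pi / 2) ((h b - h a - pi) / 2)"
  have \<delta>: "0 < \<delta>" "\<delta> < pi" "h a + pi + \<delta> \<le> h b" using c pi_gt_zero
    by (auto simp: \<delta>_def min_def field_simps)
  have s: "0 \<le> sin y" if "h a \<le> y" "y \<le> h b" for y
    using IVT'[of h a y b] that assms by (metis atLeastAtMost_iff)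
  have "0 \<le> sin (h a + pi / 2)" by (rule s) (use c pi_gt_zero in linarith)+
  then have "0 \<le> cos (h a)" by (simp add: sin_add assms(4))
  moreover have "cos (h a) \<noteq> 0" using assms(4) sin_cos_squared_add[of "h a"] by auto
  ultimately have "cos (h a) > 0" by simp
  moreover have "0 \<le> sin (h a + (pi + \<delta>))" by (rule s) (use \<delta> pi_gt_zero in linarith)+
  then have "0 \<le> - (cos (h a) * sin \<delta>)" by (simp add: sin_add[of "h a"] assms(4))
  moreover have "sin \<delta> > 0" using \<delta> by (simp add: sin_gt_zero)
  ultimately show False by (simp add: mult_le_0_iff)
qed

lemma half_plane_angle_abs_le:
  fixes h :: "real \<Rightarrow> real"
  assumes "a \<le> b" "continuous_on {a..b} h" "\<And>t. t \<in> {a..b} \<Longrightarrow> 0 \<le> sin (h t)" "sin (h a) = 0" "sin (h b) = 0"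
  shows "\<bar>h b - h a\<bar> \<le> pi"
proof -
  have "h (a + b - b) - h (a + b - a) \<le> pi"
  proof (rule half_plane_angle_le[OF assms(1), of "\<lambda>t. h (a + b - t)"])
    show "continuous_on {a..b} (\<lambda>t. h (a + b - t))"
      by (rule continuous_on_compose2[OF assms(2)]) (auto intro!: continuous_intros)
  qed (use assms in auto)
  then show ?thesis using half_plane_angle_le[OF assms(1-4)] by auto
qed

text \<open>The zeros of the sine are isolated: a path that moved would reach, by the intermediate
  value theorem, a positive distance below \<open>pi\<close> from its start, where the sine is not
  zero.\<close>

lemma discrete_angle_const:
  fixes h :: "real \<Rightarrow> real"
  assumes "a \<le> b" "continuous_on {a..b} h" "\<And>t. t \<in> {a..b} \<Longrightarrow> sin (h t) = 0"
  shows "h a = h b"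
proof -
  have le: "h b \<le> h a" if h: "continuous_on {a..b} h" "\<And>t. t \<in> {a..b} \<Longrightarrow> sin (h t) = 0" for h :: "real \<Rightarrow> real"
  proof (rule ccontr)
    assume c: "\<not> ?thesis"
    define \<delta> where "\<delta> = min (pi / 2) (h b - h a)"
    have \<delta>: "0 < \<delta>" "\<delta> < pi" "h a + \<delta> \<le> h b" using c pi_gt_zero by (auto simp: \<delta>_def min_def)
    obtain t where t: "t \<in> {a..b}" "h t = h a + \<delta>"
      using IVT'[of h a "h a + \<delta>" b] \<delta> assms(1) h(1) by auto
    have "sin (h a) = 0" using h(2)[of a] assms(1) by simp
    then have "cos (h a) * sin \<delta> = 0" using h(2)[OF t(1)] by (simp add: t(2) sin_add)
    moreover have "cos (h a) \<noteq> 0" using \<open>sin (h a) = 0\<close> sin_cos_squared_add[of "h a"] by auto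
    moreover have "sin \<delta> > 0" using \<delta> by (simp add: sin_gt_zero)
    ultimately show False by simp
  qed
  have "- h b \<le> - h a" by (rule le[of "\<lambda>t. - h t"]) (use assms in \<open>auto intro!: continuous_intros\<close>)
  then show ?thesis using le[OF assms(2,3)] by simp
qed

text \<open>Hopf's proof of the theorem of turning tangents: the secant direction, renormalised to extend
  to both edges of the strip \<open>s \<le> t \<le> s + L\<close>, has a continuous argument there.
  Starting at a lowest point, each of the two edge paths stays in a closed half plane.\<close>

lemma turning_tangent:
  fixes F F' :: "real \<Rightarrow> complex" and \<Phi> :: "real \<Rightarrow> real"
  assumes L: "L > 0" and dF: "\<And>s. (F has_vector_derivative F' s) (at s)" and cF': "continuous_on UNIV F'"
    and per: "\<And>s. F (s + L) = F s" "\<And>s. F' (s + L) = F' s"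
    and inj: "\<And>s t. s < t \<Longrightarrow> t < s + L \<Longrightarrow> F s \<noteq> F t"
    and pol: "\<And>s. F' s = exp (Complex (A s) (\<Phi> s))" and c\<Phi>: "continuous_on UNIV \<Phi>"
  obtains s where "\<bar>\<Phi> (s + L) - \<Phi> s\<bar> \<le> 2 * pi"
proof -
  \<comment> \<open>The mean velocity between \<open>s\<close> and \<open>t\<close>: it equals the
    difference quotient off the diagonal and is continuous across it.\<close>
  define D where "D x = integral {0..1} (\<lambda>u. F' (fst x + u * (snd x - fst x)))" for x
  have cD: "continuous_on UNIV D"
  proof -
    have "continuous_on (UNIV \<times> cbox 0 1) (\<lambda>y::(real \<times> real) \<times> real. F' (fst (fst y) + snd y * (snd (fst y) - fst (fst y))))"
      by (rule continuous_on_compose2[OF cF']) (auto intro!: continuous_intros)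
    then have "continuous_on UNIV (\<lambda>x. integral (cbox 0 1) (\<lambda>u. F' (fst x + u * (snd x - fst x))))"
      by (intro integral_continuous_on_param) (simp add: split_beta)
    then show ?thesis by (simp add: D_def[abs_def])
  qed
  have Dd: "D (s, s) = F' s" for s by (simp add: D_def)
  have Dsec: "(t - s) *\<^sub>R D (s, t) = F t - F s" for s t
  proof -
    have "((\<lambda>u. (t - s) *\<^sub>R F' (s + u * (t - s))) has_integral (F (s + 1 * (t - s)) - F (s + 0 * (t - s)))) {0..1}"
    proof (rule fundamental_theorem_of_calculus)
      fix u :: real
      have "((\<lambda>u. s + u * (t - s)) has_vector_derivative (t - s)) (at u)"
        by (auto simp: has_real_derivative_iff_has_vector_derivative[symmetric] intro!: derivative_eq_intros)
      from vector_diff_chain_at[OF this dF] 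
      show "((\<lambda>u. F (s + u * (t - s))) has_vector_derivative (t - s) *\<^sub>R F' (s + u * (t - s))) (at u within {0..1})"
        by (simp add: o_def has_vector_derivative_at_within)
    qed simp
    then have "integral {0..1} (\<lambda>u. (t - s) *\<^sub>R F' (s + u * (t - s))) = F (s + 1 * (t - s)) - F (s + 0 * (t - s))"
      by (rule integral_unique)
    then show ?thesis by (simp add: D_def)
  qed
  have Dper: "D (s + L, t + L) = D (s, t)" for s t
  proof -
    have "s + L + u * (t + L - (s + L)) = (s + u * (t - s)) + L" for u by (simp add: algebra_simps)
    then have "F' (s + L + u * (t + L - (s + L))) = F' (s + u * (t - s))" for u by (simp only: per(2))
    then show ?thesis unfolding D_def fst_conv snd_conv by simp
  qed
  define S where "S = {x::real \<times> real. fst x \<le> snd x \<and> snd x \<le> fst x + L}"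
  \<comment> \<open>Inside the strip this is \<open>(F t - F s) / ((t - s) * (L - (t - s)))\<close>.
    On the edge \<open>t = s\<close> it equals \<open>F' s / L\<close>, on the edge
    \<open>t = s + L\<close> it equals \<open>- F' s / L\<close>. Each of the two formulas removes
    the singularity at one edge.\<close>
  define H where "H x = (if snd x - fst x \<le> L / 2 then D x / of_real (L - (snd x - fst x))
      else - D (snd x, fst x + L) / of_real (snd x - fst x))" for x
  have agree: "D (s, t) / of_real (L - (t - s)) = - D (t, s + L) / of_real (t - s)" if "s < t" "t < s + L" for s t
  proof -
    have 1: "D (s, t) * of_real (t - s) = F t - F s"
      using Dsec[of t s] by (simp add: scaleR_conv_of_real mult.commute)
    have "L - (t - s) = s + L - t" by simp
    then have 2: "D (t, s + L) * of_real (L - (t - s)) = F s - F t"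
      using Dsec[of "s + L" t] per(1)[of s] by (simp only: scaleR_conv_of_real mult.commute)
    have "D (s, t) * of_real (t - s) = - D (t, s + L) * of_real (L - (t - s))"
      unfolding mult_minus_left 1 2 by simp
    moreover have "complex_of_real (L - (t - s)) \<noteq> 0" "complex_of_real (t - s) \<noteq> 0"
      unfolding of_real_eq_0_iff using that by linarith+
    ultimately show ?thesis by (metis frac_eq_eq)
  qed
  have cH: "continuous_on S H"
  proof -
    let ?A = "{x \<in> S. snd x - fst x \<le> L / 2}" and ?B = "{x \<in> S. L / 2 \<le> snd x - fst x}"
    have SAB: "S = ?A \<union> ?B" by auto
    have "closed {x::real \<times> real. snd x - fst x \<le> L / 2}" "closed {x::real \<times> real. L / 2 \<le> snd x - fst x}"
      by (intro closed_Collect_le continuous_intros)+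
    then have clA: "closedin (top_of_set S) ?A" "closedin (top_of_set S) ?B"
      using closedin_closed_Int[of _ S] by (simp_all add: Collect_conj_eq)
    have 1: "continuous_on ?A (\<lambda>x. D x / of_real (L - (snd x - fst x)))"
      using L by (intro continuous_intros continuous_on_subset[OF cD]) (auto simp: complex_eq_iff)
    have 2: "continuous_on ?B (\<lambda>x. - D (snd x, fst x + L) / of_real (snd x - fst x))"
      using L by (intro continuous_intros continuous_on_compose2[OF cD]) (auto simp: complex_eq_iff)
    have "continuous_on (?A \<union> ?B) H" unfolding H_def[abs_def]
      by (rule continuous_on_cases_local[OF _ _ 1 2]) (use clA L agree SAB in auto)
    then show ?thesis using SAB by simp
  qed
  have nz: "H x \<noteq> 0" if "x \<in> S" for x
  proof -
    obtain s t where x: "x = (s, t)" by force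
    have st: "s \<le> t" "t \<le> s + L" using that by (auto simp: S_def x)
    have F0: "F' s \<noteq> 0" for s using pol by simp
    consider "t = s" | "t = s + L" | "s < t" "t < s + L" using st by linarith
    then show ?thesis
    proof cases
      case 1
      then show ?thesis using L F0 by (simp add: H_def x Dd)
    next
      case 2
      then show ?thesis using L F0 by (simp add: H_def x Dd)
    next
      case 3
      then have "D (s, t) \<noteq> 0" using Dsec[of t s] inj[of s t] by force
      moreover have "complex_of_real (L - (t - s)) \<noteq> 0" unfolding of_real_eq_0_iff using 3 by linarith
      ultimately have "D (s, t) / of_real (L - (t - s)) \<noteq> 0" by (simp only: divide_eq_0_iff simp_thms)
      then show ?thesis unfolding H_def x fst_conv snd_conv agree[OF 3, symmetric] if_cancel .
    qed
  qed
  \<comment> \<open>By periodicity the chord from \<open>t\<close> to \<open>s + L\<close> is the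
    reversed chord from \<open>s\<close> to \<open>t\<close>, so the second edge path is the first
    one turned by \<open>pi\<close>.\<close>
  have anti: "H (t, s + L) = - H (s, t)" if "s \<le> t" "t \<le> s + L" for s t
  proof -
    consider "t - s < L / 2" | "t - s = L / 2" | "t - s > L / 2" by linarith
    then show ?thesis
    proof cases
      case 1
      then show ?thesis using that Dper[of s t] by (simp add: H_def algebra_simps)
    next
      case 2
      then have "s < t" "t < s + L" using L by auto
      note a = agree[OF this]
      have e: "t - s = L / 2" "s + L - t = L / 2" "L - L / 2 = L / 2" using 2 by simp_all
      show ?thesis using a unfolding H_def fst_conv snd_conv e by simp
    next
      case 3
      then show ?thesis using that by (simp add: H_def algebra_simps)
    qed
  qed
  have "S = {x. inner (1, -1) x \<le> 0} \<inter> {x. inner (-1, 1) x \<le> L}"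
    by (auto simp: S_def inner_prod_def)
  then have "convex S" by (simp add: convex_Int convex_halfspace_le)
  then obtain g where g: "continuous_on S g" "\<And>x. x \<in> S \<Longrightarrow> H x = exp (g x)"
    by (rule continuous_logarithm_on_contractible[OF cH convex_imp_contractible nz]) (assumption, rule that)
  have cF: "continuous_on UNIV F"
    using dF by (auto intro!: continuous_at_imp_continuous_on has_vector_derivative_continuous)
  have "\<exists>x\<in>{0..L}. \<forall>y\<in>{0..L}. Im (F x) \<le> Im (F y)"
    by (rule continuous_attains_inf) (use L in \<open>auto intro!: continuous_intros continuous_on_subset[OF cF]\<close>)
  then obtain s0 where s0: "s0 \<in> {0..L}" "\<And>t. t \<in> {0..L} \<Longrightarrow> Im (F s0) \<le> Im (F t)"
    by blast
  have perZ: "F (t + of_int n * L) = F t" for t n by (rule periodic_of_int) (rule per(1))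
  have low: "Im (F s0) \<le> Im (F t)" for t
  proof -
    obtain n :: int where "t + of_int n * L \<in> {0..<0 + L}" using ex_shift_into_period[OF L] by blast
    then have "t + of_int n * L \<in> {0..L}" by simp
    then show ?thesis using s0(2) perZ[of t n] by metis
  qed
  have dIm: "((\<lambda>t. Im (F t)) has_real_derivative Im (F' t)) (at t)" for t
    using dF[of t] by (simp add: has_vector_derivative_complex_iff)
  have "Im (F' s0) = 0"
    by (rule DERIV_local_min[OF dIm, of 1]) (use low in auto)
  have ImH: "0 \<le> Im (H (s0, t))" if st: "s0 \<le> t" "t \<le> s0 + L" for t
  proof -
    consider "t = s0" | "t = s0 + L" | "s0 < t" "t < s0 + L" using st by linarith
    then show ?thesis
    proof cases
      case 3
      have "(t - s0) * Im (D (s0, t)) = Im (F t) - Im (F s0)" using arg_cong[OF Dsec[of t s0], of Im] by simp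
      then have "0 \<le> (t - s0) * Im (D (s0, t))" using low[of t] by simp
      then have "0 \<le> Im (D (s0, t))" using 3 by (simp add: zero_le_mult_iff)
      then have "0 \<le> Im (D (s0, t) / of_real (L - (t - s0)))" using 3 by (simp add: Im_divide_of_real)
      then show ?thesis unfolding H_def fst_conv snd_conv agree[OF 3, symmetric] if_cancel .
    qed (use L \<open>Im (F' s0) = 0\<close> per(2) in \<open>simp_all add: H_def Dd Im_divide_of_real\<close>)
  qed
  have ImH0: "Im (H (s0, s0)) = 0" "Im (H (s0, s0 + L)) = 0"
    using L \<open>Im (F' s0) = 0\<close> per(2) by (simp_all add: H_def Dd Im_divide_of_real)
  have inS: "(s0, t) \<in> S" "(t, s0 + L) \<in> S" if "t \<in> {s0..s0 + L}" for t using that by (auto simp: S_def)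
  have sg: "Im (H x) = exp (Re (g x)) * sin (Im (g x))" if "x \<in> S" for x
    using g(2)[OF that] by (simp add: Im_exp)
  define h1 where "h1 t = Im (g (s0, t))" for t
  \<comment> \<open>By \<open>anti\<close> the values of \<open>H\<close> on this path lie in the
    closed lower half plane; the summand \<open>pi\<close> moves them to the upper one.\<close>
  define h2 where "h2 t = Im (g (t, s0 + L)) + pi" for t
  have "\<bar>h1 (s0 + L) - h1 s0\<bar> \<le> pi"
  proof (rule half_plane_angle_abs_le[of s0 "s0 + L" h1])
    show "continuous_on {s0..s0 + L} h1" unfolding h1_def[abs_def]
      by (intro continuous_intros continuous_on_compose2[OF g(1)]) (use inS in auto)
    show "0 \<le> sin (h1 t)" if "t \<in> {s0..s0 + L}" for t
      using sg[OF inS(1)[OF that]] ImH[of t] that by (simp add: h1_def zero_le_mult_iff)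
    show "sin (h1 s0) = 0" "sin (h1 (s0 + L)) = 0"
      using sg[OF inS(1)[of s0]] sg[OF inS(1)[of "s0 + L"]] ImH0 L by (auto simp: h1_def)
  qed (use L in auto)
  moreover have "\<bar>h2 (s0 + L) - h2 s0\<bar> \<le> pi"
  proof (rule half_plane_angle_abs_le[of s0 "s0 + L" h2])
    show "continuous_on {s0..s0 + L} h2" unfolding h2_def[abs_def]
      by (intro continuous_intros continuous_on_compose2[OF g(1)]) (use inS in auto)
    have I: "Im (H (t, s0 + L)) = - Im (H (s0, t))" if "t \<in> {s0..s0 + L}" for t
      using anti[of s0 t] that by simp
    show "0 \<le> sin (h2 t)" if "t \<in> {s0..s0 + L}" for t
    proof -
      have "exp (Re (g (t, s0 + L))) * sin (Im (g (t, s0 + L))) \<le> 0"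
        using sg[OF inS(2)[OF that]] ImH[of t] I[OF that] that by simp
      then show ?thesis by (simp add: h2_def mult_le_0_iff)
    qed
    show "sin (h2 s0) = 0" "sin (h2 (s0 + L)) = 0"
      using sg[OF inS(2)[of s0]] sg[OF inS(2)[of "s0 + L"]] ImH0 L I[of s0] I[of "s0 + L"] by (auto simp: h2_def)
  qed (use L in auto)
  ultimately have "\<bar>Im (g (s0 + L, s0 + L)) - Im (g (s0, s0))\<bar> \<le> 2 * pi"
    by (simp add: h1_def h2_def)
  \<comment> \<open>On the diagonal \<open>H\<close> is \<open>F' / L\<close>, so the two arguments
    differ by a multiple of \<open>pi\<close>, which cannot vary along the path.\<close>
  moreover have "Im (g (s0, s0)) - \<Phi> s0 = Im (g (s0 + L, s0 + L)) - \<Phi> (s0 + L)"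
  proof (rule discrete_angle_const[of s0 "s0 + L" "\<lambda>t. Im (g (t, t)) - \<Phi> t"])
    show "continuous_on {s0..s0 + L} (\<lambda>t. Im (g (t, t)) - \<Phi> t)"
      using L by (intro continuous_intros continuous_on_compose2[OF g(1)] continuous_on_subset[OF c\<Phi>])
        (auto simp: S_def)
    fix t assume "t \<in> {s0..s0 + L}"
    have "exp (g (t, t)) = F' t / of_real L"
      using g(2)[of "(t, t)"] L by (simp add: S_def H_def Dd)
    then have "exp (g (t, t) - Complex (A t) (\<Phi> t)) = of_real (1 / L)"
      using pol[of t] by (simp add: exp_diff)
    then have "Im (exp (g (t, t) - Complex (A t) (\<Phi> t))) = 0" by simp
    then show "sin (Im (g (t, t)) - \<Phi> t) = 0" by (simp add: Im_exp)
  qed (use L in auto)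
  ultimately show thesis using that[of s0] by simp
qed

lemma nowhere_zero_const_sign:
  fixes w :: "real \<Rightarrow> real"
  assumes "continuous_on UNIV w" "\<And>x. w x \<noteq> 0"
  shows "\<exists>\<epsilon>\<in>{1,-1}. \<forall>x. 0 < \<epsilon> * w x"
proof -
  have "connected (range w)" using assms(1) connected_continuous_image connected_UNIV by blast
  then have "\<not> (w x < 0 \<and> 0 < w y)" for x y
    using connectedD_interval[of "range w" "w x" "w y" 0] assms(2) by (metis image_iff less_imp_le rangeI)
  then have "(\<forall>x. 0 < w x) \<or> (\<forall>x. w x < 0)" using assms(2) by (metis linorder_neqE_linordered_idom)
  then show ?thesis by auto
qed

lemma vector_derivative_periodic:
  fixes f :: "real \<Rightarrow> 'b::real_normed_vector"
  assumes "\<And>t. (f has_vector_derivative f' t) (at t)" "\<And>t. f (t + L) = f t"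
  shows "f' (t + L) = f' t"
proof -
  have "((\<lambda>t. t + L) has_vector_derivative 1) (at t)"
    by (auto simp: has_real_derivative_iff_has_vector_derivative[symmetric] intro!: derivative_eq_intros)
  from vector_diff_chain_at[OF this assms(1)] have "(f has_vector_derivative f' (t + L)) (at t)"
    by (simp add: o_def assms(2))
  then show ?thesis using assms(1) vector_derivative_unique_at by blast
qed

section \<open>The unit tangent as a function of the angle\<close>

lemma dir_nth [simp]: "dir \<epsilon> \<theta> $ 1 = cos \<theta>" "dir \<epsilon> \<theta> $ 2 = \<epsilon> * sin \<theta>"
  by (simp_all add: dir_def)

lemma dir_add_pi [simp]: "dir \<epsilon> (\<theta> + pi) = - dir \<epsilon> \<theta>"
  by (simp add: vec_eq_iff forall_2)

lemma dir_cross: "cross2 (dir \<epsilon> a) (dir \<epsilon> b) = \<epsilon> * sin (b - a)"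
  by (simp add: cross2_def sin_diff algebra_simps)

lemma dir_ne_0: "dir \<epsilon> \<theta> \<noteq> 0" if "\<epsilon> \<in> {1, -1}"
proof
  assume "dir \<epsilon> \<theta> = 0"
  then have "cos \<theta> = 0" "\<epsilon> * sin \<theta> = 0" using dir_nth[of \<epsilon> \<theta>] by simp_all
  then show False using that sin_cos_squared_add[of \<theta>] by auto
qed

lemma norm_dir: "norm (dir \<epsilon> \<theta>) = 1" if "\<epsilon> \<in> {1, -1}"
  using that by (auto simp: norm_vec_def L2_set_def sum_2)

lemma dir_eq_dir: "dir \<epsilon> b = cos (b - a) *\<^sub>R dir \<epsilon> a + sin (b - a) *\<^sub>R dir \<epsilon> (a + pi / 2)"
proof -
  have "b = (b - a) + a" by simp
  then have "cos b = cos (b - a) * cos a - sin (b - a) * sin a" "sin b = sin (b - a) * cos a + cos (b - a) * sin a"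
    by (metis cos_add, metis sin_add)
  then show ?thesis by (simp add: vec_eq_iff forall_2 sin_add cos_add algebra_simps)
qed

lemma smooth_on_dir:
  fixes g :: "real \<Rightarrow> real"
  shows "open S \<Longrightarrow> smooth_on S g \<Longrightarrow> smooth_on S (\<lambda>s. dir \<epsilon> (g s))"
  unfolding dir_def by (intro smooth_on_vector2 smooth_on_mult smooth_on_const smooth_on_cos smooth_on_sin)

lemma dir_has_derivative:
  assumes "(g has_real_derivative g') (at s)"
  shows "((\<lambda>s. dir \<epsilon> (g s)) has_vector_derivative g' *\<^sub>R dir \<epsilon> (g s + pi / 2)) (at s)"
proof -
  have eq: "dir \<epsilon> \<theta> = cos \<theta> *\<^sub>R (vector [1,0] :: real^2) + (\<epsilon> * sin \<theta>) *\<^sub>R vector [0,1]" for \<theta>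
    by (simp add: vec_eq_iff forall_2)
  have 1: "((\<lambda>s. cos (g s)) has_real_derivative - sin (g s) * g') (at s)"
    and 2: "((\<lambda>s. \<epsilon> * sin (g s)) has_real_derivative \<epsilon> * (cos (g s) * g')) (at s)"
    using assms by (auto intro!: derivative_eq_intros)
  have "((\<lambda>s. dir \<epsilon> (g s)) has_vector_derivative
      (- sin (g s) * g') *\<^sub>R (vector [1,0] :: real^2) + (\<epsilon> * (cos (g s) * g')) *\<^sub>R vector [0,1]) (at s)"
    unfolding eq
    using has_vector_derivative_add[OF has_vector_derivative_scaleR[OF 1 has_vector_derivative_const]
        has_vector_derivative_scaleR[OF 2 has_vector_derivative_const]] by simp
  moreover have "(- sin (g s) * g') *\<^sub>R (vector [1,0] :: real^2) + (\<epsilon> * (cos (g s) * g')) *\<^sub>R vector [0,1]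
      = g' *\<^sub>R dir \<epsilon> (g s + pi / 2)"
    by (simp add: vec_eq_iff forall_2 sin_add cos_add)
  ultimately show ?thesis by simp
qed

lemmas cross2_simps = bounded_bilinear.scaleR_right[OF bounded_bilinear_cross2]
  bounded_bilinear.scaleR_left[OF bounded_bilinear_cross2]
  bounded_bilinear.add_right[OF bounded_bilinear_cross2] dir_cross

text \<open>Moving frame: the tangent direction rotates into its quarter turn at rate
  \<open>W\<close>, and a second quarter turn gives the minus sign. The lemma serves twice, for the
  equidistants at a zero of the speed \<open>h\<close> and for the curve itself.\<close>

lemma nth_deriv_dir:
  assumes "nth_deriv 1 \<gamma> = (\<lambda>t. h t *\<^sub>R dir \<epsilon> (\<Theta> t))"
    and h: "\<And>t. (h has_real_derivative h1 t) (at t)" "\<And>t. (h1 has_real_derivative h2 t) (at t)"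
    and W: "\<And>t. (\<Theta> has_real_derivative W t) (at t)" "\<And>t. (W has_real_derivative W1 t) (at t)"
  shows "nth_deriv 2 \<gamma> t = (h t * W t) *\<^sub>R dir \<epsilon> (\<Theta> t + pi / 2) + h1 t *\<^sub>R dir \<epsilon> (\<Theta> t)" (is ?g2)
    and "nth_deriv 3 \<gamma> t = (h t * W1 t + 2 * h1 t * W t) *\<^sub>R dir \<epsilon> (\<Theta> t + pi / 2)
      + (h2 t - h t * (W t)\<^sup>2) *\<^sub>R dir \<epsilon> (\<Theta> t)"
proof -
  let ?e = "\<lambda>t. dir \<epsilon> (\<Theta> t)" and ?n = "\<lambda>t. dir \<epsilon> (\<Theta> t + pi / 2)"
  have W': "((\<lambda>t. \<Theta> t + pi / 2) has_real_derivative W t) (at t)" for t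
    using W(1)[of t] by (auto intro!: derivative_eq_intros)
  have d2: "nth_deriv 2 \<gamma> = (\<lambda>t. h t *\<^sub>R (W t *\<^sub>R ?n t) + h1 t *\<^sub>R ?e t)"
  proof
    fix t
    have "nth_deriv 2 \<gamma> t = vector_derivative (nth_deriv 1 \<gamma>) (at t)"
      using nth_deriv_Suc[of 1 \<gamma>] by (simp add: numeral_2_eq_2)
    also have "\<dots> = h t *\<^sub>R (W t *\<^sub>R ?n t) + h1 t *\<^sub>R ?e t"
      unfolding assms(1) by (rule vector_derivative_at[OF has_vector_derivative_scaleR[OF h(1) dir_has_derivative[OF W(1)]]])
    finally show "nth_deriv 2 \<gamma> t = h t *\<^sub>R (W t *\<^sub>R ?n t) + h1 t *\<^sub>R ?e t" .
  qed
  then show ?g2 by simp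
  have "nth_deriv 3 \<gamma> t = vector_derivative (nth_deriv 2 \<gamma>) (at t)"
    using nth_deriv_Suc[of 2 \<gamma>] by (simp add: numeral_3_eq_3 numeral_2_eq_2)
  also have "\<dots> = h t *\<^sub>R (W t *\<^sub>R (W t *\<^sub>R dir \<epsilon> (\<Theta> t + pi / 2 + pi / 2)) + W1 t *\<^sub>R ?n t)
       + h1 t *\<^sub>R (W t *\<^sub>R ?n t) + (h1 t *\<^sub>R (W t *\<^sub>R ?n t) + h2 t *\<^sub>R ?e t)"
    unfolding d2
    by (rule vector_derivative_at[OF has_vector_derivative_add[OF
        has_vector_derivative_scaleR[OF h(1) has_vector_derivative_scaleR[OF W(2) dir_has_derivative[OF W']]]
        has_vector_derivative_scaleR[OF h(2) dir_has_derivative[OF W(1)]]]])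
  also have "dir \<epsilon> (\<Theta> t + pi / 2 + pi / 2) = - ?e t"
    using dir_add_pi[of \<epsilon> "\<Theta> t"] by (simp add: add.assoc)
  finally show "nth_deriv 3 \<gamma> t = (h t * W1 t + 2 * h1 t * W t) *\<^sub>R ?n t + (h2 t - h t * (W t)\<^sup>2) *\<^sub>R ?e t"
    by (simp add: vec_eq_iff algebra_simps power2_eq_square)
qed

lemma exp_Complex_eqE:
  assumes "exp (Complex a x) = exp (Complex b y)"
  obtains n :: int where "x = y + of_int n * (2 * pi)"
proof -
  obtain n :: int where "Complex a x = Complex b y + (of_int (2 * n) * pi) * \<i>"
    using assms exp_eq by blast
  then have "x = y + of_int n * (2 * pi)" by (simp add: complex_eq_iff)
  then show thesis using that by blast
qed

text \<open>The total turning \<open>\<Delta>\<close> is a multiple of \<open>2 * pi\<close> because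
  the velocity is periodic. It is at most one turn by \<open>turning_tangent\<close>, and it is
  nonzero with sign \<open>\<epsilon>\<close> because the curvature keeps that sign. Only the upper
  bound of the theorem of turning tangents is therefore required.\<close>

lemma convex_curve_angle_rep:
  assumes "convex_curve f"
  obtains m \<Theta> \<epsilon> where "angle_rep f m \<Theta> \<epsilon>"
proof -
  have smf: "smooth_on UNIV f" and per: "\<And>t. f (t + 2 * pi) = f t" and inj: "inj_on f {0..<2 * pi}"
    and reg: "\<And>t. nth_deriv 1 f t \<noteq> 0" and curv: "\<And>t. curvature f t \<noteq> 0"
    using assms by (auto simp: convex_curve_def smooth_closed_curve_def)
  define f1 where "f1 = nth_deriv 1 f"
  define f2 where "f2 = nth_deriv 2 f"
  have d1: "(f has_vector_derivative f1 s) (at s)" and d2: "(f1 has_vector_derivative f2 s) (at s)" for s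
    using nth_deriv_has_derivative[OF open_UNIV smf, of s 0] nth_deriv_has_derivative[OF open_UNIV smf, of s 1]
    by (simp_all add: f1_def f2_def numeral_2_eq_2)
  have sm1: "smooth_on UNIV f1" unfolding f1_def by (rule smooth_on_nth_deriv[OF open_UNIV smf])
  have dn: "((\<lambda>s. f1 s $ i) has_real_derivative f2 s $ i) (at s)" for i s
    using bounded_linear.has_vector_derivative[OF bounded_linear_vec_nth d2]
    by (simp add: has_real_derivative_iff_has_vector_derivative)
  have nz: "(f1 s $ 1)\<^sup>2 + (f1 s $ 2)\<^sup>2 \<noteq> 0" for s
    using reg[of s] by (simp add: f1_def sum_power2_eq_zero_iff vec_eq_iff forall_2)
  obtain A \<Phi> where A: "smooth_on UNIV A" "smooth_on UNIV \<Phi>"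
    "\<And>s. (\<Phi> has_real_derivative (f1 s $ 1 * f2 s $ 2 - f1 s $ 2 * f2 s $ 1) / ((f1 s $ 1)\<^sup>2 + (f1 s $ 2)\<^sup>2)) (at s)"
    "\<And>s. Complex (f1 s $ 1) (f1 s $ 2) = exp (Complex (A s) (\<Phi> s))"
    using complex_curve_polar[OF smooth_on_nth[OF open_UNIV sm1] smooth_on_nth[OF open_UNIV sm1] nz dn dn] by metis
  define w where "w s = (f1 s $ 1 * f2 s $ 2 - f1 s $ 2 * f2 s $ 1) / ((f1 s $ 1)\<^sup>2 + (f1 s $ 2)\<^sup>2)" for s
  have dw: "(\<Phi> has_real_derivative w s) (at s)" for s using A(3) by (simp add: w_def)
  have w0: "w s \<noteq> 0" for s using curv[of s] nz[of s] by (auto simp: w_def curvature_def f1_def f2_def)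
  have sw: "smooth_on UNIV w"
    using smooth_on_derivD[OF open_UNIV A(2)] dw by (simp add: has_real_derivative_iff_has_vector_derivative)
  obtain \<epsilon> where \<epsilon>: "\<epsilon> \<in> {1, -1}" "\<And>s. 0 < \<epsilon> * w s"
    using nowhere_zero_const_sign[OF smooth_on_imp_continuous[OF sw] w0] by blast
  have per1: "f1 (s + 2 * pi) = f1 s" and per2: "f2 (s + 2 * pi) = f2 s" for s
    using vector_derivative_periodic[OF d1 per] vector_derivative_periodic[OF d2] by blast+
  have perw: "w (s + 2 * pi) = w s" for s by (simp add: w_def per1 per2)
  have Aper: "A (s + 2 * pi) = A s" for s
  proof -
    have "cmod (exp (Complex (A (s + 2 * pi)) (\<Phi> (s + 2 * pi)))) = cmod (exp (Complex (A s) (\<Phi> s)))"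
      using A(4)[of s] A(4)[of "s + 2 * pi"] by (simp add: per1)
    then show ?thesis by simp
  qed
  obtain \<Delta> where \<Delta>: "\<And>s. \<Phi> (s + 2 * pi) = \<Phi> s + \<Delta>"
  proof -
    have "((\<lambda>s. \<Phi> (s + 2 * pi) - \<Phi> s) has_vector_derivative 0) (at s within UNIV)" for s
    proof -
      have "((\<lambda>s. \<Phi> (s + 2 * pi)) has_real_derivative w (s + 2 * pi) * 1) (at s)"
        by (rule DERIV_chain2[where f=\<Phi> and g="\<lambda>s. s + 2 * pi", OF dw]) (auto intro!: derivative_eq_intros)
      from DERIV_diff[OF this dw[of s]] show ?thesis
        by (simp add: perw has_real_derivative_iff_has_vector_derivative)
    qed
    then obtain c where "\<And>s. \<Phi> (s + 2 * pi) - \<Phi> s = c"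
      using has_vector_derivative_zero_constant[of UNIV "\<lambda>s. \<Phi> (s + 2 * pi) - \<Phi> s"] by auto
    then show thesis using that[of c] by (metis add.commute diff_add_cancel)
  qed
  have "exp (Complex (A 0) (\<Phi> (0 + 2 * pi))) = exp (Complex (A 0) (\<Phi> 0))"
    using A(4)[of 0] A(4)[of "0 + 2 * pi"] Aper[of 0] per1[of 0] by simp
  then obtain n :: int where "\<Phi> (0 + 2 * pi) = \<Phi> 0 + of_int n * (2 * pi)"
    by (rule exp_Complex_eqE)
  then have n: "\<Delta> = of_int n * (2 * pi)" using \<Delta>[of 0] by simp
  define F where "F s = Complex (f s $ 1) (f s $ 2)" for s
  have inj': "f s \<noteq> f t" if st: "s < t" "t < s + 2 * pi" for s t
  proof
    assume eq: "f s = f t"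
    obtain i where i: "s + of_int i * (2 * pi) \<in> {0..<0 + 2 * pi}" using ex_shift_into_period[of "2 * pi" s 0] by auto
    obtain j where j: "t + of_int j * (2 * pi) \<in> {0..<0 + 2 * pi}" using ex_shift_into_period[of "2 * pi" t 0] by auto
    have "f (s + of_int i * (2 * pi)) = f (t + of_int j * (2 * pi))"
      using eq periodic_of_int[of f "2 * pi"] per by simp
    then have "s + of_int i * (2 * pi) = t + of_int j * (2 * pi)" using inj i j by (auto dest: inj_onD)
    then have e: "t - s = of_int (i - j) * (2 * pi)" by (simp add: algebra_simps)
    then have "0 < of_int (i - j) * (2 * pi)" "of_int (i - j) * (2 * pi) < 1 * (2 * pi)" using st by linarith+
    then have "0 < real_of_int (i - j)" "real_of_int (i - j) < 1" using pi_gt_zero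
      by (simp add: zero_less_mult_iff, metis mult_less_cancel_right_pos mult_pos_pos pi_gt_zero zero_less_numeral)
    then show False unfolding of_int_0_less_iff of_int_less_1_iff by linarith
  qed
  obtain s0 where s0: "\<bar>\<Phi> (s0 + 2 * pi) - \<Phi> s0\<bar> \<le> 2 * pi"
  proof (rule turning_tangent[of "2 * pi" F "\<lambda>s. Complex (f1 s $ 1) (f1 s $ 2)" A \<Phi>])
    show "(F has_vector_derivative Complex (f1 s $ 1) (f1 s $ 2)) (at s)" for s
      unfolding F_def[abs_def] has_vector_derivative_complex_iff
      using bounded_linear.has_vector_derivative[OF bounded_linear_vec_nth d1]
      by (simp add: has_real_derivative_iff_has_vector_derivative)
    show "continuous_on UNIV (\<lambda>s. Complex (f1 s $ 1) (f1 s $ 2))"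
      using smooth_on_imp_continuous[OF sm1]
      by (intro continuous_on_Complex continuous_on_component)
    show "F (s + 2 * pi) = F s" "Complex (f1 (s + 2 * pi) $ 1) (f1 (s + 2 * pi) $ 2) = Complex (f1 s $ 1) (f1 s $ 2)" for s
      by (simp_all add: F_def per per1)
    show "F s \<noteq> F t" if "s < t" "t < s + 2 * pi" for s t
      using inj'[OF that] by (simp add: F_def vec_eq_iff forall_2)
    show "Complex (f1 s $ 1) (f1 s $ 2) = exp (Complex (A s) (\<Phi> s))" for s by (rule A(4))
    show "continuous_on UNIV \<Phi>" by (rule smooth_on_imp_continuous[OF A(2)])
  qed auto
  have pos: "0 < \<epsilon> * \<Delta>"
  proof -
    have "\<epsilon> * \<Phi> 0 < \<epsilon> * \<Phi> (0 + 2 * pi)"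
    proof (rule DERIV_pos_imp_increasing[of 0 "0 + 2 * pi" "\<lambda>x. \<epsilon> * \<Phi> x"])
      fix x show "\<exists>y. ((\<lambda>x. \<epsilon> * \<Phi> x) has_real_derivative y) (at x) \<and> 0 < y"
        using DERIV_cmult[OF dw[of x], of \<epsilon>] \<epsilon>(2) by blast
    qed simp
    then show ?thesis using \<Delta>[of 0] by (simp add: algebra_simps)
  qed
  have "\<epsilon> * \<Delta> = 2 * pi"
  proof -
    have "\<bar>real_of_int n\<bar> * (2 * pi) \<le> 1 * (2 * pi)" using s0 \<Delta>[of s0] by (simp add: n abs_mult)
    then have "\<bar>real_of_int n\<bar> \<le> 1" using pi_gt_zero by (metis mult_le_cancel_right_pos mult_pos_pos zero_less_numeral)
    moreover have "n \<noteq> 0" using pos n by auto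
    ultimately have "n = 1 \<or> n = -1" by linarith
    then show ?thesis using pos \<epsilon>(1) n by (auto simp: zero_less_mult_iff)
  qed
  note e\<Delta> = this
  have "angle_rep f (\<lambda>s. norm (f1 s)) (\<lambda>s. \<epsilon> * \<Phi> s) \<epsilon>"
    unfolding angle_rep_def
  proof (intro conjI allI)
    have nf: "norm (f1 s) = sqrt ((f1 s $ 1)\<^sup>2 + (f1 s $ 2)\<^sup>2)" for s
      by (simp add: norm_vec_def L2_set_def sum_2)
    have p2: "0 < (f1 s $ 1)\<^sup>2 + (f1 s $ 2)\<^sup>2" for s
      using nz[of s] by (simp add: less_le)
    show "smooth_on UNIV (\<lambda>s. norm (f1 s))" unfolding nf
      by (intro smooth_on_sqrt_comp smooth_on_add smooth_on_power smooth_on_nth sm1 open_UNIV p2)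
    show "smooth_on UNIV (\<lambda>s. \<epsilon> * \<Phi> s)" by (intro smooth_on_mult smooth_on_const A open_UNIV)
    show "0 < norm (f1 s)" for s using reg by (simp add: f1_def)
    show "0 < vector_derivative (\<lambda>s. \<epsilon> * \<Phi> s) (at s)" for s
      using DERIV_cmult[OF dw[of s], of \<epsilon>] \<epsilon>(2)[of s]
      by (simp add: has_real_derivative_iff_has_vector_derivative vector_derivative_at)
    show "norm (f1 (s + 2 * pi)) = norm (f1 s)" for s by (simp add: per1)
    show "\<epsilon> * \<Phi> (s + 2 * pi) = \<epsilon> * \<Phi> s + 2 * pi" for s
      unfolding \<Delta> distrib_left e\<Delta> ..
    show "\<epsilon> \<in> {1, -1}" by fact
    show "(f has_vector_derivative norm (f1 s) *\<^sub>R dir \<epsilon> (\<epsilon> * \<Phi> s)) (at s)" for s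
    proof -
      have "cmod (Complex (f1 s $ 1) (f1 s $ 2)) = exp (A s)" by (simp add: A(4))
      then have "norm (f1 s) = exp (A s)" by (simp add: nf cmod_def)
      moreover have "f1 s $ 1 = exp (A s) * cos (\<Phi> s)" "f1 s $ 2 = exp (A s) * sin (\<Phi> s)"
        using arg_cong[OF A(4)[of s], of Re] arg_cong[OF A(4)[of s], of Im] by (simp_all add: Re_exp Im_exp)
      ultimately have "f1 s = norm (f1 s) *\<^sub>R dir \<epsilon> (\<epsilon> * \<Phi> s)"
        using \<epsilon>(1) by (auto simp: vec_eq_iff forall_2)
      then show ?thesis using d1[of s] by simp
    qed
    show "f (s + 2 * pi) = f s" for s by (rule per)
  qed
  then show thesis by (rule that)
qed

section \<open>Geometry of a convex curve in terms of its tangent angle\<close>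

locale angle_curve =
  fixes f :: "real \<Rightarrow> real^2" and m \<Theta> :: "real \<Rightarrow> real" and \<epsilon> :: real
  assumes rep: "angle_rep f m \<Theta> \<epsilon>"
begin

lemma sm_m: "smooth_on UNIV m" and sm_Theta: "smooth_on UNIV \<Theta>" and m_pos: "m s > 0"
  and Theta'_pos: "vector_derivative \<Theta> (at s) > 0" and m_per: "m (s + 2 * pi) = m s"
  and Theta_per: "\<Theta> (s + 2 * pi) = \<Theta> s + 2 * pi" and eps: "\<epsilon> \<in> {1, -1}"
  and f_deriv: "(f has_vector_derivative m s *\<^sub>R dir \<epsilon> (\<Theta> s)) (at s)"
  and f_per: "f (s + 2 * pi) = f s"
  using rep by (simp_all add: angle_rep_def)

lemma eps2: "\<epsilon> * \<epsilon> = 1"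
  using eps by auto

lemma Theta_deriv: "(\<Theta> has_real_derivative vector_derivative \<Theta> (at s)) (at s)"
  using smooth_on_has_vector_derivative[OF open_UNIV sm_Theta]
  by (simp add: has_real_derivative_iff_has_vector_derivative)

lemma Theta_less: "s < t \<Longrightarrow> \<Theta> s < \<Theta> t"
  using Theta_deriv Theta'_pos by (intro DERIV_pos_imp_increasing[of s t \<Theta>]) blast+

lemma Theta_less_iff [simp]: "\<Theta> s < \<Theta> t \<longleftrightarrow> s < t"
  and Theta_le_iff [simp]: "\<Theta> s \<le> \<Theta> t \<longleftrightarrow> s \<le> t"
  and Theta_eq_iff [simp]: "\<Theta> s = \<Theta> t \<longleftrightarrow> s = t"
  using Theta_less by (metis less_asym linorder_neqE_linordered_idom less_irrefl,
      metis linorder_not_less order_less_le, metis less_irrefl linorder_neqE_linordered_idom)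

lemma Theta_per_int: "\<Theta> (s + of_int n * (2 * pi)) = \<Theta> s + of_int n * (2 * pi)"
proof -
  have "(\<lambda>s. \<Theta> s - s) (s + of_int n * (2 * pi)) = \<Theta> s - s"
    by (rule periodic_of_int) (simp add: Theta_per)
  then show ?thesis by simp
qed

lemma Theta_surj: "range \<Theta> = UNIV"
proof -
  have "\<exists>s. \<Theta> s = y" for y
  proof -
    obtain n :: int where n: "y + of_int n * (2 * pi) \<in> {\<Theta> 0..<\<Theta> 0 + 2 * pi}"
      using ex_shift_into_period[of "2 * pi" y "\<Theta> 0"] by auto
    have "\<exists>s\<ge>0. s \<le> 2 * pi \<and> \<Theta> s = y + of_int n * (2 * pi)"
    proof (rule IVT')
      show "y + of_int n * (2 * pi) \<le> \<Theta> (2 * pi)" using n Theta_per[of 0] by simp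
      show "continuous_on {0..2 * pi} \<Theta>"
        using smooth_on_imp_continuous[OF sm_Theta] continuous_on_subset by blast
    qed (use n in auto)
    then obtain s where "\<Theta> s = y + of_int n * (2 * pi)" by blast
    then have "\<Theta> (s + of_int (- n) * (2 * pi)) = y" using Theta_per_int[of s "- n"] by simp
    then show ?thesis by blast
  qed
  then show ?thesis by (metis surjI)
qed

definition T :: "real \<Rightarrow> real" where "T = inv \<Theta>"

lemma Theta_T [simp]: "\<Theta> (T \<theta>) = \<theta>"
  unfolding T_def using Theta_surj by (simp add: surj_f_inv_f)

lemma T_Theta [simp]: "T (\<Theta> s) = s"
  using Theta_T[of "\<Theta> s"] by (simp del: Theta_T)

lemma T_per: "T (\<theta> + 2 * pi) = T \<theta> + 2 * pi"
  by (metis T_Theta Theta_T Theta_per)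

lemma T_less_iff [simp]: "T x < T y \<longleftrightarrow> x < y"
  by (metis Theta_T Theta_less_iff)

lemma sm_T: "smooth_on UNIV T"
proof -
  have "diffeo_on UNIV UNIV \<Theta>"
    using diffeo_on_real(1)[OF open_UNIV connected_UNIV sm_Theta Theta'_pos] by (simp add: Theta_surj)
  then obtain \<psi> where "homeomorphism UNIV UNIV \<Theta> \<psi>" "smooth_on UNIV \<psi>"
    unfolding diffeo_on_def by blast
  moreover have "\<psi> = T"
    using calculation(1) by (metis T_Theta UNIV_I homeomorphism_apply2 ext)
  ultimately show ?thesis by simp
qed

lemma T_deriv: "(T has_real_derivative 1 / vector_derivative \<Theta> (at (T \<theta>))) (at \<theta>)"
proof -
  have "isCont T \<theta>"
    using smooth_on_imp_continuous[OF sm_T] by (simp add: continuous_on_eq_continuous_at)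
  then have "DERIV T \<theta> :> inverse (vector_derivative \<Theta> (at (T \<theta>)))"
    using Theta'_pos[of "T \<theta>"]
    by (intro DERIV_inverse_function[where f=\<Theta> and a="\<theta> - 1" and b="\<theta> + 1", OF Theta_deriv]) auto
  then show ?thesis by (simp add: inverse_eq_divide)
qed

lemma sm_f: "smooth_on UNIV f"
  by (rule smooth_on_derivI[OF open_UNIV f_deriv])
    (intro smooth_on_scaleR smooth_on_dir sm_m sm_Theta open_UNIV)

lemma f_deriv1: "nth_deriv 1 f s = m s *\<^sub>R dir \<epsilon> (\<Theta> s)"
  unfolding nth_deriv_1 by (rule vector_derivative_at[OF f_deriv])

text \<open>The component normal to the tangent at \<open>s\<close> grows strictly as long as the
  tangent has turned by less than \<open>pi\<close>.\<close>

lemma f_arc_ne: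
  assumes "s < t" "\<Theta> t - \<Theta> s \<le> pi"
  shows "f s \<noteq> f t"
proof -
  define k where "k r = \<epsilon> * cross2 (dir \<epsilon> (\<Theta> s)) (f r)" for r
  have dk: "(k has_real_derivative m r * sin (\<Theta> r - \<Theta> s)) (at r)" for r
  proof -
    have "bounded_linear (\<lambda>z. \<epsilon> * cross2 (dir \<epsilon> (\<Theta> s)) z)"
      by (intro bounded_linear_const_mult bounded_bilinear.bounded_linear_right[OF bounded_bilinear_cross2])
    from bounded_linear.has_vector_derivative[OF this f_deriv[of r]]
    have "(k has_vector_derivative \<epsilon> * cross2 (dir \<epsilon> (\<Theta> s)) (m r *\<^sub>R dir \<epsilon> (\<Theta> r))) (at r)"
      by (simp add: k_def[abs_def])
    also have "\<epsilon> * cross2 (dir \<epsilon> (\<Theta> s)) (m r *\<^sub>R dir \<epsilon> (\<Theta> r)) = m r * sin (\<Theta> r - \<Theta> s)"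
      using eps2 by (simp add: cross2_simps)
    finally show ?thesis by (simp add: has_real_derivative_iff_has_vector_derivative)
  qed
  have "k s < k t"
  proof (rule DERIV_pos_imp_increasing_open[OF assms(1)])
    fix r assume "s < r" "r < t"
    then have "\<Theta> s < \<Theta> r" "\<Theta> r < \<Theta> t" by (simp_all only: Theta_less_iff)
    then have "0 < sin (\<Theta> r - \<Theta> s)" using assms(2) by (intro sin_gt_zero) linarith+
    then show "\<exists>y. (k has_real_derivative y) (at r) \<and> 0 < y" using dk m_pos by (metis mult_pos_pos)
  next
    show "continuous_on {s..t} k"
      using dk by (auto intro!: continuous_at_imp_continuous_on DERIV_isCont)
  qed
  then show ?thesis by (auto simp: k_def)
qed

text \<open>Of the two arcs between the points, one turns by at most \<open>pi\<close>; injectivity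
  is thus a consequence of the angle data.\<close>

lemma f_ne:
  assumes "s < t" "t < s + 2 * pi"
  shows "f s \<noteq> f t"
proof (cases "\<Theta> t - \<Theta> s \<le> pi")
  case True
  then show ?thesis using f_arc_ne assms by blast
next
  case False
  then have "f t \<noteq> f (s + 2 * pi)" using assms by (intro f_arc_ne) (simp_all add: Theta_per)
  then show ?thesis by (simp add: f_per)
qed

lemma f_per_int: "f (s + of_int n * (2 * pi)) = f s"
  by (rule periodic_of_int) (rule f_per)

lemma f_eqD:
  assumes "f s = f t"
  obtains n :: int where "t = s + of_int n * (2 * pi)"
proof -
  obtain n :: int where n: "t + of_int n * (2 * pi) \<in> {s..<s + 2 * pi}"
    using ex_shift_into_period[of "2 * pi" t s] by auto
  have "f s = f (t + of_int n * (2 * pi))" using assms f_per_int by simp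
  then have "s = t + of_int n * (2 * pi)" using n f_ne[of s "t + of_int n * (2 * pi)"] by force
  then have "t = s + of_int (- n) * (2 * pi)" by simp
  then show thesis by (rule that)
qed

text \<open>Parameter of the parallel partner, half a turn of the tangent later.\<close>

definition p :: "real \<Rightarrow> real" where "p s = T (\<Theta> s + pi)"

lemma Theta_p [simp]: "\<Theta> (p s) = \<Theta> s + pi"
  by (simp add: p_def)

lemma p_gt: "s < p s" and p_less: "p s < s + 2 * pi"
proof -
  have "\<Theta> s < \<Theta> (p s)" "\<Theta> (p s) < \<Theta> (s + 2 * pi)" unfolding Theta_p Theta_per by simp_all
  then show "s < p s" "p s < s + 2 * pi" by (simp_all only: Theta_less_iff)
qed

lemma tangent_direction_eq_iff:
  "tangent_direction f s = tangent_direction f t \<longleftrightarrow> sin (\<Theta> t - \<Theta> s) = 0"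
proof -
  have td: "tangent_direction f s = span {dir \<epsilon> (\<Theta> s)}" for s
    unfolding tangent_direction_def f_deriv1 using m_pos[of s]
    by (intro span_eq[THEN iffD2] conjI)
      (auto intro: span_mul span_base simp: span_singleton image_iff intro!: exI[of _ "1 / m s"])
  show ?thesis
  proof
    assume "tangent_direction f s = tangent_direction f t"
    then have "dir \<epsilon> (\<Theta> t) \<in> span {dir \<epsilon> (\<Theta> s)}" unfolding td by (metis insertI1 span_base)
    then obtain k where "dir \<epsilon> (\<Theta> t) = k *\<^sub>R dir \<epsilon> (\<Theta> s)" by (auto simp: span_singleton)
    then have "cross2 (dir \<epsilon> (\<Theta> s)) (dir \<epsilon> (\<Theta> t)) = 0"
      by (simp add: cross2_def)
    then show "sin (\<Theta> t - \<Theta> s) = 0" using eps by (auto simp: dir_cross)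
  next
    assume a: "sin (\<Theta> t - \<Theta> s) = 0"
    then have eq: "dir \<epsilon> (\<Theta> t) = cos (\<Theta> t - \<Theta> s) *\<^sub>R dir \<epsilon> (\<Theta> s)"
      using dir_eq_dir[of \<epsilon> "\<Theta> t" "\<Theta> s"] by simp
    have "cos (\<Theta> t - \<Theta> s) \<noteq> 0" using a sin_cos_squared_add[of "\<Theta> t - \<Theta> s"] by auto
    then show "tangent_direction f s = tangent_direction f t"
      unfolding td eq
      by (intro span_eq[THEN iffD2] conjI)
        (auto intro: span_mul span_base simp: span_singleton image_iff intro!: exI[of _ "1 / cos (\<Theta> t - \<Theta> s)"])
  qed
qed

text \<open>Parallel tangents mean that the angles differ by a multiple of \<open>pi\<close>. Even
  multiples lead back to the point itself, odd ones to the point half a turn later.\<close>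

lemma partner_f: "partner f (f s) = f (p s)"
  unfolding partner_def
proof (rule the_equality)
  have "f s \<noteq> f (p s)" by (rule f_ne[OF p_gt p_less])
  moreover have "tangent_direction f s = tangent_direction f (p s)"
    by (simp add: tangent_direction_eq_iff)
  ultimately show "parallel_pair f (f s) (f (p s))" unfolding parallel_pair_def by blast
next
  fix b assume "parallel_pair f (f s) b"
  then obtain s' t where st: "f s \<noteq> f t" "f s' = f s" "b = f t" "tangent_direction f s' = tangent_direction f t"
    unfolding parallel_pair_def by blast
  obtain n :: int where n: "s' = s + of_int n * (2 * pi)" using f_eqD[of s s'] st(2) by metis
  have "sin (\<Theta> t - \<Theta> s') = 0" using st(4) tangent_direction_eq_iff by blast
  then obtain i :: int where i: "\<Theta> t - \<Theta> s' = of_int i * pi" by (auto simp: sin_zero_iff_int2)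
  have Tt: "\<Theta> t = \<Theta> s + of_int (i + 2 * n) * pi"
    using i unfolding n Theta_per_int by (simp add: algebra_simps)
  show "b = f (p s)"
  proof (cases "even (i + 2 * n)")
    case True
    then obtain j where "i + 2 * n = 2 * j" by (rule evenE)
    then have "\<Theta> t = \<Theta> (s + of_int j * (2 * pi))" unfolding Tt Theta_per_int by (simp add: algebra_simps)
    then have "f t = f s" using f_per_int by (simp only: Theta_eq_iff)
    then show ?thesis using st(1) by simp
  next
    case False
    then obtain j where "i + 2 * n = 2 * j + 1" by (rule oddE)
    then have "\<Theta> t = \<Theta> (p s + of_int j * (2 * pi))" unfolding Tt Theta_per_int Theta_p by (simp add: algebra_simps)
    then have "f t = f (p s)" using f_per_int by (simp only: Theta_eq_iff)
    then show ?thesis using st(3) by simp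
  qed
qed

section \<open>Radius of curvature and singularities of the equidistants\<close>

definition \<rho> :: "real \<Rightarrow> real" where "\<rho> \<theta> = m (T \<theta>) / vector_derivative \<Theta> (at (T \<theta>))"

lemma rho_pos: "\<rho> \<theta> > 0"
  unfolding \<rho>_def using m_pos Theta'_pos by simp

lemma Theta'_per: "vector_derivative \<Theta> (at (s + 2 * pi)) = vector_derivative \<Theta> (at s)"
proof -
  have "((\<lambda>s. \<Theta> s - s) has_vector_derivative vector_derivative \<Theta> (at s) - 1) (at s)" for s
    using DERIV_diff[OF Theta_deriv DERIV_ident] by (simp add: has_real_derivative_iff_has_vector_derivative)
  from vector_derivative_periodic[OF this, where L="2 * pi"] show ?thesis by (simp add: Theta_per)
qed

lemma rho_per: "\<rho> (\<theta> + 2 * pi) = \<rho> \<theta>"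
  by (simp add: \<rho>_def T_per m_per Theta'_per)

lemma sm_rho: "smooth_on UNIV \<rho>"
  unfolding \<rho>_def[abs_def] using Theta'_pos
  by (intro smooth_on_divide smooth_on_compose_UNIV[OF _ _ sm_T] sm_m smooth_on_vector_derivative sm_Theta open_UNIV)
    (simp add: less_imp_neq[symmetric] less_imp_neq[OF Theta'_pos, symmetric])

definition F :: "real \<Rightarrow> real^2" where "F \<theta> = f (T \<theta>)"

lemma F_deriv: "(F has_vector_derivative \<rho> \<theta> *\<^sub>R dir \<epsilon> \<theta>) (at \<theta>)"
  using vector_diff_chain_at[OF T_deriv[of \<theta>, unfolded has_real_derivative_iff_has_vector_derivative] f_deriv]
  by (simp add: o_def F_def[abs_def] \<rho>_def)

lemma F_Theta: "F (\<Theta> s) = f s" and F_Theta_pi: "F (\<Theta> s + pi) = f (p s)"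
  by (simp_all add: F_def p_def)

lemma equidistant_eq: "equidistant l f s = l *\<^sub>R F (\<Theta> s) + (1 - l) *\<^sub>R F (\<Theta> s + pi)"
  by (simp add: equidistant_def partner_f F_Theta F_Theta_pi)

lemma sm_F: "smooth_on UNIV F"
  unfolding F_def[abs_def] by (rule smooth_on_compose_UNIV[OF open_UNIV sm_f sm_T])

lemma sm_equidistant: "smooth_closed_curve (equidistant l f)"
proof -
  have "smooth_on UNIV (\<lambda>s. l *\<^sub>R F (\<Theta> s) + (1 - l) *\<^sub>R F (\<Theta> s + pi))"
    by (intro smooth_on_add smooth_on_scaleR smooth_on_const smooth_on_compose_UNIV[OF _ sm_F] sm_Theta open_UNIV)
  then have "smooth_on UNIV (equidistant l f)"
    using equidistant_eq by (simp add: fun_eq_iff cong: smooth_on_cong)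
  moreover have "F (\<theta> + 2 * pi) = F \<theta>" for \<theta> by (simp add: F_def T_per f_per)
  then have "F (\<Theta> s + 2 * pi + pi) = F (\<Theta> s + pi)" "F (\<Theta> s + 2 * pi) = F (\<Theta> s)" for s
    by (metis add.assoc add.commute, metis)
  then have "equidistant l f (s + 2 * pi) = equidistant l f s" for s
    unfolding equidistant_eq Theta_per by simp
  ultimately show ?thesis by (simp add: smooth_closed_curve_def)
qed

definition q :: "real \<Rightarrow> real" where "q \<theta> = \<rho> (\<theta> + pi) / (\<rho> \<theta> + \<rho> (\<theta> + pi))"

lemma sm_q: "smooth_on UNIV q"
  unfolding q_def[abs_def]
  by (intro smooth_on_divide smooth_on_add smooth_on_compose_UNIV[OF _ sm_rho] smooth_on_id smooth_on_const sm_rho open_UNIV)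
    (metis add_pos_pos less_irrefl rho_pos)

lemma q_pi: "q (\<theta> + pi) = 1 - q \<theta>"
proof -
  have "\<rho> (\<theta> + pi + pi) = \<rho> \<theta>" using rho_per[of \<theta>] by (simp add: algebra_simps)
  moreover have "\<rho> \<theta> + \<rho> (\<theta> + pi) \<noteq> 0" by (metis add_pos_pos less_irrefl rho_pos)
  ultimately show ?thesis by (simp add: q_def field_simps)
qed

lemma q_2pi: "q (\<theta> + 2 * pi) = q \<theta>"
  using q_pi[of \<theta>] q_pi[of "\<theta> + pi"] by (simp add: algebra_simps)

lemma q_deriv: "(q has_real_derivative vector_derivative q (at \<theta>)) (at \<theta>)"
  using smooth_on_has_vector_derivative[OF open_UNIV sm_q]
  by (simp add: has_real_derivative_iff_has_vector_derivative)

text \<open>The signed speed of the equidistant along \<open>dir \<epsilon> (\<Theta> s)\<close>,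
  factored into a positive function and \<open>l - q\<close>, which alone carries the zeros.\<close>

definition h :: "real \<Rightarrow> real \<Rightarrow> real" where
  "h l s = (\<rho> (\<Theta> s) + \<rho> (\<Theta> s + pi)) * vector_derivative \<Theta> (at s) * (l - q (\<Theta> s))"

lemma equidistant_deriv: "(equidistant l f has_vector_derivative h l s *\<^sub>R dir \<epsilon> (\<Theta> s)) (at s)"
proof -
  let ?d = "vector_derivative \<Theta> (at s)" and ?\<theta> = "\<Theta> s"
  have T: "(\<Theta> has_vector_derivative ?d) (at s)" "((\<lambda>s. \<Theta> s + pi) has_vector_derivative ?d) (at s)"
    using Theta_deriv[of s] by (auto simp: has_real_derivative_iff_has_vector_derivative[symmetric] intro!: derivative_eq_intros)
  have "((\<lambda>s. F (\<Theta> s)) has_vector_derivative ?d *\<^sub>R (\<rho> ?\<theta> *\<^sub>R dir \<epsilon> ?\<theta>)) (at s)"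
    "((\<lambda>s. F (\<Theta> s + pi)) has_vector_derivative ?d *\<^sub>R (\<rho> (?\<theta> + pi) *\<^sub>R dir \<epsilon> (?\<theta> + pi))) (at s)"
    using vector_diff_chain_at[OF T(1) F_deriv] vector_diff_chain_at[OF T(2) F_deriv] by (simp_all add: o_def)
  note c = this
  have "((\<lambda>s. l *\<^sub>R F (\<Theta> s) + (1 - l) *\<^sub>R F (\<Theta> s + pi)) has_vector_derivative
      l *\<^sub>R (?d *\<^sub>R (\<rho> ?\<theta> *\<^sub>R dir \<epsilon> ?\<theta>)) + (1 - l) *\<^sub>R (?d *\<^sub>R (\<rho> (?\<theta> + pi) *\<^sub>R dir \<epsilon> (?\<theta> + pi)))) (at s)"
    by (intro has_vector_derivative_add bounded_linear.has_vector_derivative[OF bounded_linear_scaleR_right] c)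
  moreover have "l *\<^sub>R (?d *\<^sub>R (\<rho> ?\<theta> *\<^sub>R dir \<epsilon> ?\<theta>)) + (1 - l) *\<^sub>R (?d *\<^sub>R (\<rho> (?\<theta> + pi) *\<^sub>R dir \<epsilon> (?\<theta> + pi)))
      = (?d * (l * \<rho> ?\<theta> - (1 - l) * \<rho> (?\<theta> + pi))) *\<^sub>R dir \<epsilon> ?\<theta>"
    unfolding dir_add_pi by (simp add: algebra_simps)
  moreover have "?d * (l * \<rho> ?\<theta> - (1 - l) * \<rho> (?\<theta> + pi)) = h l s"
  proof -
    have "\<rho> ?\<theta> + \<rho> (?\<theta> + pi) \<noteq> 0" by (metis add_pos_pos less_irrefl rho_pos)
    then have "(\<rho> ?\<theta> + \<rho> (?\<theta> + pi)) * (l - q ?\<theta>) = l * \<rho> ?\<theta> - (1 - l) * \<rho> (?\<theta> + pi)"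
      by (simp add: q_def field_simps)
    then show ?thesis unfolding h_def by (simp add: mult_ac)
  qed
  moreover have "equidistant l f = (\<lambda>s. l *\<^sub>R F (\<Theta> s) + (1 - l) *\<^sub>R F (\<Theta> s + pi))"
    by (simp add: fun_eq_iff equidistant_eq)
  ultimately show ?thesis by simp
qed

lemma singular_iff: "nth_deriv 1 (equidistant l f) s = 0 \<longleftrightarrow> q (\<Theta> s) = l"
proof -
  have "nth_deriv 1 (equidistant l f) s = h l s *\<^sub>R dir \<epsilon> (\<Theta> s)"
    unfolding nth_deriv_1 by (rule vector_derivative_at[OF equidistant_deriv])
  moreover have "\<rho> (\<Theta> s) + \<rho> (\<Theta> s + pi) > 0" by (simp add: add_pos_pos rho_pos)
  ultimately show ?thesis
    using dir_ne_0[OF eps, of "\<Theta> s"] Theta'_pos[of s] by (auto simp: h_def)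
qed

text \<open>At a simple zero of \<open>h l\<close> the second derivative is tangential with
  coefficient \<open>h1 s\<close>, while the third has normal component
  \<open>2 * h1 s * W s\<close>. Their determinant contains the square of \<open>h1 s\<close> and is
  nonzero.\<close>

lemma cusp_if_regular:
  assumes "q (\<Theta> s) = l" "vector_derivative q (at (\<Theta> s)) \<noteq> 0"
  shows "cusp_at (equidistant l f) s"
proof -
  let ?E = "equidistant l f"
  let ?r = "\<lambda>s. (\<rho> (\<Theta> s) + \<rho> (\<Theta> s + pi)) * vector_derivative \<Theta> (at s)"
  let ?d = "vector_derivative \<Theta> (at s)"
  have smE: "smooth_on UNIV ?E" using sm_equidistant by (simp add: smooth_closed_curve_def)
  have sr: "smooth_on UNIV ?r"
    by (intro smooth_on_add smooth_on_mult smooth_on_compose_UNIV[OF _ sm_rho] smooth_on_vector_derivative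
        sm_Theta smooth_on_const open_UNIV)
  have sh: "smooth_on UNIV (h l)"
    unfolding h_def[abs_def]
    by (intro smooth_on_diff smooth_on_mult sr[simplified] smooth_on_const smooth_on_compose_UNIV[OF _ sm_q] sm_Theta open_UNIV
        smooth_on_add smooth_on_compose_UNIV[OF _ sm_rho] smooth_on_vector_derivative)
  define h1 where "h1 = nth_deriv 1 (h l)"
  define h2 where "h2 = nth_deriv 2 (h l)"
  have dh: "(h l has_real_derivative h1 t) (at t)" "(h1 has_real_derivative h2 t) (at t)" for t
    using nth_deriv_has_derivative[OF open_UNIV sh, of t 0] nth_deriv_has_derivative[OF open_UNIV sh, of t 1]
    by (simp_all add: h1_def h2_def numeral_2_eq_2 has_real_derivative_iff_has_vector_derivative)
  have h0: "h l s = 0" using assms(1) by (simp add: h_def)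
  have h1s: "h1 s \<noteq> 0"
  proof -
    obtain r' where "(?r has_real_derivative r') (at s)"
      using smooth_on_has_vector_derivative[OF open_UNIV sr] by (auto simp: has_real_derivative_iff_has_vector_derivative)
    moreover have "((\<lambda>s. l - q (\<Theta> s)) has_real_derivative 0 - vector_derivative q (at (\<Theta> s)) * ?d) (at s)"
      by (intro DERIV_diff DERIV_const DERIV_chain2[OF q_deriv Theta_deriv])
    ultimately have "(h l has_real_derivative r' * (l - q (\<Theta> s)) + (0 - vector_derivative q (at (\<Theta> s)) * ?d) * ?r s) (at s)"
      unfolding h_def[abs_def] by (rule DERIV_mult)
    then have "h1 s = r' * (l - q (\<Theta> s)) + (0 - vector_derivative q (at (\<Theta> s)) * ?d) * ?r s"
      using dh(1) DERIV_unique by blast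
    moreover have "\<rho> (\<Theta> s) + \<rho> (\<Theta> s + pi) \<noteq> 0" by (metis add_pos_pos less_irrefl rho_pos)
    ultimately show ?thesis using assms Theta'_pos[of s] by simp
  qed
  define W where "W = (\<lambda>t. vector_derivative \<Theta> (at t))"
  have sW: "smooth_on UNIV W" unfolding W_def by (rule smooth_on_vector_derivative[OF open_UNIV sm_Theta])
  define W' where "W' t = vector_derivative W (at t)" for t
  have W': "(W has_real_derivative W' t) (at t)" for t
    using smooth_on_has_vector_derivative[OF open_UNIV sW] by (simp add: W'_def has_real_derivative_iff_has_vector_derivative)
  have E1: "nth_deriv 1 ?E = (\<lambda>t. h l t *\<^sub>R dir \<epsilon> (\<Theta> t))"
    unfolding nth_deriv_1 using vector_derivative_at[OF equidistant_deriv] by blast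
  have dT: "(\<Theta> has_real_derivative W t) (at t)" for t using Theta_deriv by (simp add: W_def)
  have E2: "nth_deriv 2 ?E s = h1 s *\<^sub>R dir \<epsilon> (\<Theta> s)"
    and E3: "nth_deriv 3 ?E s = (2 * h1 s * W s) *\<^sub>R dir \<epsilon> (\<Theta> s + pi / 2) + h2 s *\<^sub>R dir \<epsilon> (\<Theta> s)"
    using nth_deriv_dir[OF E1 dh dT W', of s] by (simp_all add: h0)
  have "cross2 (nth_deriv 2 ?E s) (nth_deriv 3 ?E s) = 2 * (h1 s)\<^sup>2 * W s * \<epsilon>"
    unfolding E2 E3 by (simp add: cross2_simps power2_eq_square)
  also have "\<dots> \<noteq> 0" using h1s Theta'_pos[of s] eps by (auto simp: W_def)
  finally have "cross2 (nth_deriv 2 ?E s) (nth_deriv 3 ?E s) \<noteq> 0" .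
  moreover have "nth_deriv 1 ?E s = 0" using assms(1) singular_iff by blast
  ultimately show ?thesis using cusp_atI[OF smE] by blast
qed

lemma cusp_iff:
  assumes "\<And>\<theta>. q \<theta> = l \<Longrightarrow> vector_derivative q (at \<theta>) \<noteq> 0"
  shows "cusp_at (equidistant l f) s \<longleftrightarrow> q (\<Theta> s) = l"
  using cusp_if_regular[of s l] assms cusp_at_imp_singular[of "equidistant l f" s] singular_iff by blast

lemma only_cusps:
  assumes "\<And>\<theta>. q \<theta> = l \<Longrightarrow> vector_derivative q (at \<theta>) \<noteq> 0"
  shows "only_cusp_singularities (equidistant l f)"
  unfolding only_cusp_singularities_def using sm_equidistant cusp_iff[OF assms] singular_iff by blast

end

section \<open>Parity of simple zeros\<close>

text \<open>The positive difference quotient, multiplied by \<open>(y - x)\<^sup>2\<close>, yields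
  one inequality that expresses both the isolation of the zero and the change of sign.\<close>

lemma simple_zero_isolated:
  fixes u :: "real \<Rightarrow> real"
  assumes "(u has_real_derivative d) (at x)" "u x = 0" "d \<noteq> 0"
  obtains e where "e > 0" "\<And>y. y \<noteq> x \<Longrightarrow> \<bar>y - x\<bar> < e \<Longrightarrow> u y * d * (y - x) > 0"
proof -
  have "((\<lambda>y. (u y - u x) / (y - x)) \<longlongrightarrow> d) (at x)"
    using assms(1) by (simp add: has_field_derivative_iff)
  then have "((\<lambda>y. (u y - u x) / (y - x) * d) \<longlongrightarrow> d * d) (at x)"
    by (rule tendsto_mult_right)
  moreover have "d * d > 0" using assms(3) by (metis not_real_square_gt_zero)
  ultimately have "\<forall>\<^sub>F y in at x. (u y - u x) / (y - x) * d > 0"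
    by (rule order_tendstoD)
  then obtain e where e: "e > 0" "\<And>y. y \<noteq> x \<Longrightarrow> dist y x < e \<Longrightarrow> (u y - u x) / (y - x) * d > 0"
    unfolding eventually_at by auto
  have "u y * d * (y - x) > 0" if y: "y \<noteq> x" "\<bar>y - x\<bar> < e" for y
  proof -
    have "0 < u y / (y - x) * d" using e(2)[of y] y assms(2) by (simp add: dist_real_def)
    then have "0 < u y / (y - x) * d * (y - x)\<^sup>2" by (rule mult_pos_pos) (use y in simp)
    also have "\<dots> = u y * d * (y - x)" using y by (simp add: power2_eq_square)
    finally show ?thesis .
  qed
  then show thesis using e(1) that by blast
qed

text \<open>Infinitely many zeros would accumulate in the compact interval at a point that is a zero
  by continuity, but simple zeros are isolated.\<close>

lemma simple_zeros_finite:
  fixes u :: "real \<Rightarrow> real"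
  assumes "\<And>x. x \<in> {a..b} \<Longrightarrow> (u has_real_derivative u' x) (at x)"
    and "\<And>x. x \<in> {a..b} \<Longrightarrow> u x = 0 \<Longrightarrow> u' x \<noteq> 0"
  shows "finite {x \<in> {a..b}. u x = 0}"
proof (rule ccontr)
  let ?Z = "{x \<in> {a..b}. u x = 0}"
  assume "infinite ?Z"
  then have "\<exists>x\<in>{a..b}. x islimpt ?Z"
    by (rule Heine_Borel_imp_Bolzano_Weierstrass[OF compact_Icc]) auto
  then obtain x where x: "x \<in> {a..b}" "x islimpt ?Z" by blast
  have "continuous_on {a..b} u"
    by (intro continuous_at_imp_continuous_on ballI DERIV_isCont[OF assms(1)])
  then have "closed ?Z" by (intro continuous_closed_preimage_constant) auto
  then have "u x = 0" using x(2) closed_limpt by blast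
  then obtain e where e: "e > 0" "\<And>y. y \<noteq> x \<Longrightarrow> \<bar>y - x\<bar> < e \<Longrightarrow> u y * u' x * (y - x) > 0"
    using simple_zero_isolated[OF assms(1)[OF x(1)]] assms(2)[OF x(1)] by metis
  obtain y where "y \<in> ?Z" "y \<noteq> x" "dist y x < e" using x(2) e(1) unfolding islimpt_approachable by blast
  then show False using e(2)[of y] by (auto simp: dist_real_def)
qed

lemma no_zero_same_sign:
  fixes u :: "real \<Rightarrow> real"
  assumes "a \<le> b" "continuous_on {a..b} u" "\<And>x. x \<in> {a..b} \<Longrightarrow> u x \<noteq> 0"
  shows "u a * u b > 0"
proof (rule ccontr)
  assume "\<not> ?thesis"
  then have "(u a \<le> 0 \<and> 0 \<le> u b) \<or> (u b \<le> 0 \<and> 0 \<le> u a)"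
    unfolding zero_less_mult_iff by linarith
  then show False
  proof
    assume "u a \<le> 0 \<and> 0 \<le> u b"
    then obtain x where "a \<le> x" "x \<le> b" "u x = 0" using IVT'[of u a 0 b] assms(1,2) by blast
    then show False using assms(3) by simp
  next
    assume "u b \<le> 0 \<and> 0 \<le> u a"
    then obtain x where "a \<le> x" "x \<le> b" "u x = 0" using IVT2'[of u b 0 a] assms(1,2) by blast
    then show False using assms(3) by simp
  qed
qed

text \<open>Induction on the number of zeros: cutting off just before the largest zero lowers the
  count by one and reverses the sign at the right end.\<close>

lemma simple_zeros_parity:
  fixes u :: "real \<Rightarrow> real"
  assumes "\<And>x. (u has_real_derivative u' x) (at x)" "\<And>x. u x = 0 \<Longrightarrow> u' x \<noteq> 0"
    and "a \<le> b" "u a \<noteq> 0" "u b \<noteq> 0"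
  shows "even (card {x \<in> {a..b}. u x = 0}) \<longleftrightarrow> u a * u b > 0"
  using assms(3,5)
proof (induction "card {x \<in> {a..b}. u x = 0}" arbitrary: b rule: less_induct)
  case less
  let ?Z = "{x \<in> {a..b}. u x = 0}"
  have fin: "finite ?Z" by (rule simple_zeros_finite[where u'=u']) (use assms in auto)
  have cont: "continuous_on S u" for S
    using assms(1) by (auto intro!: continuous_at_imp_continuous_on DERIV_isCont)
  show ?case
  proof (cases "?Z = {}")
    case True
    then have "u a * u b > 0" using less.prems by (intro no_zero_same_sign cont) auto
    then show ?thesis unfolding True by simp
  next
    case False
    define z where "z = Max ?Z"
    have z: "z \<in> ?Z" "\<And>x. x \<in> ?Z \<Longrightarrow> x \<le> z"
      using Max_in[OF fin False] Max_ge[OF fin] by (auto simp: z_def)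
    have "z \<noteq> a" "z \<noteq> b" using z(1) assms(4) less.prems by auto
    then have zab: "a < z" "z < b" using z(1) by auto
    obtain e where e: "e > 0" "\<And>y. y \<noteq> z \<Longrightarrow> \<bar>y - z\<bar> < e \<Longrightarrow> u y * u' z * (y - z) > 0"
      using simple_zero_isolated[OF assms(1)[of z]] assms(2)[of z] z(1) by auto
    \<comment> \<open>\<open>c\<close> and \<open>d\<close> enclose \<open>z\<close> so tightly that
      \<open>z\<close> is the only zero between them; the induction continues on
      \<open>{a..c}\<close>.\<close>
    define c where "c = max a (z - e / 2)"
    define d where "d = min b (z + e / 2)"
    have c: "a \<le> c" "c < z" "z - c < e" and d: "d \<le> b" "z < d" "d - z < e"
      using zab e(1) by (auto simp: c_def d_def)
    have "u c * u' z * (c - z) > 0" "u d * u' z * (d - z) > 0"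
      using e(2)[of c] e(2)[of d] c d by auto
    then have s: "u c * u' z < 0" "u d * u' z > 0"
      using c d by (simp_all add: zero_less_mult_iff)
    have nz: "u x \<noteq> 0" if "x \<in> {d..b}" for x using z(2)[of x] that d zab by force
    have "u d * u b > 0" using d nz by (intro no_zero_same_sign cont) auto
    with s have cb: "u c * u b < 0" by (auto simp: zero_less_mult_iff mult_less_0_iff)
    have Zc: "?Z = insert z {x \<in> {a..c}. u x = 0}"
    proof -
      have "x \<le> c \<or> x = z" if "x \<in> ?Z" for x
        using z(2)[OF that] that e(2)[of x] c by force
      then show ?thesis using z(1) c zab by auto
    qed
    have fc: "finite {x \<in> {a..c}. u x = 0}" using fin Zc by (metis (no_types, lifting) finite_insert)
    have card: "card ?Z = Suc (card {x \<in> {a..c}. u x = 0})"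
      unfolding Zc using fc c by (subst card_insert_disjoint) auto
    have "u c \<noteq> 0" using s by auto
    then have "even (card {x \<in> {a..c}. u x = 0}) \<longleftrightarrow> u a * u c > 0"
      using less.hyps[of c] card c(1) by simp
    then have "even (card ?Z) \<longleftrightarrow> \<not> (u a * u c > 0)" unfolding card by simp
    also have "\<dots> \<longleftrightarrow> u a * u b > 0"
      using cb assms(4) \<open>u c \<noteq> 0\<close> by (auto simp: zero_less_mult_iff mult_less_0_iff)
    finally show ?thesis .
  qed
qed

text \<open>The end values satisfy \<open>u c * u (c + P) = \<sigma> * (u c)\<^sup>2\<close>, so the
  sign of \<open>\<sigma>\<close> decides the parity. It is 1 for a full period and -1 for the half
  period of the Wigner caustic.\<close>

lemma simple_zeros_period:
  fixes u :: "real \<Rightarrow> real"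
  assumes "\<And>x. (u has_real_derivative u' x) (at x)" "\<And>x. u x = 0 \<Longrightarrow> u' x \<noteq> 0"
    and "P > 0" "\<And>x. u (x + P) = \<sigma> * u x" "\<sigma> \<noteq> 0"
  shows "finite {x \<in> {a..<a + P}. u x = 0}" and "even (card {x \<in> {a..<a + P}. u x = 0}) \<longleftrightarrow> \<sigma> > 0"
proof -
  \<comment> \<open>The end point \<open>a\<close> may itself be a zero. A slight move of the window
    to the left makes both ends nonzero and keeps the zeros counted by the half-open
    interval.\<close>
  obtain c where c: "c \<le> a" "a - c < P" "u c \<noteq> 0" "\<And>x. x \<in> {c..<a} \<Longrightarrow> u x \<noteq> 0"
  proof (cases "u a = 0")
    case False
    then show thesis using that[of a] assms(3) by auto
  next
    case True
    then obtain e where e: "e > 0" "\<And>y. y \<noteq> a \<Longrightarrow> \<bar>y - a\<bar> < e \<Longrightarrow> u y * u' a * (y - a) > 0"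
      using simple_zero_isolated[OF assms(1)[of a]] assms(2)[of a] by auto
    have "u x \<noteq> 0" if "x \<in> {a - min (e/2) (P/2)..<a}" for x
      using e(2)[of x] that e(1) by (force simp: min_def split: if_splits)
    then show thesis using that[of "a - min (e/2) (P/2)"] e(1) assms(3) by auto
  qed
  have eq: "{x \<in> {a..<a + P}. u x = 0} = {x \<in> {c..c + P}. u x = 0}"
  proof -
    have "x \<le> c + P" if "u x = 0" "x < a + P" for x
    proof (rule ccontr)
      assume "\<not> ?thesis"
      then have "u (x - P) \<noteq> 0" using c(4)[of "x - P"] that by auto
      moreover have "u x = \<sigma> * u (x - P)" using assms(4)[of "x - P"] by simp
      ultimately show False using that assms(5) by simp
    qed
    moreover have "x \<ge> a" if "u x = 0" "c \<le> x" for x using c(4)[of x] that by force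
    moreover have "x < a + P" if "u x = 0" "x \<le> c + P" for x
    proof -
      have "u (c + P) \<noteq> 0" using assms(4,5) c(3) by simp
      then have "x \<noteq> c + P" using that by auto
      then show ?thesis using that c(1) by simp
    qed
    ultimately show ?thesis using c(1) by auto
  qed
  show "finite {x \<in> {a..<a + P}. u x = 0}"
    unfolding eq by (rule simple_zeros_finite[where u'=u']) (use assms in auto)
  have "even (card {x \<in> {c..c + P}. u x = 0}) \<longleftrightarrow> u c * u (c + P) > 0"
    by (rule simple_zeros_parity[OF assms(1,2)]) (use assms(3,4,5) c in auto)
  also have "u c * u (c + P) = \<sigma> * (u c)\<^sup>2" using assms(4)[of c] by (simp add: power2_eq_square)
  also have "\<dots> > 0 \<longleftrightarrow> \<sigma> > 0" using c(3) by (simp add: zero_less_mult_iff)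
  finally show "even (card {x \<in> {a..<a + P}. u x = 0}) \<longleftrightarrow> \<sigma> > 0" unfolding eq .
qed

text \<open>Critical values form a null set, which contains no interval. Since
  \<open>baby_Sard\<close> speaks of vectors, \<open>u\<close> is read as a map of
  \<open>real^1\<close>.\<close>

lemma sard_real:
  fixes u :: "real \<Rightarrow> real"
  assumes "\<And>x. x \<in> C \<Longrightarrow> (u has_real_derivative 0) (at x)" "a < b"
  shows "\<not> {a<..<b} \<subseteq> u ` C"
proof
  assume sub: "{a<..<b} \<subseteq> u ` C"
  let ?g = "\<lambda>x::real^1. vec (u (x $ 1)) :: real^1"
  have "negligible (?g ` (vec ` C))"
  proof (rule baby_Sard[where f' = "\<lambda>x h. 0"])
    fix x :: "real^1" assume "x \<in> vec ` C"
    then have "(u has_derivative (\<lambda>h. 0)) (at (x $ 1))"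
      using assms(1)[of "x $ 1"] by (auto simp: has_field_derivative_def lambda_zero)
    from has_derivative_compose[OF bounded_linear_imp_has_derivative[OF bounded_linear_vec_nth] this]
    have "((\<lambda>x. u (x $ 1)) has_derivative (\<lambda>h. 0)) (at x)" .
    moreover have "bounded_linear (vec :: real \<Rightarrow> real^1)"
      by (simp add: linear_conv_bounded_linear[symmetric] linear_vec)
    ultimately have "(?g has_derivative (\<lambda>h. vec 0)) (at x)"
      using bounded_linear.has_derivative by blast
    then show "(?g has_derivative (\<lambda>h. 0)) (at x within vec ` C)"
      by (simp add: has_derivative_at_withinI)
    have "matrix (\<lambda>h::real^1. 0 :: real^1) = 0" by (simp add: matrix_def vec_eq_iff)
    then show "rank (matrix (\<lambda>h::real^1. 0 :: real^1)) < CARD(1)" by (simp add: rank_0)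
  qed simp
  moreover have "box (vec a) (vec b) \<subseteq> ?g ` (vec ` C)"
  proof
    fix y :: "real^1" assume "y \<in> box (vec a) (vec b)"
    then have "y $ 1 \<in> {a<..<b}" by (simp add: mem_box_cart)
    then obtain x where "x \<in> C" "y $ 1 = u x" using sub by blast
    then show "y \<in> ?g ` (vec ` C)" by (force simp: vec_eq_iff image_iff)
  qed
  ultimately have "negligible (box (vec a) (vec b :: real^1))" using negligible_subset by blast
  moreover have "box (vec a) (vec b :: real^1) \<noteq> {}"
    using assms(2) by (simp add: interval_eq_empty_cart)
  ultimately show False using open_not_negligible open_box by blast
qed

section \<open>Counting cusps\<close>

context angle_curve
begin

lemma equidistant_cusps_even:
  assumes "\<And>\<theta>. q \<theta> = l \<Longrightarrow> vector_derivative q (at \<theta>) \<noteq> 0"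
  shows "finite (equidistant_cusps l f)" "even (card (equidistant_cusps l f))"
proof -
  let ?Z = "{x \<in> {\<Theta> 0..<\<Theta> 0 + 2 * pi}. l - q x = 0}"
  have d: "((\<lambda>x. l - q x) has_real_derivative 0 - vector_derivative q (at x)) (at x)" for x
    by (intro DERIV_diff DERIV_const q_deriv)
  have Z: "finite ?Z" "even (card ?Z)"
    using simple_zeros_period[OF d, where P="2 * pi" and \<sigma>=1 and a="\<Theta> 0"] assms by (auto simp: q_2pi)
  have im: "\<Theta> ` equidistant_cusps l f = ?Z"
  proof -
    have "\<Theta> 0 + 2 * pi = \<Theta> (2 * pi)" using Theta_per[of 0] by simp
    then have per: "s \<in> {0..<2 * pi} \<longleftrightarrow> \<Theta> s \<in> {\<Theta> 0..<\<Theta> 0 + 2 * pi}" for s by simp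
    have c: "cusp_at (equidistant l f) s \<longleftrightarrow> q (\<Theta> s) = l" for s
      by (rule cusp_iff) (rule assms)
    have eqs: "s \<in> equidistant_cusps l f \<longleftrightarrow> \<Theta> s \<in> ?Z" for s
      unfolding equidistant_cusps_def mem_Collect_eq c per[symmetric] right_minus_eq
      by (simp only: eq_commute[of l])
    show ?thesis
    proof
      show "\<Theta> ` equidistant_cusps l f \<subseteq> ?Z" using eqs by blast
      show "?Z \<subseteq> \<Theta> ` equidistant_cusps l f"
      proof
        fix y assume "y \<in> ?Z"
        then have "T y \<in> equidistant_cusps l f" unfolding eqs Theta_T .
        then show "y \<in> \<Theta> ` equidistant_cusps l f" using Theta_T[of y] by (metis imageI)
      qed
    qed
  qed
  have inj: "inj_on \<Theta> (equidistant_cusps l f)" by (rule inj_onI) simp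
  show "finite (equidistant_cusps l f)" by (rule finite_imageD[OF _ inj]) (simp only: im Z)
  show "even (card (equidistant_cusps l f))" unfolding card_image[OF inj, symmetric] im by (rule Z(2))
qed

text \<open>The unordered pair at \<open>\<theta>\<close> is the same as at
  \<open>\<theta> + pi\<close>, so the pairs are counted by the zeros of \<open>1/2 - q\<close> in a
  half period, at whose ends this function has opposite values.\<close>

lemma wigner_cusps_odd:
  assumes "\<And>\<theta>. q \<theta> = 1/2 \<Longrightarrow> vector_derivative q (at \<theta>) \<noteq> 0"
  shows "finite (wigner_cusps f)" "odd (card (wigner_cusps f))"
proof -
  let ?Z = "{x \<in> {0..<0 + pi}. 1/2 - q x = 0}"
  let ?g = "\<lambda>\<theta>. {F \<theta>, F (\<theta> + pi)}"
  have d: "((\<lambda>x. 1/2 - q x) has_real_derivative 0 - vector_derivative q (at x)) (at x)" for x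
    by (intro DERIV_diff DERIV_const q_deriv)
  have "1/2 - q (x + pi) = - 1 * (1/2 - q x)" for x by (simp add: q_pi)
  then have Z: "finite ?Z" "odd (card ?Z)"
    using simple_zeros_period[OF d, where P=pi and \<sigma>="-1" and a=0] assms by auto
  have c: "cusp_at (equidistant (1/2) f) s \<longleftrightarrow> q (\<Theta> s) = 1/2" for s
    by (rule cusp_iff) (rule assms)
  have W: "wigner_cusps f = {?g (\<Theta> s) | s. q (\<Theta> s) = 1/2}"
    unfolding wigner_cusps_def partner_f F_Theta F_Theta_pi by (simp only: c)
  have F_per: "F (\<theta> + of_int n * (2 * pi)) = F \<theta>" for \<theta> n
    by (rule periodic_of_int) (simp add: F_def T_per f_per)
  have g_pi: "?g (\<theta> + pi) = ?g \<theta>" for \<theta>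
    using F_per[of \<theta> 1] by (simp add: insert_commute algebra_simps)
  have sh: "q (\<theta> + of_int n * pi) = 1/2 \<longleftrightarrow> q \<theta> = 1/2" for \<theta> n
  proof -
    \<comment> \<open>A half turn replaces \<open>q\<close> by \<open>1 - q\<close>, which preserves
      the value 1/2; \<open>periodic_of_int\<close> is applied to this predicate rather than to
      \<open>q\<close>.\<close>
    have "(\<lambda>\<theta>. q \<theta> = 1/2) (\<theta> + of_int n * pi) = (q \<theta> = 1/2)"
      by (rule periodic_of_int) (auto simp: q_pi)
    then show ?thesis .
  qed
  have im: "?g ` ?Z = wigner_cusps f"
  proof
    show "?g ` ?Z \<subseteq> wigner_cusps f"
    proof
      fix w assume "w \<in> ?g ` ?Z"
      then obtain \<theta> where "q \<theta> = 1/2" "w = ?g \<theta>" by auto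
      then show "w \<in> wigner_cusps f" unfolding W by (intro CollectI exI[of _ "T \<theta>"]) simp
    qed
    show "wigner_cusps f \<subseteq> ?g ` ?Z"
    proof
      fix w assume "w \<in> wigner_cusps f"
      then obtain s where s: "q (\<Theta> s) = 1/2" "w = ?g (\<Theta> s)" unfolding W by blast
      obtain n :: int where n: "\<Theta> s + of_int n * pi \<in> {0..<0 + pi}" using ex_shift_into_period[of pi "\<Theta> s" 0] by auto
      have "?g (\<Theta> s + of_int n * pi) = ?g (\<Theta> s)"
        by (rule periodic_of_int[of ?g]) (rule g_pi)
      moreover have "\<Theta> s + of_int n * pi \<in> ?Z" using n s(1) sh[of "\<Theta> s" n] by simp
      ultimately show "w \<in> ?g ` ?Z" using s(2) by blast
    qed
  qed
  have Fne: "F x \<noteq> F y" if "x < y" "y < x + 2 * pi" for x y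
  proof -
    have "T y < T (x + 2 * pi)" using that by simp
    then show ?thesis unfolding F_def using that by (intro f_ne) (simp_all add: T_per)
  qed
  \<comment> \<open>For \<open>x < y\<close> in the half period both \<open>y\<close> and
    \<open>y + pi\<close> come less than one turn after \<open>x\<close>, so \<open>F x\<close> is
    neither element of the other pair.\<close>
  have "inj_on ?g ?Z"
  proof (rule linorder_inj_onI')
    fix x y assume xy: "x \<in> ?Z" "y \<in> ?Z" "x < y"
    then have "F x \<noteq> F y" by (intro Fne) auto
    moreover have "F x \<noteq> F (y + pi)" by (rule Fne) (use xy in auto)
    ultimately show "?g x \<noteq> ?g y" by (auto simp: doubleton_eq_iff)
  qed
  from card_image[OF this] have "card (wigner_cusps f) = card ?Z" unfolding im .
  then show "odd (card (wigner_cusps f))" using Z(2) by simp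
  show "finite (wigner_cusps f)" unfolding im[symmetric] by (rule finite_imageI[OF Z(1)])
qed

text \<open>\<open>L\<close> is the complement of the critical values of \<open>q\<close>. They form
  a compact set because one period produces all of them, and by Sard's theorem they have no
  interior.\<close>

lemma generic_ratio:
  obtains L where "open L" "closure L = (UNIV::real set)"
    "\<And>l \<theta>. l \<in> L \<Longrightarrow> q \<theta> = l \<Longrightarrow> vector_derivative q (at \<theta>) \<noteq> 0"
proof -
  let ?q' = "\<lambda>\<theta>. vector_derivative q (at \<theta>)"
  define C where "C = {\<theta>. ?q' \<theta> = 0}"
  have cq: "continuous_on UNIV q" "continuous_on UNIV ?q'"
    using smooth_on_imp_continuous sm_q smooth_on_vector_derivative[OF open_UNIV sm_q] by blast+
  have q'_per: "?q' (x + 2 * pi) = ?q' x" for x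
    by (rule vector_derivative_periodic[OF smooth_on_has_vector_derivative[OF open_UNIV sm_q]]) (auto simp: q_2pi)
  have "closed C" unfolding C_def
    using continuous_closed_preimage_constant[OF cq(2), of 0] by simp
  then have "compact (C \<inter> {0..2 * pi})" by (simp add: closed_Int_compact)
  then have comp: "compact (q ` (C \<inter> {0..2 * pi}))"
    using cq(1) by (intro compact_continuous_image) (auto intro: continuous_on_subset)
  have "q ` C \<subseteq> q ` (C \<inter> {0..2 * pi})"
  proof
    fix y assume "y \<in> q ` C"
    then obtain x where x: "?q' x = 0" "y = q x" by (auto simp: C_def)
    obtain n :: int where n: "x + of_int n * (2 * pi) \<in> {0..<0 + 2 * pi}"
      using ex_shift_into_period[of "2 * pi" x 0] by auto
    have "?q' (x + of_int n * (2 * pi)) = ?q' x" by (rule periodic_of_int[of ?q']) (rule q'_per)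
    moreover have "q (x + of_int n * (2 * pi)) = q x" by (rule periodic_of_int) (rule q_2pi)
    ultimately show "y \<in> q ` (C \<inter> {0..2 * pi})"
      using x n by (intro image_eqI[of _ _ "x + of_int n * (2 * pi)"]) (auto simp: C_def)
  qed
  then have eq: "q ` C = q ` (C \<inter> {0..2 * pi})" by auto
  have "open (- (q ` C))" unfolding eq using compact_imp_closed[OF comp] by (rule open_Compl)
  moreover have "closure (- (q ` C)) = UNIV"
  proof -
    have d0: "(q has_real_derivative 0) (at \<theta>)" if "\<theta> \<in> C" for \<theta>
      using q_deriv[of \<theta>] that by (simp add: C_def)
    have "interior (q ` C) = {}"
    proof (rule ccontr)
      assume "interior (q ` C) \<noteq> {}"
      then obtain x where "x \<in> interior (q ` C)" by blast
      then obtain e where "e > 0" "ball x e \<subseteq> q ` C" using mem_interior by blast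
      moreover have "{x<..<x + e} \<subseteq> ball x e" by (auto simp: dist_real_def)
      ultimately show False
        using sard_real[of C q x "x + e", OF d0] by auto
    qed
    then show ?thesis by (simp add: closure_complement)
  qed
  moreover have "?q' \<theta> \<noteq> 0" if "l \<in> - (q ` C)" "q \<theta> = l" for l \<theta>
    using that by (auto simp: C_def)
  ultimately show thesis by (rule that)
qed

lemma generic_conclusion:
  assumes "\<And>\<theta>. q \<theta> = 1/2 \<Longrightarrow> vector_derivative q (at \<theta>) \<noteq> 0"
  shows "(\<exists>L. open L \<and> closure L = (UNIV :: real set) \<and>
        (\<forall>l\<in>L. l \<noteq> 1/2 \<longrightarrow>
          only_cusp_singularities (equidistant l f) \<and>
          finite (equidistant_cusps l f) \<and> even (card (equidistant_cusps l f)))) \<and>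
      only_cusp_singularities (equidistant (1/2) f) \<and>
      finite (wigner_cusps f) \<and> odd (card (wigner_cusps f))"
proof -
  obtain L where L: "open L" "closure L = (UNIV::real set)"
    "\<And>l \<theta>. l \<in> L \<Longrightarrow> q \<theta> = l \<Longrightarrow> vector_derivative q (at \<theta>) \<noteq> 0"
    by (rule generic_ratio) (rule that)
  have "only_cusp_singularities (equidistant l f) \<and>
          finite (equidistant_cusps l f) \<and> even (card (equidistant_cusps l f))" if "l \<in> L" for l
    using only_cusps[of l] equidistant_cusps_even[of l] L(3)[OF that] by blast
  then have "\<exists>L. open L \<and> closure L = (UNIV :: real set) \<and>
        (\<forall>l\<in>L. l \<noteq> 1/2 \<longrightarrow>
          only_cusp_singularities (equidistant l f) \<and>
          finite (equidistant_cusps l f) \<and> even (card (equidistant_cusps l f)))"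
    using L(1,2) by (intro exI[of _ L]) simp
  then show ?thesis
    by (intro conjI only_cusps wigner_cusps_odd assms)
qed

end

section \<open>Genericity\<close>

lemma Cinf_ball_self: "smooth_closed_curve f \<Longrightarrow> 0 < e \<Longrightarrow> f \<in> Cinf_ball f k e"
  by (simp add: Cinf_ball_def)

lemma Cinf_ball_mono: "k \<le> k' \<Longrightarrow> e' \<le> e \<Longrightarrow> Cinf_ball f k' e' \<subseteq> Cinf_ball f k e"
  by (auto simp: Cinf_ball_def intro: less_le_trans[where y=e'])

lemma openin_Cinf_ball: "smooth_closed_curve f \<Longrightarrow> 0 < e \<Longrightarrow> openin Cinf_topology (Cinf_ball f k e)"
  unfolding Cinf_topology_def
  by (rule topology_generated_by_Basis, rule CollectI, intro exI conjI, rule refl)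

lemma topspace_Cinf: "topspace Cinf_topology = {f. smooth_closed_curve f}"
proof
  show "topspace Cinf_topology \<subseteq> {f. smooth_closed_curve f}"
    unfolding Cinf_topology_def topology_generated_by_topspace by (auto simp: Cinf_ball_def)
  show "{f. smooth_closed_curve f} \<subseteq> topspace Cinf_topology"
    using openin_subset[OF openin_Cinf_ball[of _ 1 0]] Cinf_ball_self[of _ 1 0] by auto
qed

lemma nth_deriv_periodic:
  assumes "smooth_closed_curve f"
  shows "nth_deriv n f (t + 2 * pi) = nth_deriv n f t"
proof -
  have sm: "smooth_on UNIV f" and per: "\<And>t. f (t + 2 * pi) = f t"
    using assms by (auto simp: smooth_closed_curve_def)
  show ?thesis
  proof (induction n arbitrary: t)
    case (Suc n)
    show ?case
      by (rule vector_derivative_periodic[OF nth_deriv_has_derivative[OF open_UNIV sm]]) (auto simp: Suc)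
  qed (simp add: per)
qed

lemma nth_deriv_continuous:
  assumes "smooth_closed_curve f"
  shows "continuous_on S (nth_deriv n f)"
  using smooth_on_imp_continuous[OF smooth_on_nth_deriv[OF open_UNIV]] assms continuous_on_subset
  unfolding smooth_closed_curve_def by blast

lemma periodic_bounded:
  fixes f :: "real \<Rightarrow> real"
  assumes "continuous_on UNIV f" "\<And>t. f (t + 2 * pi) = f t"
  obtains s where "\<And>t. f t \<le> f s"
proof -
  have "\<exists>s\<in>{0..2 * pi}. \<forall>t\<in>{0..2 * pi}. f t \<le> f s"
    by (rule continuous_attains_sup) (auto intro: continuous_on_subset[OF assms(1)])
  then obtain s where s: "\<And>t. t \<in> {0..2 * pi} \<Longrightarrow> f t \<le> f s" by blast
  have "f t \<le> f s" for t
  proof -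
    obtain n :: int where n: "t + of_int n * (2 * pi) \<in> {0..<0 + 2 * pi}"
      using ex_shift_into_period[of "2 * pi" t 0] by auto
    have "f (t + of_int n * (2 * pi)) = f t" by (rule periodic_of_int) (rule assms(2))
    then show ?thesis using s[of "t + of_int n * (2 * pi)"] n by simp
  qed
  then show thesis by (rule that)
qed

text \<open>By periodicity the distances attain their maxima, so the strict pointwise bounds leave a
  positive margin \<open>e - M\<close>.\<close>

lemma Cinf_ball_recenter:
  assumes "smooth_closed_curve f0" "f \<in> Cinf_ball f0 k e"
  obtains d where "d > 0" "Cinf_ball f k d \<subseteq> Cinf_ball f0 k e"
proof -
  have smf: "smooth_closed_curve f" using assms(2) by (simp add: Cinf_ball_def)
  have "\<exists>s. \<forall>t. dist (nth_deriv j f t) (nth_deriv j f0 t) \<le> dist (nth_deriv j f s) (nth_deriv j f0 s)" for j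
  proof -
    obtain s where "\<And>t. dist (nth_deriv j f t) (nth_deriv j f0 t) \<le> dist (nth_deriv j f s) (nth_deriv j f0 s)"
      by (rule periodic_bounded[of "\<lambda>t. dist (nth_deriv j f t) (nth_deriv j f0 t)"])
        (use nth_deriv_continuous nth_deriv_periodic assms(1) smf in \<open>auto intro!: continuous_on_dist\<close>)
    then show ?thesis by blast
  qed
  then obtain s where s: "\<And>j t. dist (nth_deriv j f t) (nth_deriv j f0 t) \<le> dist (nth_deriv j f (s j)) (nth_deriv j f0 (s j))"
    by metis
  define M where "M = Max ((\<lambda>j. dist (nth_deriv j f (s j)) (nth_deriv j f0 (s j))) ` {..k})"
  have M: "M < e"
    unfolding M_def using assms(2) by (subst Max_less_iff) (auto simp: Cinf_ball_def)
  have le: "dist (nth_deriv j f t) (nth_deriv j f0 t) \<le> M" if "j \<le> k" for j t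
    unfolding M_def by (rule order_trans[OF s]) (rule Max_ge, use that in auto)
  have "Cinf_ball f k (e - M) \<subseteq> Cinf_ball f0 k e"
  proof
    fix g assume g: "g \<in> Cinf_ball f k (e - M)"
    have "dist (nth_deriv j g t) (nth_deriv j f0 t) < e" if "j \<le> k" for j t
    proof -
      have "dist (nth_deriv j g t) (nth_deriv j f t) < e - M" using g that by (simp add: Cinf_ball_def)
      then show ?thesis using le[OF that, of t] dist_triangle[of "nth_deriv j g t" "nth_deriv j f0 t" "nth_deriv j f t"]
        by linarith
    qed
    then show "g \<in> Cinf_ball f0 k e" using g by (simp add: Cinf_ball_def)
  qed
  then show thesis using that[of "e - M"] M by simp
qed

text \<open>The balls are only given as a subbase. Recentring makes the balls around
  \<open>f\<close> a neighbourhood base; intersections take the larger order and the smaller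
  radius.\<close>

lemma Cinf_nhd:
  assumes "openin Cinf_topology T" "f \<in> T"
  obtains k e where "e > 0" "Cinf_ball f k e \<subseteq> T"
proof -
  have "generate_topology_on {Cinf_ball f k e | f k e. smooth_closed_curve f \<and> 0 < e} T"
    using assms(1) by (simp add: Cinf_topology_def openin_topology_generated_by_iff)
  then have "\<forall>f\<in>T. \<exists>k e. e > 0 \<and> Cinf_ball f k e \<subseteq> T"
  proof induction
    case Empty
    then show ?case by simp
  next
    case (Int a b)
    show ?case
    proof
      fix f assume f: "f \<in> a \<inter> b"
      then obtain k1 e1 k2 e2 where "e1 > 0" "Cinf_ball f k1 e1 \<subseteq> a" "e2 > 0" "Cinf_ball f k2 e2 \<subseteq> b"
        using Int.IH by blast
      moreover have "Cinf_ball f (max k1 k2) (min e1 e2) \<subseteq> Cinf_ball f k1 e1"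
        "Cinf_ball f (max k1 k2) (min e1 e2) \<subseteq> Cinf_ball f k2 e2"
        by (rule Cinf_ball_mono; simp)+
      ultimately show "\<exists>k e. e > 0 \<and> Cinf_ball f k e \<subseteq> a \<inter> b"
        by (intro exI[of _ "max k1 k2"] exI[of _ "min e1 e2"]) auto
    qed
  next
    case (UN K)
    then show ?case by (meson Union_iff Union_upper order_trans)
  next
    case (Basis s)
    then obtain f0 k e where s: "s = Cinf_ball f0 k e" "smooth_closed_curve f0" by blast
    then show ?case using Cinf_ball_recenter[OF s(2)] by metis
  qed
  then show thesis using assms(2) that by blast
qed

text \<open>Curvature and its derivative with respect to arc length, in terms of the first three derivatives
  of the curve.\<close>

definition curv_jet :: "real^2 \<Rightarrow> real^2 \<Rightarrow> real" where
  "curv_jet a b = cross2 a b / norm a ^ 3"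

definition dcurv_jet :: "real^2 \<Rightarrow> real^2 \<Rightarrow> real^2 \<Rightarrow> real" where
  "dcurv_jet a b c = (cross2 a c * (norm a)\<^sup>2 - 3 * cross2 a b * (a \<bullet> b)) / norm a ^ 6"

text \<open>The Wigner caustic degenerates where an antiparallel pair of points has the same curvature and
  the same derivative of the curvature with respect to arc length.\<close>

definition degenerate_pair :: "(real \<Rightarrow> real^2) \<Rightarrow> real \<Rightarrow> real \<Rightarrow> bool" where
  "degenerate_pair f s t \<longleftrightarrow>
     cross2 (nth_deriv 1 f s) (nth_deriv 1 f t) = 0 \<and> nth_deriv 1 f s \<bullet> nth_deriv 1 f t \<le> 0 \<and>
     curv_jet (nth_deriv 1 f s) (nth_deriv 2 f s) = curv_jet (nth_deriv 1 f t) (nth_deriv 2 f t) \<and>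
     dcurv_jet (nth_deriv 1 f s) (nth_deriv 2 f s) (nth_deriv 3 f s) =
     dcurv_jet (nth_deriv 1 f t) (nth_deriv 2 f t) (nth_deriv 3 f t)"

text \<open>Stated through jets at arbitrary parameters, so that membership can be compared between
  neighbouring curves without comparing their tangent angles.\<close>

definition generic_curves :: "(real \<Rightarrow> real^2) set" where
  "generic_curves = {f. convex_curve f \<and> (\<forall>s t. \<not> degenerate_pair f s t)}"

section \<open>Openness of the generic set\<close>

lemma degenerate_pair_shift:
  assumes "smooth_closed_curve f" "degenerate_pair f s t"
  obtains s' t' where "s' \<in> {0..2 * pi}" "t' \<in> {0..2 * pi}" "degenerate_pair f s' t'"
proof -
  have P: "nth_deriv n f (x + of_int i * (2 * pi)) = nth_deriv n f x" for n x i
    by (rule periodic_of_int) (rule nth_deriv_periodic[OF assms(1)])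
  obtain i :: int where i: "s + of_int i * (2 * pi) \<in> {0..<0 + 2 * pi}" using ex_shift_into_period[of "2 * pi" s 0] by auto
  obtain j :: int where j: "t + of_int j * (2 * pi) \<in> {0..<0 + 2 * pi}" using ex_shift_into_period[of "2 * pi" t 0] by auto
  have "degenerate_pair f (s + of_int i * (2 * pi)) (t + of_int j * (2 * pi))"
    using assms(2) by (simp only: degenerate_pair_def P)
  moreover have "s + of_int i * (2 * pi) \<in> {0..2 * pi}" "t + of_int j * (2 * pi) \<in> {0..2 * pi}"
    using i j by simp_all
  ultimately show thesis using that by blast
qed

text \<open>Degeneracy consists of equations and one non-strict inequality between 3-jets, hence
  survives limits in \<open>C^3\<close>. The limit curve must be regular because the jets divide by
  its speed.\<close>

lemma degenerate_pair_limit: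
  assumes f: "smooth_closed_curve f" and reg: "\<And>t. nth_deriv 1 f t \<noteq> 0"
    and g: "\<And>n. g n \<in> Cinf_ball f 3 (1 / Suc n)" "\<And>n. degenerate_pair (g n) (s n) (t n)"
    and lim: "s \<longlonglongrightarrow> s0" "t \<longlonglongrightarrow> t0"
  shows "degenerate_pair f s0 t0"
proof -
  have J: "(\<lambda>n. nth_deriv j (g n) (r n)) \<longlonglongrightarrow> nth_deriv j f r0" if "j \<le> 3" "r \<longlonglongrightarrow> r0" for j r r0
  proof -
    have "isCont (nth_deriv j f) r0"
      using nth_deriv_continuous[OF f, of UNIV j] by (simp add: continuous_on_eq_continuous_at)
    then have 1: "(\<lambda>n. nth_deriv j f (r n)) \<longlonglongrightarrow> nth_deriv j f r0"
      by (rule isCont_tendsto_compose) (rule that(2))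
    have "(\<lambda>n. nth_deriv j (g n) (r n) - nth_deriv j f (r n)) \<longlonglongrightarrow> 0"
    proof (rule Lim_null_comparison)
      show "\<forall>\<^sub>F n in sequentially. norm (nth_deriv j (g n) (r n) - nth_deriv j f (r n)) \<le> 1 / real (Suc n)"
        using g(1) that(1) by (intro always_eventually allI less_imp_le) (simp add: Cinf_ball_def dist_norm)
      show "(\<lambda>n. 1 / real (Suc n)) \<longlonglongrightarrow> 0" by (rule LIMSEQ_Suc[OF lim_1_over_n])
    qed
    from tendsto_add[OF 1 this] show ?thesis by simp
  qed
  note Js = J[OF _ lim(1)] and Jt = J[OF _ lim(2)]
  have cr: "(\<lambda>n. cross2 (a n) (b n)) \<longlonglongrightarrow> cross2 a0 b0" if "a \<longlonglongrightarrow> a0" "b \<longlonglongrightarrow> b0" for a b a0 b0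
    using bounded_bilinear.tendsto[OF bounded_bilinear_cross2 that] .
  have K: "(\<lambda>n. curv_jet (a n) (b n)) \<longlonglongrightarrow> curv_jet a0 b0"
    if "a \<longlonglongrightarrow> a0" "b \<longlonglongrightarrow> b0" "a0 \<noteq> 0" for a b a0 b0
    unfolding curv_jet_def using that by (intro tendsto_intros cr) auto
  have K': "(\<lambda>n. dcurv_jet (a n) (b n) (c n)) \<longlonglongrightarrow> dcurv_jet a0 b0 c0"
    if "a \<longlonglongrightarrow> a0" "b \<longlonglongrightarrow> b0" "c \<longlonglongrightarrow> c0" "a0 \<noteq> 0" for a b c a0 b0 c0
    unfolding dcurv_jet_def using that by (intro tendsto_intros cr) auto
  note D = g(2)[unfolded degenerate_pair_def]
  show ?thesis
    unfolding degenerate_pair_def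
  proof (intro conjI)
    have "(\<lambda>n. cross2 (nth_deriv 1 (g n) (s n)) (nth_deriv 1 (g n) (t n))) \<longlonglongrightarrow> cross2 (nth_deriv 1 f s0) (nth_deriv 1 f t0)"
      by (intro cr Js Jt) auto
    then show "cross2 (nth_deriv 1 f s0) (nth_deriv 1 f t0) = 0"
      using D LIMSEQ_unique[OF _ tendsto_const[of 0]] by auto
    have "(\<lambda>n. nth_deriv 1 (g n) (s n) \<bullet> nth_deriv 1 (g n) (t n)) \<longlonglongrightarrow> nth_deriv 1 f s0 \<bullet> nth_deriv 1 f t0"
      by (intro tendsto_inner Js Jt) auto
    then show "nth_deriv 1 f s0 \<bullet> nth_deriv 1 f t0 \<le> 0"
      by (rule LIMSEQ_le_const2) (use D in auto)
    have 1: "(\<lambda>n. curv_jet (nth_deriv 1 (g n) (s n)) (nth_deriv 2 (g n) (s n))) \<longlonglongrightarrow> curv_jet (nth_deriv 1 f s0) (nth_deriv 2 f s0)"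
      and 2: "(\<lambda>n. curv_jet (nth_deriv 1 (g n) (t n)) (nth_deriv 2 (g n) (t n))) \<longlonglongrightarrow> curv_jet (nth_deriv 1 f t0) (nth_deriv 2 f t0)"
      by (intro K Js Jt reg; simp)+
    have "(\<lambda>n. curv_jet (nth_deriv 1 (g n) (s n)) (nth_deriv 2 (g n) (s n))) \<longlonglongrightarrow> curv_jet (nth_deriv 1 f t0) (nth_deriv 2 f t0)"
      using 2 D by simp
    then show "curv_jet (nth_deriv 1 f s0) (nth_deriv 2 f s0) = curv_jet (nth_deriv 1 f t0) (nth_deriv 2 f t0)"
      using 1 LIMSEQ_unique by blast
    have 1: "(\<lambda>n. dcurv_jet (nth_deriv 1 (g n) (s n)) (nth_deriv 2 (g n) (s n)) (nth_deriv 3 (g n) (s n))) \<longlonglongrightarrow>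
        dcurv_jet (nth_deriv 1 f s0) (nth_deriv 2 f s0) (nth_deriv 3 f s0)"
      and 2: "(\<lambda>n. dcurv_jet (nth_deriv 1 (g n) (t n)) (nth_deriv 2 (g n) (t n)) (nth_deriv 3 (g n) (t n))) \<longlonglongrightarrow>
        dcurv_jet (nth_deriv 1 f t0) (nth_deriv 2 f t0) (nth_deriv 3 f t0)"
      by (intro K' Js Jt reg; simp)+
    have "(\<lambda>n. dcurv_jet (nth_deriv 1 (g n) (s n)) (nth_deriv 2 (g n) (s n)) (nth_deriv 3 (g n) (s n))) \<longlonglongrightarrow>
        dcurv_jet (nth_deriv 1 f t0) (nth_deriv 2 f t0) (nth_deriv 3 f t0)"
      using 2 D by simp
    then show "dcurv_jet (nth_deriv 1 f s0) (nth_deriv 2 f s0) (nth_deriv 3 f s0) =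
        dcurv_jet (nth_deriv 1 f t0) (nth_deriv 2 f t0) (nth_deriv 3 f t0)"
      using 1 LIMSEQ_unique by blast
  qed
qed

text \<open>Otherwise degenerate convex curves converge to \<open>f\<close> in \<open>C^3\<close>.
  Their degenerate pairs, moved into a compact square of parameters, have a convergent subsequence
  whose limit is a degenerate pair of \<open>f\<close>.\<close>

lemma openin_generic: "openin convex_curve_topology generic_curves"
  unfolding openin_subopen[of _ generic_curves]
proof
  fix f assume f: "f \<in> generic_curves"
  have cf: "convex_curve f" and nd: "\<And>s t. \<not> degenerate_pair f s t"
    using f by (auto simp: generic_curves_def)
  have smf: "smooth_closed_curve f" and reg: "\<And>t. nth_deriv 1 f t \<noteq> 0"
    using cf by (auto simp: convex_curve_def)
  have "\<exists>e>0. Cinf_ball f 3 e \<inter> {f. convex_curve f} \<subseteq> generic_curves"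
  proof (rule ccontr)
    assume n: "\<not> ?thesis"
    have "\<exists>g. g \<in> Cinf_ball f 3 (1 / Suc n) \<and> convex_curve g \<and> g \<notin> generic_curves" for n
    proof -
      have "0 < 1 / real (Suc n)" by simp
      then have "\<not> Cinf_ball f 3 (1 / Suc n) \<inter> {f. convex_curve f} \<subseteq> generic_curves" using n by blast
      then show ?thesis by blast
    qed
    then obtain g where g: "\<And>n. g n \<in> Cinf_ball f 3 (1 / Suc n)" "\<And>n. convex_curve (g n)" "\<And>n. g n \<notin> generic_curves"
      by metis
    have "\<exists>x. x \<in> {0..2 * pi} \<times> {0..2 * pi} \<and> degenerate_pair (g n) (fst x) (snd x)" for n
    proof -
      obtain s t where "degenerate_pair (g n) s t" using g(2,3)[of n] by (auto simp: generic_curves_def)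
      moreover have "smooth_closed_curve (g n)" using g(2) by (simp add: convex_curve_def)
      ultimately obtain s' t' where "s' \<in> {0..2 * pi}" "t' \<in> {0..2 * pi}" "degenerate_pair (g n) s' t'"
        using degenerate_pair_shift by metis
      then show ?thesis by (intro exI[of _ "(s', t')"]) simp
    qed
    then obtain x where x: "\<And>n. x n \<in> {0..2 * pi} \<times> {0..2 * pi}" "\<And>n. degenerate_pair (g n) (fst (x n)) (snd (x n))"
      by metis
    have comp: "compact ({0..2 * pi} \<times> {0..2 * pi})" by (intro compact_Times compact_Icc)
    have "\<forall>n. x n \<in> {0..2 * pi} \<times> {0..2 * pi}" using x(1) by blast
    then obtain x0 r where r: "strict_mono r" "(x \<circ> r) \<longlonglongrightarrow> x0"
      by (rule seq_compactE[OF compact_imp_seq_compact[OF comp]]) (rule that)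
    have "degenerate_pair f (fst x0) (snd x0)"
    proof (rule degenerate_pair_limit[OF smf reg, where g="\<lambda>n. g (r n)"])
      show "g (r n) \<in> Cinf_ball f 3 (1 / Suc n)" for n
      proof -
        have "n \<le> r n" using r(1) seq_suble by blast
        then have "1 / real (Suc (r n)) \<le> 1 / real (Suc n)" by (simp add: frac_le)
        then show ?thesis using Cinf_ball_mono[of 3 3] g(1)[of "r n"] by blast
      qed
      show "degenerate_pair (g (r n)) (fst (x (r n))) (snd (x (r n)))" for n by (rule x(2))
      show "(\<lambda>n. fst (x (r n))) \<longlonglongrightarrow> fst x0" "(\<lambda>n. snd (x (r n))) \<longlonglongrightarrow> snd x0"
        using r(2) by (auto simp: o_def intro: tendsto_intros)
    qed
    then show False using nd by blast
  qed
  then obtain e where "e > 0" "Cinf_ball f 3 e \<inter> {f. convex_curve f} \<subseteq> generic_curves" by blast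
  moreover have "openin convex_curve_topology (Cinf_ball f 3 e \<inter> {f. convex_curve f})"
    unfolding convex_curve_topology_def
    using openin_Cinf_ball[OF smf \<open>e > 0\<close>] by (intro openin_subtopology_Int)
  ultimately show "\<exists>T. openin convex_curve_topology T \<and> f \<in> T \<and> T \<subseteq> generic_curves"
    using Cinf_ball_self[OF smf] cf by blast
qed

section \<open>Degeneracy in terms of the radius of curvature\<close>

context angle_curve
begin

lemma rho_deriv: "(\<rho> has_real_derivative vector_derivative \<rho> (at \<theta>)) (at \<theta>)"
  using smooth_on_has_vector_derivative[OF open_UNIV sm_rho]
  by (simp add: has_real_derivative_iff_has_vector_derivative)

lemma m_eq: "m s = \<rho> (\<Theta> s) * vector_derivative \<Theta> (at s)"
  using Theta'_pos[of s] by (simp add: \<rho>_def)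

text \<open>The curvature is \<open>\<epsilon> / \<rho>\<close>, and differentiation by arc length
  is differentiation by the angle divided by \<open>\<rho>\<close>, which accounts for the
  cube.\<close>

lemma curvature_jets:
  shows "curv_jet (nth_deriv 1 f s) (nth_deriv 2 f s) = \<epsilon> / \<rho> (\<Theta> s)"
    and "dcurv_jet (nth_deriv 1 f s) (nth_deriv 2 f s) (nth_deriv 3 f s) =
      - \<epsilon> * vector_derivative \<rho> (at (\<Theta> s)) / \<rho> (\<Theta> s) ^ 3"
proof -
  define W where "W = (\<lambda>t. vector_derivative \<Theta> (at t))"
  have sW: "smooth_on UNIV W" unfolding W_def by (rule smooth_on_vector_derivative[OF open_UNIV sm_Theta])
  have W: "(\<Theta> has_real_derivative W t) (at t)" for t using Theta_deriv by (simp add: W_def)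
  define m1 where "m1 = nth_deriv 1 m"
  define m2 where "m2 = nth_deriv 2 m"
  define W1 where "W1 = nth_deriv 1 W"
  have dm: "(m has_real_derivative m1 t) (at t)" "(m1 has_real_derivative m2 t) (at t)"
    and dW: "(W has_real_derivative W1 t) (at t)" for t
    using nth_deriv_has_derivative[OF open_UNIV sm_m, of t 0] nth_deriv_has_derivative[OF open_UNIV sm_m, of t 1]
      nth_deriv_has_derivative[OF open_UNIV sW, of t 0]
    by (simp_all add: m1_def m2_def W1_def numeral_2_eq_2 has_real_derivative_iff_has_vector_derivative)
  let ?e = "\<lambda>t. dir \<epsilon> (\<Theta> t)" and ?n = "\<lambda>t. dir \<epsilon> (\<Theta> t + pi / 2)"
  have f1: "nth_deriv 1 f = (\<lambda>t. m t *\<^sub>R ?e t)" using f_deriv1 by blast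
  note f23 = nth_deriv_dir[OF f1 dm W dW, of s]
  have n1: "norm (nth_deriv 1 f s) = m s" using m_pos[of s] by (simp add: f_deriv1 norm_dir[OF eps] del: One_nat_def)
  have c12: "cross2 (nth_deriv 1 f s) (nth_deriv 2 f s) = \<epsilon> * (m s)\<^sup>2 * W s"
    unfolding f1 f23 by (simp add: cross2_simps power2_eq_square)
  have c13: "cross2 (nth_deriv 1 f s) (nth_deriv 3 f s) = \<epsilon> * m s * (m s * W1 s + 2 * m1 s * W s)"
    unfolding f1 f23 by (simp add: cross2_simps)
  have i12: "nth_deriv 1 f s \<bullet> nth_deriv 2 f s = m s * m1 s"
  proof -
    have "?e s \<bullet> ?n s = 0" "?e s \<bullet> ?e s = 1"
      using eps2 norm_dir[OF eps, of "\<Theta> s"]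
      by (simp_all add: inner_vec_def sum_2 sin_add cos_add norm_eq_1)
    then show ?thesis unfolding f1 f23 by (simp add: inner_add_right)
  qed
  have mW: "m s > 0" "W s > 0" "m s = \<rho> (\<Theta> s) * W s" using m_pos Theta'_pos m_eq by (simp_all add: W_def)
  let ?r = "\<rho> (\<Theta> s)" and ?r' = "vector_derivative \<rho> (at (\<Theta> s))"
  show "curv_jet (nth_deriv 1 f s) (nth_deriv 2 f s) = \<epsilon> / ?r"
    unfolding curv_jet_def n1 c12 using mW(1,2) rho_pos[of "\<Theta> s"] by (simp add: mW(3) power2_eq_square power3_eq_cube)
  have "((\<lambda>t. \<rho> (\<Theta> t) * W t) has_real_derivative ?r' * W s * W s + W1 s * ?r) (at s)"
    by (intro DERIV_mult DERIV_chain2[OF rho_deriv W] dW)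
  moreover have "m = (\<lambda>t. \<rho> (\<Theta> t) * W t)" using m_eq by (simp add: W_def fun_eq_iff)
  ultimately have m1: "m1 s = ?r' * W s * W s + W1 s * ?r" using dm(1) DERIV_unique by metis
  have "dcurv_jet (nth_deriv 1 f s) (nth_deriv 2 f s) (nth_deriv 3 f s) =
      \<epsilon> * (m s) ^ 3 * (m s * W1 s - m1 s * W s) / m s ^ 6"
    unfolding dcurv_jet_def n1 c12 c13 i12 by (simp add: algebra_simps power2_eq_square power3_eq_cube)
  also have "m s * W1 s - m1 s * W s = - (?r' * W s ^ 3)"
    unfolding m1 mW(3) by (simp add: algebra_simps power3_eq_cube)
  also have "\<epsilon> * (m s) ^ 3 * - (?r' * W s ^ 3) / m s ^ 6 = - \<epsilon> * ?r' / ?r ^ 3"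
  proof -
    have "m s ^ 6 = m s ^ 3 * (?r ^ 3 * W s ^ 3)"
      using mW(3) by (metis power_add[of "m s" 3 3] power_mult_distrib numeral_Bit0)
    then show ?thesis using mW(1,2) by simp
  qed
  finally show "dcurv_jet (nth_deriv 1 f s) (nth_deriv 2 f s) (nth_deriv 3 f s) = - \<epsilon> * ?r' / ?r ^ 3" .
qed

text \<open>Converse of \<open>convex_curve_angle_rep\<close>; it shows that the perturbed curves
  stay convex.\<close>

lemma is_convex_curve: "convex_curve f"
proof -
  have "inj_on f {0..<2 * pi}"
  proof (rule linorder_inj_onI')
    fix i j :: real assume "i \<in> {0..<2 * pi}" "j \<in> {0..<2 * pi}" "i < j"
    then show "f i \<noteq> f j" by (intro f_ne) auto
  qed
  moreover have "nth_deriv 1 f t \<noteq> 0" for t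
    using m_pos[of t] dir_ne_0[OF eps] by (simp add: f_deriv1 del: One_nat_def)
  moreover have "curvature f t \<noteq> 0" for t
  proof -
    have "curvature f t = \<epsilon> / \<rho> (\<Theta> t)"
      unfolding curvature_jets(1)[symmetric] by (simp add: curvature_def curv_jet_def cross2_def)
    then show ?thesis using rho_pos[of "\<Theta> t"] eps by auto
  qed
  ultimately show ?thesis
    using sm_f f_per by (simp add: convex_curve_def smooth_closed_curve_def)
qed

lemma rho_deriv_per: "vector_derivative \<rho> (at (\<theta> + 2 * pi)) = vector_derivative \<rho> (at \<theta>)"
  by (rule vector_derivative_periodic[OF smooth_on_has_vector_derivative[OF open_UNIV sm_rho]]) (auto simp: rho_per)

text \<open>The zero determinant and the nonpositive inner product make the two angles differ by an
  odd multiple of \<open>pi\<close>; periodicity of \<open>\<rho>\<close> reduces this to a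
  difference of exactly \<open>pi\<close>.\<close>

lemma degenerate_iff:
  "(\<exists>s t. degenerate_pair f s t) \<longleftrightarrow>
   (\<exists>\<theta>. \<rho> \<theta> = \<rho> (\<theta> + pi) \<and> vector_derivative \<rho> (at \<theta>) = vector_derivative \<rho> (at (\<theta> + pi)))"
proof -
  have e0: "\<epsilon> \<noteq> 0" using eps by auto
  have cross: "cross2 (nth_deriv 1 f s) (nth_deriv 1 f t) = 0 \<longleftrightarrow> sin (\<Theta> t - \<Theta> s) = 0" for s t
    using m_pos[of s] m_pos[of t] e0
    by (simp add: f_deriv1 cross2_simps del: One_nat_def)
  have inner: "nth_deriv 1 f s \<bullet> nth_deriv 1 f t = m s * m t * cos (\<Theta> t - \<Theta> s)" for s t
  proof -
    have "dir \<epsilon> (\<Theta> s) \<bullet> dir \<epsilon> (\<Theta> t) = cos (\<Theta> t - \<Theta> s)"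
      using eps by (auto simp: inner_vec_def sum_2 cos_diff algebra_simps)
    then show ?thesis by (simp add: f_deriv1 del: One_nat_def)
  qed
  have jet_eq: "curv_jet (nth_deriv 1 f s) (nth_deriv 2 f s) = curv_jet (nth_deriv 1 f t) (nth_deriv 2 f t) \<and>
     dcurv_jet (nth_deriv 1 f s) (nth_deriv 2 f s) (nth_deriv 3 f s) =
     dcurv_jet (nth_deriv 1 f t) (nth_deriv 2 f t) (nth_deriv 3 f t) \<longleftrightarrow>
     \<rho> (\<Theta> s) = \<rho> (\<Theta> t) \<and> vector_derivative \<rho> (at (\<Theta> s)) = vector_derivative \<rho> (at (\<Theta> t))" for s t
  proof -
    have p: "\<rho> (\<Theta> s) \<noteq> 0" "\<rho> (\<Theta> t) \<noteq> 0" using rho_pos by (metis less_irrefl)+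
    then have "\<epsilon> / \<rho> (\<Theta> s) = \<epsilon> / \<rho> (\<Theta> t) \<longleftrightarrow> \<rho> (\<Theta> s) = \<rho> (\<Theta> t)" using e0 by auto
    then show ?thesis unfolding curvature_jets using e0 p by auto
  qed
  show ?thesis
  proof
    assume "\<exists>s t. degenerate_pair f s t"
    then obtain s t where d: "degenerate_pair f s t" by blast
    then have sc: "sin (\<Theta> t - \<Theta> s) = 0" "cos (\<Theta> t - \<Theta> s) \<le> 0"
      and r: "\<rho> (\<Theta> s) = \<rho> (\<Theta> t)" "vector_derivative \<rho> (at (\<Theta> s)) = vector_derivative \<rho> (at (\<Theta> t))"
      using jet_eq[of s t] cross[of s t] inner[of s t] m_pos[of s] m_pos[of t]
      unfolding degenerate_pair_def by (auto simp: mult_le_0_iff zero_less_mult_iff dest: order.strict_implies_order)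
    obtain i :: int where i: "\<Theta> t - \<Theta> s = of_int i * pi" using sc(1) by (auto simp: sin_zero_iff_int2)
    have "odd i"
    proof
      assume "even i"
      then obtain j where "i = 2 * j" by (rule evenE)
      then have "cos (\<Theta> t - \<Theta> s) = 1" unfolding i using cos_int_2pin[of j] by (simp add: mult_ac)
      then show False using sc(2) by simp
    qed
    then obtain j where "i = 2 * j + 1" by (rule oddE)
    then have t: "\<Theta> t = \<Theta> s + pi + of_int j * (2 * pi)" using i by (simp add: algebra_simps)
    have "\<rho> (\<Theta> t) = \<rho> (\<Theta> s + pi)" unfolding t by (rule periodic_of_int) (rule rho_per)
    moreover have "vector_derivative \<rho> (at (\<Theta> t)) = vector_derivative \<rho> (at (\<Theta> s + pi))"
      unfolding t by (rule periodic_of_int[of "\<lambda>x. vector_derivative \<rho> (at x)"]) (rule rho_deriv_per)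
    ultimately show "\<exists>\<theta>. \<rho> \<theta> = \<rho> (\<theta> + pi) \<and> vector_derivative \<rho> (at \<theta>) = vector_derivative \<rho> (at (\<theta> + pi))"
      using r by metis
  next
    assume "\<exists>\<theta>. \<rho> \<theta> = \<rho> (\<theta> + pi) \<and> vector_derivative \<rho> (at \<theta>) = vector_derivative \<rho> (at (\<theta> + pi))"
    then obtain \<theta> where \<theta>: "\<rho> \<theta> = \<rho> (\<theta> + pi)" "vector_derivative \<rho> (at \<theta>) = vector_derivative \<rho> (at (\<theta> + pi))" by blast
    have "\<Theta> (T (\<theta> + pi)) - \<Theta> (T \<theta>) = pi" by simp
    moreover have "m (T \<theta>) * m (T (\<theta> + pi)) > 0" by (simp add: m_pos)
    ultimately have "degenerate_pair f (T \<theta>) (T (\<theta> + pi))"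
      unfolding degenerate_pair_def cross inner jet_eq using \<theta> by simp
    then show "\<exists>s t. degenerate_pair f s t" by blast
  qed
qed

text \<open>\<open>q \<theta> = 1/2\<close> says that \<open>\<rho>\<close> agrees at
  \<open>\<theta>\<close> and \<open>\<theta> + pi\<close>. The derivative of \<open>q\<close> is
  then a nonzero multiple of the difference of the derivatives of \<open>\<rho>\<close> there, so a
  critical point would be a degenerate pair.\<close>

lemma q_half_regular:
  assumes "\<And>s t. \<not> degenerate_pair f s t" "q \<theta> = 1/2"
  shows "vector_derivative q (at \<theta>) \<noteq> 0"
proof
  assume z: "vector_derivative q (at \<theta>) = 0"
  let ?a = "\<rho> \<theta>" and ?b = "\<rho> (\<theta> + pi)"
  let ?a' = "vector_derivative \<rho> (at \<theta>)" and ?b' = "vector_derivative \<rho> (at (\<theta> + pi))"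
  have pos: "?a > 0" "?b > 0" by (rule rho_pos)+
  then have ab: "?a = ?b" using assms(2) by (simp add: q_def field_simps)
  have dp: "((\<lambda>x. \<rho> (x + pi)) has_real_derivative ?b' * 1) (at \<theta>)"
    by (rule DERIV_chain2[OF rho_deriv]) (auto intro!: derivative_eq_intros)
  have "(q has_real_derivative ((?b' * 1) * (?a + ?b) - ?b * (?a' + ?b' * 1)) / ((?a + ?b) * (?a + ?b))) (at \<theta>)"
    unfolding q_def[abs_def] using pos
    by (intro DERIV_divide dp DERIV_add rho_deriv) auto
  then have "((?b' * 1) * (?a + ?b) - ?b * (?a' + ?b' * 1)) / ((?a + ?b) * (?a + ?b)) = 0"
    using q_deriv z DERIV_unique by metis
  then have "(?b' - ?a') * ?b = 0" using pos by (simp add: ab algebra_simps)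
  then have "?a' = ?b'" using pos by simp
  then show False using degenerate_iff assms(1) ab by blast
qed

end

lemma generic_curves_conclusion:
  assumes "f \<in> generic_curves"
  shows "(\<exists>L. open L \<and> closure L = (UNIV :: real set) \<and>
        (\<forall>l\<in>L. l \<noteq> 1/2 \<longrightarrow>
          only_cusp_singularities (equidistant l f) \<and>
          finite (equidistant_cusps l f) \<and> even (card (equidistant_cusps l f)))) \<and>
      only_cusp_singularities (equidistant (1/2) f) \<and>
      finite (wigner_cusps f) \<and> odd (card (wigner_cusps f))"
proof -
  have f: "convex_curve f" "\<And>s t. \<not> degenerate_pair f s t" using assms by (auto simp: generic_curves_def)
  obtain m \<Theta> \<epsilon> where "angle_rep f m \<Theta> \<epsilon>" by (rule convex_curve_angle_rep[OF f(1)])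
  then interpret angle_curve f m \<Theta> \<epsilon> by unfold_locales
  show ?thesis by (rule generic_conclusion) (rule q_half_regular[OF f(2)])
qed

section \<open>Density of the generic set by third-harmonic perturbations\<close>

lemma smooth_closed_curve_bounded:
  assumes "smooth_closed_curve f"
  obtains M where "\<And>j t. j \<le> k \<Longrightarrow> norm (nth_deriv j f t) \<le> M"
proof -
  have "\<exists>M. \<forall>t. norm (nth_deriv j f t) \<le> M" for j
  proof -
    obtain s where "\<And>t. norm (nth_deriv j f t) \<le> norm (nth_deriv j f s)"
      by (rule periodic_bounded[of "\<lambda>t. norm (nth_deriv j f t)"])
        (use nth_deriv_continuous nth_deriv_periodic assms in \<open>auto intro!: continuous_on_norm\<close>)
    then show ?thesis by blast
  qed
  then obtain M where M: "\<And>j t. norm (nth_deriv j f t) \<le> M j" by metis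
  have "norm (nth_deriv j f t) \<le> Max (M ` {..k})" if "j \<le> k" for j t
    by (rule order_trans[OF M Max_ge]) (use that in auto)
  then show thesis by (rule that)
qed

lemma vector2_has_derivative:
  assumes "(a has_real_derivative a') (at t)" "(b has_real_derivative b') (at t)"
  shows "((\<lambda>t. vector [a t, b t] :: real^2) has_vector_derivative vector [a', b']) (at t)"
proof -
  have eq: "vector [x, y] = x *\<^sub>R (vector [1,0] :: real^2) + y *\<^sub>R vector [0,1]" for x y
    by (simp add: vec_eq_iff forall_2)
  show ?thesis unfolding eq[of "a _"] eq[of a']
    using has_vector_derivative_add[OF has_vector_derivative_scaleR[OF assms(1) has_vector_derivative_const]
        has_vector_derivative_scaleR[OF assms(2) has_vector_derivative_const]] by simp
qed

text \<open>Antiderivatives of \<open>cos 3\<theta>\<close> and \<open>sin 3\<theta>\<close> times the unit tangent. The third harmonic is the lowest one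
  that is odd under \<open>\<theta> \<mapsto> \<theta> + \<pi>\<close> and still gives closed curves.\<close>

definition harm1 :: "real \<Rightarrow> real \<Rightarrow> real^2" where
  "harm1 \<epsilon> \<theta> = vector [sin (2 * \<theta>) / 4 + sin (4 * \<theta>) / 8, \<epsilon> * (cos (2 * \<theta>) / 4 - cos (4 * \<theta>) / 8)]"

definition harm2 :: "real \<Rightarrow> real \<Rightarrow> real^2" where
  "harm2 \<epsilon> \<theta> = vector [- (cos (2 * \<theta>) / 4) - cos (4 * \<theta>) / 8, \<epsilon> * (sin (2 * \<theta>) / 4 - sin (4 * \<theta>) / 8)]"

lemma harm_deriv:
  shows "(harm1 \<epsilon> has_vector_derivative cos (3 * \<theta>) *\<^sub>R dir \<epsilon> \<theta>) (at \<theta>)"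
    and "(harm2 \<epsilon> has_vector_derivative sin (3 * \<theta>) *\<^sub>R dir \<epsilon> \<theta>) (at \<theta>)"
proof -
  have e: "cos (4 * \<theta>) = cos (3 * \<theta>) * cos \<theta> - sin (3 * \<theta>) * sin \<theta>"
    "sin (4 * \<theta>) = sin (3 * \<theta>) * cos \<theta> + cos (3 * \<theta>) * sin \<theta>"
    "cos (2 * \<theta>) = cos (3 * \<theta>) * cos \<theta> + sin (3 * \<theta>) * sin \<theta>"
    "sin (2 * \<theta>) = sin (3 * \<theta>) * cos \<theta> - cos (3 * \<theta>) * sin \<theta>"
    using cos_add[of "3 * \<theta>" \<theta>] sin_add[of "3 * \<theta>" \<theta>] cos_diff[of "3 * \<theta>" \<theta>] sin_diff[of "3 * \<theta>" \<theta>]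
    by simp_all
  have c: "cos (3 * \<theta>) *\<^sub>R dir \<epsilon> \<theta> = vector [cos (2 * \<theta>) / 2 + cos (4 * \<theta>) / 2, \<epsilon> * (- (sin (2 * \<theta>) / 2) + sin (4 * \<theta>) / 2)]"
    unfolding e by (simp add: vec_eq_iff forall_2 field_simps)
  have s: "sin (3 * \<theta>) *\<^sub>R dir \<epsilon> \<theta> = vector [sin (2 * \<theta>) / 2 + sin (4 * \<theta>) / 2, \<epsilon> * (cos (2 * \<theta>) / 2 - cos (4 * \<theta>) / 2)]"
    unfolding e by (simp add: vec_eq_iff forall_2 field_simps)
  show "(harm1 \<epsilon> has_vector_derivative cos (3 * \<theta>) *\<^sub>R dir \<epsilon> \<theta>) (at \<theta>)"
    unfolding c harm1_def[abs_def] by (rule vector2_has_derivative) (auto intro!: derivative_eq_intros)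
  show "(harm2 \<epsilon> has_vector_derivative sin (3 * \<theta>) *\<^sub>R dir \<epsilon> \<theta>) (at \<theta>)"
    unfolding s harm2_def[abs_def] by (rule vector2_has_derivative) (auto intro!: derivative_eq_intros simp: algebra_simps)
qed

lemma harm_smooth: "smooth_on UNIV (harm1 \<epsilon>)" "smooth_on UNIV (harm2 \<epsilon>)"
proof -
  have "smooth_on UNIV (\<lambda>\<theta>. cos (3 * \<theta>) *\<^sub>R dir \<epsilon> \<theta>)" "smooth_on UNIV (\<lambda>\<theta>. sin (3 * \<theta>) *\<^sub>R dir \<epsilon> \<theta>)"
    by (intro smooth_on_scaleR smooth_on_cos smooth_on_sin smooth_on_dir smooth_on_mult smooth_on_const smooth_on_id open_UNIV)+
  then show "smooth_on UNIV (harm1 \<epsilon>)" "smooth_on UNIV (harm2 \<epsilon>)"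
    using smooth_on_derivI[OF open_UNIV harm_deriv(1)] smooth_on_derivI[OF open_UNIV harm_deriv(2)] by blast+
qed

lemma trig_per: "cos (of_nat n * (\<theta> + 2 * pi)) = cos (of_nat n * \<theta>)" "sin (of_nat n * (\<theta> + 2 * pi)) = sin (of_nat n * \<theta>)"
proof -
  have e: "of_nat n * (\<theta> + 2 * pi) = of_nat n * \<theta> + of_int (int n) * (2 * pi)" by (simp add: algebra_simps)
  show "cos (of_nat n * (\<theta> + 2 * pi)) = cos (of_nat n * \<theta>)" "sin (of_nat n * (\<theta> + 2 * pi)) = sin (of_nat n * \<theta>)"
    unfolding e by (rule periodic_of_int, simp)+
qed

lemma harm_per: "harm1 \<epsilon> (\<theta> + 2 * pi) = harm1 \<epsilon> \<theta>" "harm2 \<epsilon> (\<theta> + 2 * pi) = harm2 \<epsilon> \<theta>"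
  using trig_per[of 2 \<theta>] trig_per[of 4 \<theta>] by (simp_all add: harm1_def harm2_def)

context angle_curve
begin

text \<open>The added velocity is tangential, so the angle function is unchanged and only the radius
  of curvature is modified.\<close>

lemma perturbed_rep:
  assumes "\<And>\<theta>. 0 < \<rho> \<theta> + (a * cos (3 * \<theta>) + b * sin (3 * \<theta>))"
  shows "angle_rep (\<lambda>s. f s + (a *\<^sub>R harm1 \<epsilon> (\<Theta> s) + b *\<^sub>R harm2 \<epsilon> (\<Theta> s)))
    (\<lambda>s. (\<rho> (\<Theta> s) + (a * cos (3 * \<Theta> s) + b * sin (3 * \<Theta> s))) * vector_derivative \<Theta> (at s)) \<Theta> \<epsilon>"
  unfolding angle_rep_def
proof (intro conjI allI)
  show "smooth_on UNIV (\<lambda>s. (\<rho> (\<Theta> s) + (a * cos (3 * \<Theta> s) + b * sin (3 * \<Theta> s))) * vector_derivative \<Theta> (at s))"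
    by (intro smooth_on_mult smooth_on_add smooth_on_const smooth_on_cos smooth_on_sin sm_Theta
        smooth_on_compose_UNIV[OF _ sm_rho] smooth_on_vector_derivative open_UNIV)
  show "0 < (\<rho> (\<Theta> s) + (a * cos (3 * \<Theta> s) + b * sin (3 * \<Theta> s))) * vector_derivative \<Theta> (at s)" for s
    by (rule mult_pos_pos[OF assms Theta'_pos])
  show "(\<rho> (\<Theta> (s + 2 * pi)) + (a * cos (3 * \<Theta> (s + 2 * pi)) + b * sin (3 * \<Theta> (s + 2 * pi)))) * vector_derivative \<Theta> (at (s + 2 * pi))
      = (\<rho> (\<Theta> s) + (a * cos (3 * \<Theta> s) + b * sin (3 * \<Theta> s))) * vector_derivative \<Theta> (at s)" for s
    using trig_per[of 3 "\<Theta> s"] by (simp add: Theta_per rho_per Theta'_per)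
  show "((\<lambda>s. f s + (a *\<^sub>R harm1 \<epsilon> (\<Theta> s) + b *\<^sub>R harm2 \<epsilon> (\<Theta> s))) has_vector_derivative
      ((\<rho> (\<Theta> s) + (a * cos (3 * \<Theta> s) + b * sin (3 * \<Theta> s))) * vector_derivative \<Theta> (at s)) *\<^sub>R dir \<epsilon> (\<Theta> s)) (at s)" for s
  proof -
    let ?d = "vector_derivative \<Theta> (at s)"
    have T: "(\<Theta> has_vector_derivative ?d) (at s)"
      using Theta_deriv by (simp add: has_real_derivative_iff_has_vector_derivative)
    have "((\<lambda>s. harm1 \<epsilon> (\<Theta> s)) has_vector_derivative ?d *\<^sub>R (cos (3 * \<Theta> s) *\<^sub>R dir \<epsilon> (\<Theta> s))) (at s)"
      "((\<lambda>s. harm2 \<epsilon> (\<Theta> s)) has_vector_derivative ?d *\<^sub>R (sin (3 * \<Theta> s) *\<^sub>R dir \<epsilon> (\<Theta> s))) (at s)"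
      using vector_diff_chain_at[OF T harm_deriv(1)] vector_diff_chain_at[OF T harm_deriv(2)] by (simp_all add: o_def)
    note h = this
    have "((\<lambda>s. f s + (a *\<^sub>R harm1 \<epsilon> (\<Theta> s) + b *\<^sub>R harm2 \<epsilon> (\<Theta> s))) has_vector_derivative
      m s *\<^sub>R dir \<epsilon> (\<Theta> s) + (a *\<^sub>R (?d *\<^sub>R (cos (3 * \<Theta> s) *\<^sub>R dir \<epsilon> (\<Theta> s))) + b *\<^sub>R (?d *\<^sub>R (sin (3 * \<Theta> s) *\<^sub>R dir \<epsilon> (\<Theta> s))))) (at s)"
      by (intro has_vector_derivative_add f_deriv h bounded_linear.has_vector_derivative[OF bounded_linear_scaleR_right])
    moreover have "m s *\<^sub>R dir \<epsilon> (\<Theta> s) + (a *\<^sub>R (?d *\<^sub>R (cos (3 * \<Theta> s) *\<^sub>R dir \<epsilon> (\<Theta> s))) + b *\<^sub>R (?d *\<^sub>R (sin (3 * \<Theta> s) *\<^sub>R dir \<epsilon> (\<Theta> s))))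
      = ((\<rho> (\<Theta> s) + (a * cos (3 * \<Theta> s) + b * sin (3 * \<Theta> s))) * ?d) *\<^sub>R dir \<epsilon> (\<Theta> s)"
      using m_eq[of s] by (simp add: scaleR_add_left distrib_right distrib_left mult_ac)
    ultimately show ?thesis by (simp only:)
  qed
  show "f (s + 2 * pi) + (a *\<^sub>R harm1 \<epsilon> (\<Theta> (s + 2 * pi)) + b *\<^sub>R harm2 \<epsilon> (\<Theta> (s + 2 * pi)))
      = f s + (a *\<^sub>R harm1 \<epsilon> (\<Theta> s) + b *\<^sub>R harm2 \<epsilon> (\<Theta> s))" for s
    by (simp add: Theta_per f_per harm_per)
qed (rule sm_Theta Theta'_pos Theta_per eps)+

text \<open>Thom's transversality argument: for each angle exactly one pair of coefficients is bad,
  so the bad pairs form a differentiable curve in the plane, which is negligible.\<close>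

lemma good_coefficients:
  assumes "\<delta> > 0"
  obtains a b where "\<bar>a\<bar> < \<delta>" "\<bar>b\<bar> < \<delta>"
    "\<And>\<theta>. \<not> (\<rho> \<theta> - \<rho> (\<theta> + pi) + 2 * a * cos (3 * \<theta>) + 2 * b * sin (3 * \<theta>) = 0 \<and>
         vector_derivative \<rho> (at \<theta>) - vector_derivative \<rho> (at (\<theta> + pi)) - 6 * a * sin (3 * \<theta>) + 6 * b * cos (3 * \<theta>) = 0)"
proof -
  define u where "u \<theta> = \<rho> \<theta> - \<rho> (\<theta> + pi)" for \<theta>
  define v where "v \<theta> = vector_derivative \<rho> (at \<theta>) - vector_derivative \<rho> (at (\<theta> + pi))" for \<theta>
  \<comment> \<open>\<open>B \<theta>\<close> is the unique solution \<open>(a, b)\<close> of the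
    two bad equations at \<open>\<theta>\<close>. Their determinant is the constant 12, so a
    solution exists for every angle.\<close>
  define B where "B \<theta> = (- (u \<theta> * cos (3 * \<theta>)) / 2 + v \<theta> * sin (3 * \<theta>) / 6, - (u \<theta> * sin (3 * \<theta>)) / 2 - v \<theta> * cos (3 * \<theta>) / 6)" for \<theta>
  have su: "smooth_on UNIV u" unfolding u_def[abs_def]
    by (intro smooth_on_diff sm_rho smooth_on_compose_UNIV[OF _ sm_rho] smooth_on_add smooth_on_id smooth_on_const open_UNIV)
  have sv: "smooth_on UNIV v" unfolding v_def[abs_def]
    by (intro smooth_on_diff smooth_on_compose_UNIV[OF _ smooth_on_vector_derivative[OF open_UNIV sm_rho], of UNIV "\<lambda>x. x + pi"]
        smooth_on_vector_derivative sm_rho smooth_on_add smooth_on_id smooth_on_const open_UNIV)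
  have "smooth_on UNIV (\<lambda>\<theta>. fst (B \<theta>))" "smooth_on UNIV (\<lambda>\<theta>. snd (B \<theta>))"
    unfolding B_def fst_conv snd_conv
    by (intro smooth_on_add smooth_on_diff smooth_on_linear[OF bounded_linear_divide] smooth_on_minus smooth_on_mult
        smooth_on_cos smooth_on_sin smooth_on_const smooth_on_id su sv open_UNIV)+
  then have "(\<lambda>\<theta>. (fst (B \<theta>), snd (B \<theta>))) differentiable (at \<theta>)" for \<theta>
    using smooth_on_differentiable UNIV_I has_derivative_Pair unfolding differentiable_def by metis
  then have "B differentiable_on UNIV"
    by (simp add: differentiable_on_def)
  then have neg: "negligible (range B)"
    by (rule negligible_differentiable_image_lowdim[rotated]) simp
  have "\<not> ball 0 \<delta> \<subseteq> range B"
    using negligible_subset[OF neg] open_not_negligible[of "ball 0 \<delta>"] assms by auto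
  then obtain c where c: "c \<in> ball 0 \<delta>" "c \<notin> range B" by blast
  obtain a b where ab: "c = (a, b)" by force
  have "\<bar>a\<bar> < \<delta>" "\<bar>b\<bar> < \<delta>"
    using c(1) norm_fst_le[of a b] norm_snd_le[of b a] by (auto simp: ab)
  moreover have False if e: "u \<theta> + 2 * a * cos (3 * \<theta>) + 2 * b * sin (3 * \<theta>) = 0"
      "v \<theta> - 6 * a * sin (3 * \<theta>) + 6 * b * cos (3 * \<theta>) = 0" for \<theta>
  proof -
    let ?c = "cos (3 * \<theta>)" and ?s = "sin (3 * \<theta>)"
    have alg: "- ((- 2 * a * c - 2 * b * s) * c) / 2 + (6 * a * s - 6 * b * c) * s / 6 = a * (s\<^sup>2 + c\<^sup>2)"
      "- ((- 2 * a * c - 2 * b * s) * s) / 2 - (6 * a * s - 6 * b * c) * c / 6 = b * (s\<^sup>2 + c\<^sup>2)" for c s :: real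
      by (simp_all add: field_simps power2_eq_square)
    have u: "u \<theta> = - 2 * a * ?c - 2 * b * ?s" and v: "v \<theta> = 6 * a * ?s - 6 * b * ?c" using e by linarith+
    have "- (u \<theta> * ?c) / 2 + v \<theta> * ?s / 6 = a * (?s\<^sup>2 + ?c\<^sup>2)" "- (u \<theta> * ?s) / 2 - v \<theta> * ?c / 6 = b * (?s\<^sup>2 + ?c\<^sup>2)"
      unfolding u v alg by (rule refl)+
    then have "B \<theta> = c" unfolding ab B_def sin_cos_squared_add by simp
    then show False using c(2) by blast
  qed
  ultimately show thesis using that[of a b] unfolding u_def v_def by blast
qed

lemma generic_dense:
  assumes "e > 0"
  obtains g where "g \<in> generic_curves" "g \<in> Cinf_ball f k e"
proof -
  obtain x where x: "\<And>\<theta>. - \<rho> \<theta> \<le> - \<rho> x"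
    by (rule periodic_bounded[of "\<lambda>\<theta>. - \<rho> \<theta>"])
      (use smooth_on_imp_continuous[OF sm_rho] rho_per in \<open>auto intro: continuous_on_minus\<close>)
  have smcf: "smooth_closed_curve f" using sm_f f_per by (simp add: smooth_closed_curve_def)
  define V1 where "V1 s = harm1 \<epsilon> (\<Theta> s)" for s
  define V2 where "V2 s = harm2 \<epsilon> (\<Theta> s)" for s
  have sV: "smooth_closed_curve V1" "smooth_closed_curve V2"
    unfolding smooth_closed_curve_def V1_def[abs_def] V2_def[abs_def]
    using smooth_on_compose_UNIV[OF open_UNIV harm_smooth(1) sm_Theta] smooth_on_compose_UNIV[OF open_UNIV harm_smooth(2) sm_Theta]
    by (auto simp: Theta_per harm_per)
  obtain M1 where M1: "\<And>j t. j \<le> k \<Longrightarrow> norm (nth_deriv j V1 t) \<le> M1"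
    by (rule smooth_closed_curve_bounded[OF sV(1)]) (rule that)
  obtain M2 where M2: "\<And>j t. j \<le> k \<Longrightarrow> norm (nth_deriv j V2 t) \<le> M2"
    by (rule smooth_closed_curve_bounded[OF sV(2)]) (rule that)
  have M0: "0 \<le> M1" "0 \<le> M2"
    using order_trans[OF norm_ge_zero M1[of 0 0]] order_trans[OF norm_ge_zero M2[of 0 0]] by auto
  \<comment> \<open>\<open>\<rho> x\<close> is the minimum of \<open>\<rho>\<close>, so coefficients
    below half of it keep the new radius positive. The second bound makes the perturbation smaller
    than \<open>e\<close> in all derivatives up to order \<open>k\<close>; the summand 1 avoids
    division by 0.\<close>
  define \<delta> where "\<delta> = min (\<rho> x / 2) (e / (M1 + M2 + 1))"
  have \<delta>: "\<delta> > 0" "\<delta> \<le> \<rho> x / 2" "\<delta> * (M1 + M2) < e"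
  proof -
    show "\<delta> > 0" using assms M0 rho_pos[of x] by (simp add: \<delta>_def)
    show "\<delta> \<le> \<rho> x / 2" unfolding \<delta>_def by (rule min.cobounded1)
    have "\<delta> * (M1 + M2 + 1) \<le> e"
    proof -
      have "\<delta> \<le> e / (M1 + M2 + 1)" by (simp add: \<delta>_def)
      then show ?thesis using M0 by (simp add: pos_le_divide_eq)
    qed
    then show "\<delta> * (M1 + M2) < e" using \<open>\<delta> > 0\<close> by (simp add: algebra_simps)
  qed
  obtain a b where ab: "\<bar>a\<bar> < \<delta>" "\<bar>b\<bar> < \<delta>"
    "\<And>\<theta>. \<not> (\<rho> \<theta> - \<rho> (\<theta> + pi) + 2 * a * cos (3 * \<theta>) + 2 * b * sin (3 * \<theta>) = 0 \<and>
         vector_derivative \<rho> (at \<theta>) - vector_derivative \<rho> (at (\<theta> + pi)) - 6 * a * sin (3 * \<theta>) + 6 * b * cos (3 * \<theta>) = 0)"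
    by (rule good_coefficients[OF \<delta>(1)]) (rule that)
  have pos: "0 < \<rho> \<theta> + (a * cos (3 * \<theta>) + b * sin (3 * \<theta>))" for \<theta>
  proof -
    have "\<bar>a * cos (3 * \<theta>)\<bar> \<le> \<bar>a\<bar> * 1" "\<bar>b * sin (3 * \<theta>)\<bar> \<le> \<bar>b\<bar> * 1"
      unfolding abs_mult by (intro mult_left_mono; simp)+
    then show ?thesis using ab(1,2) \<delta>(2) x[of \<theta>] by linarith
  qed
  define g where "g s = f s + (a *\<^sub>R V1 s + b *\<^sub>R V2 s)" for s
  define m' where "m' s = (\<rho> (\<Theta> s) + (a * cos (3 * \<Theta> s) + b * sin (3 * \<Theta> s))) * vector_derivative \<Theta> (at s)" for s
  have "angle_rep g m' \<Theta> \<epsilon>"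
    using perturbed_rep[OF pos] unfolding g_def[abs_def] m'_def[abs_def] V1_def V2_def .
  then interpret g: angle_curve g m' \<Theta> \<epsilon> by unfold_locales
  have g\<rho>: "g.\<rho> \<theta> = \<rho> \<theta> + (a * cos (3 * \<theta>) + b * sin (3 * \<theta>))" for \<theta>
    using Theta'_pos[of "T \<theta>"] by (simp add: g.\<rho>_def m'_def)
  have g\<rho>': "vector_derivative g.\<rho> (at \<theta>) = vector_derivative \<rho> (at \<theta>) + (- 3 * a * sin (3 * \<theta>) + 3 * b * cos (3 * \<theta>))" for \<theta>
  proof -
    have "((\<lambda>\<theta>. a * cos (3 * \<theta>) + b * sin (3 * \<theta>)) has_real_derivative (- 3 * a * sin (3 * \<theta>) + 3 * b * cos (3 * \<theta>))) (at \<theta>)"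
      by (auto intro!: derivative_eq_intros)
    from DERIV_add[OF rho_deriv this]
    have "(g.\<rho> has_real_derivative vector_derivative \<rho> (at \<theta>) + (- 3 * a * sin (3 * \<theta>) + 3 * b * cos (3 * \<theta>))) (at \<theta>)"
      unfolding g\<rho>[abs_def] .
    then show ?thesis using g.rho_deriv DERIV_unique by blast
  qed
  \<comment> \<open>Since the third harmonics change sign under a half turn, the differences between
    partners change by twice the perturbation and twice its derivative: the factors 2 and 6 in
    \<open>good_coefficients\<close>.\<close>
  have trig: "cos (3 * (\<theta> + pi)) = - cos (3 * \<theta>)" "sin (3 * (\<theta> + pi)) = - sin (3 * \<theta>)" for \<theta>
  proof -
    have "3 * (\<theta> + pi) = 3 * \<theta> + pi + 2 * pi" by simp
    then show "cos (3 * (\<theta> + pi)) = - cos (3 * \<theta>)" "sin (3 * (\<theta> + pi)) = - sin (3 * \<theta>)"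
      by (simp_all only: cos_periodic sin_periodic cos_periodic_pi sin_periodic_pi)
  qed
  have "\<not> degenerate_pair g s t" for s t
  proof
    assume "degenerate_pair g s t"
    then obtain \<theta> where "g.\<rho> \<theta> = g.\<rho> (\<theta> + pi)" "vector_derivative g.\<rho> (at \<theta>) = vector_derivative g.\<rho> (at (\<theta> + pi))"
      using g.degenerate_iff by blast
    then show False using ab(3)[of \<theta>] unfolding g\<rho> g\<rho>' trig by (simp add: algebra_simps)
  qed
  then have "g \<in> generic_curves" using g.is_convex_curve by (simp add: generic_curves_def)
  moreover have "g \<in> Cinf_ball f k e"
  proof -
    have smU: "smooth_on UNIV V1" "smooth_on UNIV V2" using sV by (auto simp: smooth_closed_curve_def)
    let ?D = "\<lambda>n t. nth_deriv n f t + (a *\<^sub>R nth_deriv n V1 t + b *\<^sub>R nth_deriv n V2 t)"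
    have "nth_deriv n (?D 0) = ?D n" for n
      by (rule nth_deriv_eqI)
        (intro has_vector_derivative_add bounded_linear.has_vector_derivative[OF bounded_linear_scaleR_right]
          nth_deriv_has_derivative[OF open_UNIV] sm_f smU UNIV_I)
    moreover have "g = ?D 0" by (simp add: g_def fun_eq_iff)
    ultimately have nd: "nth_deriv n g = ?D n" for n by simp
    have "dist (nth_deriv j g t) (nth_deriv j f t) < e" if "j \<le> k" for j t
    proof -
      have "dist (nth_deriv j g t) (nth_deriv j f t) = norm (a *\<^sub>R nth_deriv j V1 t + b *\<^sub>R nth_deriv j V2 t)"
        by (simp add: nd dist_norm)
      also have "\<dots> \<le> \<bar>a\<bar> * norm (nth_deriv j V1 t) + \<bar>b\<bar> * norm (nth_deriv j V2 t)"
        by (rule order_trans[OF norm_triangle_ineq]) simp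
      also have "\<dots> \<le> \<delta> * M1 + \<delta> * M2"
        using ab(1,2) M1[OF that] M2[OF that] M0 by (intro add_mono mult_mono) auto
      also have "\<dots> < e" using \<delta>(3) by (simp add: distrib_left)
      finally show ?thesis .
    qed
    moreover have "smooth_closed_curve g" using g.is_convex_curve by (simp add: convex_curve_def)
    ultimately show ?thesis by (simp add: Cinf_ball_def)
  qed
  ultimately show thesis by (rule that)
qed

end

section \<open>Residuality and conclusion\<close>

lemma topspace_convex: "topspace convex_curve_topology = {f. convex_curve f}"
  by (auto simp: convex_curve_topology_def topspace_subtopology topspace_Cinf convex_curve_def)

text \<open>The set is itself open and dense, so the countable family in \<open>residual_in\<close>
  is a singleton. Density is tested on balls of arbitrary order \<open>k\<close>, since basic
  neighbourhoods may control any number of derivatives.\<close>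

lemma generic_curves_residual: "residual_in convex_curve_topology generic_curves"
proof -
  have "f \<in> convex_curve_topology closure_of generic_curves" if f: "convex_curve f" for f
    unfolding in_closure_of
  proof (intro conjI allI impI)
    show "f \<in> topspace convex_curve_topology" using f by (simp add: topspace_convex)
    fix U assume U: "f \<in> U \<and> openin convex_curve_topology U"
    then obtain U' where U': "openin Cinf_topology U'" "U = U' \<inter> {f. convex_curve f}"
      by (auto simp: convex_curve_topology_def openin_subtopology)
    obtain k e where ke: "e > 0" "Cinf_ball f k e \<subseteq> U'"
      using Cinf_nhd[OF U'(1)] U U'(2) by blast
    obtain m \<Theta> \<epsilon> where "angle_rep f m \<Theta> \<epsilon>" by (rule convex_curve_angle_rep[OF f])
    then interpret angle_curve f m \<Theta> \<epsilon> by unfold_locales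
    obtain g where "g \<in> generic_curves" "g \<in> Cinf_ball f k e" by (rule generic_dense[OF ke(1)]) (rule that)
    then show "\<exists>y. y \<in> generic_curves \<and> y \<in> U"
      using ke(2) U'(2) by (auto simp: generic_curves_def)
  qed
  then have "convex_curve_topology closure_of generic_curves = topspace convex_curve_topology"
    using closure_of_subset_topspace by (force simp: topspace_convex)
  moreover have "generic_curves \<subseteq> topspace convex_curve_topology"
    by (auto simp: topspace_convex generic_curves_def)
  ultimately show ?thesis
    unfolding residual_in_def using openin_generic by (intro conjI exI[of _ "{generic_curves}"]) auto
qed

theorem theorem2p16:
  shows "\<exists>G. residual_in convex_curve_topology G \<and>
    (\<forall>f\<in>G.
      (\<exists>L. open L \<and> closure L = (UNIV :: real set) \<and>
        (\<forall>l\<in>L. l \<noteq> 1/2 \<longrightarrow>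
          only_cusp_singularities (equidistant l f) \<and>
          finite (equidistant_cusps l f) \<and> even (card (equidistant_cusps l f)))) \<and>
      only_cusp_singularities (equidistant (1/2) f) \<and>
      finite (wigner_cusps f) \<and> odd (card (wigner_cusps f)))"
  by (rule exI[of _ generic_curves], rule conjI[OF generic_curves_residual], rule ballI, rule generic_curves_conclusion)

end
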